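(* Let $r\in\mathbb{N}_0$. Let $a_0>0$, $b_0\in\mathbb{R}$ be two given constants and let $a(t),b(t)$ be a solution of the Toda hierarchy $\mathrm{TL}_r(a(t),b(t))=0$, that is, of $$\dot a(n,t)=a(n,t)\big(g_{r+1}(n+1,t)-g_{r+1}(n,t)\big),\qquad \dot b(n,t)=h_{r+1}(n,t)-h_{r+1}(n-1,t),\qquad n\in\mathbb{Z},$$ satisfying $$\sum_{n\in\mathbb{Z}}|n|\big(|a(n,t)-a_0|+|b(n,t)-b_0|\big)<\infty$$ for one (and hence for all) $t\in\mathbb{R}$. Suppose that for two different times $t_0<t_1$, some constant $\delta>0$ and some constant $C$, we have $$\sum_{n\geq M}\big(|a(n,t_j)-a_0|+|b(n,t_j)-b_0|\big)\leq C\frac{1}{M^{(1+\delta)2M}},\qquad M>0,\quad j\in\{0,1\}.$$ Then $$a(n,t)=a_0,\qquad b(n,t)=b_0,\qquad (n,t)\in\mathbb{Z}\times\mathbb{R}.$$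
   Context: Here $\mathbb{N}_0=\{0,1,2,\dots\}$ and the dot denotes the derivative with respect to $t$. The sequences $a(t)=(a(n,t))_{n\in\mathbb{Z}}$ and $b(t)=(b(n,t))_{n\in\mathbb{Z}}$, $t\in\mathbb{R}$, satisfy $a(n,t)^2\neq 0$. Associated with them is the Jacobi operator $H(t)$ acting on sequences over $\mathbb{Z}$ by $$(H(t)f)(n)=a(n,t)f(n+1)+a(n-1,t)f(n-1)+b(n,t)f(n).$$ Constants $c_0=1$, $c_j$ for $1\le j\le r$, and $c_{r+1}=0$ are chosen. With $\delta_m(n)=\delta_{m,n}$ (Kronecker delta) and $\langle\delta_m,A\delta_n\rangle$ denoting the matrix elements of an operator $A$ with respect to the basis $(\delta_m)_{m\in\mathbb{Z}}$, set $$g_j(n,t)=\sum_{l=0}^j c_{j-l}\,\tilde g_l(n,t),\qquad \tilde g_l(n,t)=\langle\delta_n,H(t)^l\delta_n\rangle,$$ $$h_j(n,t)=\sum_{l=0}^j c_{j-l}\,\tilde h_l(n,t),\qquad \tilde h_l(n,t)=2a(n,t)\langle\delta_{n+1},H(t)^l\delta_n\rangle.$$ Varying $r\in\mathbb{N}_0$ gives the Toda hierarchy; for $r=0$ one obtains the Toda lattice $\dot a(n,t)=a(n,t)(b(n+1,t)-b(n,t))$, $\dot b(n,t)=2(a(n,t)^2-a(n-1,t)^2)$.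
   Formalization: With only a(n,t)²≠0 the claim fails (flip the sign of a(0,t)); proved instead: |a(n,t)|=a_0, b(n,t)=b_0, and a(n,t)=a_0 if all a(n,t)>0. Boundedness in n of a(t), b(t) at each t, implied by the summability for all t, is assumed; a, b, c_j are real. *)

theory Defs
  imports "HOL-Analysis.Analysis"
begin

definition kdelta :: "int \<Rightarrow> int \<Rightarrow> real"
  where "kdelta m n = (if n = m then 1 else 0)"

text \<open>The Jacobi operator as a difference expression on arbitrary real sequences over the
  integers; \<open>a\<close> and \<open>b\<close> are its coefficients at one fixed time.\<close>

definition jacobi :: "(int \<Rightarrow> real) \<Rightarrow> (int \<Rightarrow> real) \<Rightarrow> (int \<Rightarrow> real) \<Rightarrow> int \<Rightarrow> real"
  where "jacobi a b f n = a n * f (n + 1) + a (n - 1) * f (n - 1) + b n * f n"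

definition matrix_element :: "((int \<Rightarrow> real) \<Rightarrow> int \<Rightarrow> real) \<Rightarrow> int \<Rightarrow> int \<Rightarrow> real"
  where "matrix_element A m n = (\<Sum>\<^sub>\<infinity>k\<in>UNIV. kdelta m k * A (kdelta n) k)"

text \<open>The series above has at most one nonzero term, so it always converges.\<close>

lemma matrix_element_eq: "matrix_element A m n = A (kdelta n) m"
proof -
  have "matrix_element A m n = (\<Sum>\<^sub>\<infinity>k\<in>{m}. kdelta m k * A (kdelta n) k)"
    unfolding matrix_element_def by (rule infsum_cong_neutral) (auto simp: kdelta_def)
  then show ?thesis by (simp add: kdelta_def)
qed

definition g_tilde :: "(int \<Rightarrow> real) \<Rightarrow> (int \<Rightarrow> real) \<Rightarrow> nat \<Rightarrow> int \<Rightarrow> real"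
  where "g_tilde a b l n = matrix_element (jacobi a b ^^ l) n n"

definition h_tilde :: "(int \<Rightarrow> real) \<Rightarrow> (int \<Rightarrow> real) \<Rightarrow> nat \<Rightarrow> int \<Rightarrow> real"
  where "h_tilde a b l n = 2 * a n * matrix_element (jacobi a b ^^ l) (n + 1) n"

definition toda_g :: "(nat \<Rightarrow> real) \<Rightarrow> (int \<Rightarrow> real) \<Rightarrow> (int \<Rightarrow> real) \<Rightarrow> nat \<Rightarrow> int \<Rightarrow> real"
  where "toda_g c a b j n = (\<Sum>l=0..j. c (j - l) * g_tilde a b l n)"

definition toda_h :: "(nat \<Rightarrow> real) \<Rightarrow> (int \<Rightarrow> real) \<Rightarrow> (int \<Rightarrow> real) \<Rightarrow> nat \<Rightarrow> int \<Rightarrow> real"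
  where "toda_h c a b j n = (\<Sum>l=0..j. c (j - l) * h_tilde a b l n)"

text \<open>The equations of the \<open>r\<close>-th member of the Toda hierarchy, for all times. The first
  argument of \<open>a\<close> and \<open>b\<close> is the lattice site, the second one the time. Derivatives are taken
  site by site.\<close>

definition toda_hierarchy ::
  "nat \<Rightarrow> (nat \<Rightarrow> real) \<Rightarrow> (int \<Rightarrow> real \<Rightarrow> real) \<Rightarrow> (int \<Rightarrow> real \<Rightarrow> real) \<Rightarrow> bool"
  where "toda_hierarchy r c a b \<longleftrightarrow>
    (\<forall>n t. let g = toda_g c (\<lambda>m. a m t) (\<lambda>m. b m t) (r + 1);
               h = toda_h c (\<lambda>m. a m t) (\<lambda>m. b m t) (r + 1)
           in (a n has_real_derivative a n t * (g (n + 1) - g n)) (at t) \<and>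
              (b n has_real_derivative h n - h (n - 1)) (at t))"

lemma toda_lattice:
  assumes "c 0 = 1" "c 1 = 0"
  shows "toda_hierarchy 0 c a b \<longleftrightarrow>
    (\<forall>n t. (a n has_real_derivative a n t * (b (n + 1) t - b n t)) (at t) \<and>
           (b n has_real_derivative 2 * ((a n t)\<^sup>2 - (a (n - 1) t)\<^sup>2)) (at t))"
proof -
  have g: "toda_g c x y (0 + 1) n = y n" and h: "toda_h c x y (0 + 1) n = 2 * (x n)\<^sup>2" for x y n
    using assms
    by (simp_all add: toda_g_def toda_h_def g_tilde_def h_tilde_def matrix_element_eq jacobi_def
        kdelta_def power2_eq_square)
  show ?thesis
    unfolding toda_hierarchy_def Let_def g h by (simp add: right_diff_distrib)
qed

end

theory Submission imports Defs "HOL-Complex_Analysis.Complex_Analysis" begin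

text \<open>The right tail decays superexponentially at both times, hence (by Gronwall with exponential weights)
  faster than every exponential at all times. For large \<open>\<zeta>\<close> this allows the right
  reflection coefficient \<open>R(\<zeta>, t)\<close> at the spectral parameter \<open>1 / \<zeta>\<close> to be read off from the diagonal of the
  resolvent alone, with no information on the left end beyond boundedness. The Lax equation gives
  \<open>R(\<zeta>, t1) = exp (\<alpha>(\<zeta>) (t1 - t0)) R(\<zeta>, t0)\<close> where \<open>\<alpha>\<close> grows like \<open>\<zeta> ^ (r + 1)\<close>, while the decay
  hypothesis makes \<open>R\<close> of minimal exponential type at both times. So \<open>R(\<zeta>, t0) R(\<zeta>, t1)\<close> decays exponentially
  along almost all rays, and the Phragmen-Lindelof principle forces it to vanish. If \<open>R = 0\<close>, the entire Jost
  function is proportional to the left Weyl solution near \<open>\<infinity>\<close>, hence bounded, hence constant by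
  Liouville, which makes the coefficients constant.\<close>

section \<open>Powers of the Jacobi operator and the Lax pair\<close>

text \<open>Reading off the reflection coefficient at large \<zeta> costs the weight
  \<open>\<zeta> ^ (2 * N)\<close>, which amplifies the tail of the coefficients. This leads to two
  decay classes. \<open>rapid_decay\<close> makes the limit exist for every large \<zeta> and is
  carried by the flow to all times. The hypothesis at \<open>t0\<close> and \<open>t1\<close> enters
  as the bound \<open>\<epsilon> ^ (2 * n) / fact (2 * n)\<close> for every \<epsilon>, whose
  weighted sum grows no faster than \<open>exp (\<epsilon> * norm \<zeta>)\<close> up to a power of
  \<zeta>; the surplus \<delta> in the exponent is what makes \<epsilon> arbitrary. The real part of
  \<alpha> changes sign from sector to sector, so along a given ray only one of the two reflection
  coefficients is forced to be small, and which one depends on the ray. Their product treats both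
  signs alike. As \<epsilon> is arbitrary, a linear lower bound for the modulus of that real part is
  enough, and all \<open>r\<close> are treated at once. Changing the sign of a single
  \<open>a n\<close> conjugates \<open>H\<close> by a diagonal matrix of signs and leaves the
  hierarchy invariant; hence the conclusion fixes the modulus of \<open>a n t\<close> first and its
  sign separately.\<close>

lemma gronwall_family:
  fixes x x' :: "'i \<Rightarrow> real \<Rightarrow> real"
  assumes der: "\<And>i t. s \<le> t \<Longrightarrow> t \<le> u \<Longrightarrow> (x i has_real_derivative x' i t) (at t)"
    and bdd: "\<And>i t. s \<le> t \<Longrightarrow> t \<le> u \<Longrightarrow> \<bar>x i t\<bar> \<le> B"
    and grow: "\<And>i t \<sigma>. s \<le> t \<Longrightarrow> t \<le> u \<Longrightarrow> (\<And>j. \<bar>x j t\<bar> \<le> \<sigma>) \<Longrightarrow> \<bar>x' i t\<bar> \<le> K * \<sigma>"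
    and init: "\<And>i. \<bar>x i s\<bar> \<le> \<sigma>0"
    and t: "s \<le> t" "t \<le> u"
  shows "\<bar>x i t\<bar> \<le> \<sigma>0 * exp (K * (t - s))"
proof -
  \<comment> \<open>The supremum over an infinite family need not be differentiable, so Gronwall is
    not applied to it. Instead the crude bound \<open>B\<close> is improved by Picard iteration:
    each integration of the differential inequality raises \<open>n\<close> by one, and
    \<open>B\<close> ends up multiplied by \<open>(K * (t - s)) ^ n / fact n\<close>, which tends to
    0.\<close>
  define \<phi> where "\<phi> n t = \<sigma>0 * (\<Sum>j<n. (K * (t - s)) ^ j / fact j) + B * ((K * (t - s)) ^ n / fact n)" for n t
  have bnd: "\<bar>x i t\<bar> \<le> \<phi> n t" if "s \<le> t" "t \<le> u" for n i t
    using that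
  proof (induction n arbitrary: i t)
    case 0
    then show ?case using bdd[of t i] by (simp add: \<phi>_def)
  next
    case (Suc n)
    have d: "((\<phi> (Suc n)) has_real_derivative K * \<phi> n t) (at t)" for t
    proof -
      have pw: "((\<lambda>t. (K * (t - s)) ^ Suc j / fact (Suc j)) has_real_derivative K * ((K * (t - s)) ^ j / fact j)) (at t)" for j
        by (rule derivative_eq_intros refl | simp add: field_simps del: of_nat_Suc)+
      have "((\<lambda>t. \<sigma>0 * (1 + (\<Sum>j<n. (K * (t - s)) ^ Suc j / fact (Suc j))) + B * ((K * (t - s)) ^ Suc n / fact (Suc n)))
        has_real_derivative \<sigma>0 * (0 + (\<Sum>j<n. K * ((K * (t - s)) ^ j / fact j))) + B * (K * ((K * (t - s)) ^ n / fact n))) (at t)"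
        by (intro DERIV_add DERIV_cmult DERIV_const DERIV_sum pw)
      moreover have "\<phi> (Suc n) = (\<lambda>t. \<sigma>0 * (1 + (\<Sum>j<n. (K * (t - s)) ^ Suc j / fact (Suc j))) + B * ((K * (t - s)) ^ Suc n / fact (Suc n)))"
        unfolding \<phi>_def by (subst sum.lessThan_Suc_shift) simp
      ultimately show ?thesis
        by (simp add: \<phi>_def sum_distrib_left algebra_simps)
    qed
    have \<phi>s: "\<phi> (Suc n) s = \<sigma>0"
      unfolding \<phi>_def by (subst sum.lessThan_Suc_shift) simp
    have dx: "\<bar>x' i v\<bar> \<le> K * \<phi> n v" if "s \<le> v" "v \<le> t" for v
      using grow[of v "\<phi> n v"] Suc.IH[of v] that Suc.prems by force
    have "x i s - \<phi> (Suc n) s \<ge> x i t - \<phi> (Suc n) t"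
    proof (rule DERIV_nonpos_imp_nonincreasing[of s t])
      fix v assume v: "s \<le> v" "v \<le> t"
      show "\<exists>y. ((\<lambda>t. x i t - \<phi> (Suc n) t) has_real_derivative y) (at v) \<and> y \<le> 0"
        using v Suc.prems dx[of v] der[of v i] d[of v]
        by (intro exI[of _ "x' i v - K * \<phi> n v"]) (auto intro: DERIV_diff)
    qed (use Suc.prems in auto)
    moreover have "- x i s - \<phi> (Suc n) s \<ge> - x i t - \<phi> (Suc n) t"
    proof (rule DERIV_nonpos_imp_nonincreasing[of s t "\<lambda>t. - x i t - \<phi> (Suc n) t"])
      fix v assume v: "s \<le> v" "v \<le> t"
      show "\<exists>y. ((\<lambda>t. - x i t - \<phi> (Suc n) t) has_real_derivative y) (at v) \<and> y \<le> 0"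
        using v Suc.prems dx[of v] der[of v i] d[of v]
        by (intro exI[of _ "- x' i v - K * \<phi> n v"]) (auto intro: DERIV_diff DERIV_minus)
    qed (use Suc.prems in auto)
    ultimately show ?case
      using init[of i] \<phi>s by linarith
  qed
  have "(\<lambda>n. (K * (t - s)) ^ n / fact n) sums exp (K * (t - s))"
    using exp_converges[of "K * (t - s)"] by (simp add: field_simps)
  then have "(\<lambda>n. \<sigma>0 * (\<Sum>j<n. (K * (t - s)) ^ j / fact j) + B * ((K * (t - s)) ^ n / fact n))
    \<longlonglongrightarrow> \<sigma>0 * exp (K * (t - s)) + B * 0"
    using summable_LIMSEQ_zero[OF sums_summable] by (intro tendsto_intros) (auto simp: sums_def)
  then show ?thesis
    using bnd[OF t] by (intro tendsto_lowerbound[where f = "\<lambda>n. \<phi> n t"]) (auto simp: \<phi>_def)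
qed

lemma gronwall_family_reverse:
  fixes x x' :: "'i \<Rightarrow> real \<Rightarrow> real"
  assumes der: "\<And>i t. u \<le> t \<Longrightarrow> t \<le> s \<Longrightarrow> (x i has_real_derivative x' i t) (at t)"
    and bdd: "\<And>i t. u \<le> t \<Longrightarrow> t \<le> s \<Longrightarrow> \<bar>x i t\<bar> \<le> B"
    and grow: "\<And>i t \<sigma>. u \<le> t \<Longrightarrow> t \<le> s \<Longrightarrow> (\<And>j. \<bar>x j t\<bar> \<le> \<sigma>) \<Longrightarrow> \<bar>x' i t\<bar> \<le> K * \<sigma>"
    and init: "\<And>i. \<bar>x i s\<bar> \<le> \<sigma>0"
    and t: "u \<le> t" "t \<le> s"
  shows "\<bar>x i t\<bar> \<le> \<sigma>0 * exp (K * (s - t))"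
proof -
  have "\<bar>x i (- (- t))\<bar> \<le> \<sigma>0 * exp (K * (- t - (- s)))"
  proof (rule gronwall_family[where s = "- s" and u = "- u" and x = "\<lambda>i t. x i (- t)" and x' = "\<lambda>i t. - x' i (- t)" and B = B])
    fix i v assume "- s \<le> v" "v \<le> - u"
    then have "(x i has_real_derivative x' i (- v)) (at (- v))"
      by (intro der) auto
    then show "((\<lambda>t. x i (- t)) has_real_derivative - x' i (- v)) (at v)"
      by (simp add: DERIV_mirror)
  next
    fix i v \<sigma> assume "- s \<le> v" "v \<le> - u" "\<And>j. \<bar>x j (- v)\<bar> \<le> \<sigma>"
    then show "\<bar>- x' i (- v)\<bar> \<le> K * \<sigma>"
      using grow[of "-v" \<sigma>  i] by auto
  qed (use bdd init t in auto)
  then show ?thesis by simp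
qed

section \<open>Matrix elements of the powers of the Jacobi operator\<close>

definition jpow :: "(int \<Rightarrow> real) \<Rightarrow> (int \<Rightarrow> real) \<Rightarrow> nat \<Rightarrow> int \<Rightarrow> int \<Rightarrow> real"
  where "jpow a b l m n = (jacobi a b ^^ l) (kdelta n) m"

lemma g_tilde_jpow: "g_tilde a b l n = jpow a b l n n"
  by (simp add: g_tilde_def matrix_element_eq jpow_def)

lemma h_tilde_jpow: "h_tilde a b l n = 2 * a n * jpow a b l (n + 1) n"
  by (simp add: h_tilde_def matrix_element_eq jpow_def)

lemma jpow_0: "jpow a b 0 m n = (if m = n then 1 else 0)"
  by (simp add: jpow_def kdelta_def)

lemma jpow_Suc:
  "jpow a b (Suc l) m n = a m * jpow a b l (m + 1) n + a (m - 1) * jpow a b l (m - 1) n + b m * jpow a b l m n"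
  by (simp add: jpow_def jacobi_def)

lemma jpow_Suc_right:
  "jpow a b (Suc l) m n = a n * jpow a b l m (n + 1) + a (n - 1) * jpow a b l m (n - 1) + b n * jpow a b l m n"
proof (induction l arbitrary: m)
  case 0
  then show ?case by (auto simp: jpow_Suc jpow_0)
next
  case (Suc l)
  have "b m * jpow a b (Suc l) m n
      = b m * (a n * jpow a b l m (n + 1) + a (n - 1) * jpow a b l m (n - 1) + b n * jpow a b l m n)"
    by (simp only: Suc)
  moreover have "b n * jpow a b (Suc l) m n
      = b n * (a m * jpow a b l (m + 1) n + a (m - 1) * jpow a b l (m - 1) n + b m * jpow a b l m n)"
    by (simp only: jpow_Suc)
  ultimately show ?case
    unfolding jpow_Suc[of a b "Suc l" m n] jpow_Suc[of a b l m "n + 1"] jpow_Suc[of a b l m "n - 1"]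
      Suc[of "m + 1"] Suc[of "m - 1"]
    by (simp only: algebra_simps)
qed

lemma jpow_sym: "jpow a b l m n = jpow a b l n m"
proof (induction l arbitrary: m n)
  case 0
  then show ?case by (auto simp: jpow_0)
next
  case (Suc l)
  show ?case
    unfolding jpow_Suc[of a b l m n] jpow_Suc_right[of a b l n m] by (simp add: Suc)
qed

lemma jpow_band: "\<bar>m - n\<bar> > int l \<Longrightarrow> jpow a b l m n = 0"
  by (induction l arbitrary: m) (auto simp: jpow_0 jpow_Suc)

lemma jpow_bound:
  assumes "\<And>n. \<bar>a n\<bar> \<le> M" "\<And>n. \<bar>b n\<bar> \<le> M"
  shows "\<bar>jpow a b l m n\<bar> \<le> (3 * M) ^ l"
proof (induction l arbitrary: m)
  case 0
  then show ?case by (simp add: jpow_0)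
next
  case (Suc l)
  have M: "M \<ge> 0" using assms(1)[of 0] by linarith
  have *: "\<bar>c * jpow a b l j n\<bar> \<le> M * (3 * M) ^ l" if "\<bar>c\<bar> \<le> M" for c j
    using that M Suc by (simp add: abs_mult mult_mono)
  have "\<bar>jpow a b (Suc l) m n\<bar> \<le> \<bar>a m * jpow a b l (m + 1) n\<bar> + \<bar>a (m - 1) * jpow a b l (m - 1) n\<bar> + \<bar>b m * jpow a b l m n\<bar>"
    unfolding jpow_Suc by linarith
  also have "\<dots> \<le> M * (3 * M) ^ l + M * (3 * M) ^ l + M * (3 * M) ^ l"
    by (intro add_mono * assms)
  finally show ?case by (simp add: mult_ac)
qed

lemma jpow_add:
  "jpow a b (p + q) m n = (\<Sum>j\<in>{m - int p..m + int p}. jpow a b p m j * jpow a b q j n)"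
proof (induction q arbitrary: n)
  case 0
  show ?case
    using jpow_band[of p m n a b] by (auto simp: jpow_0 if_distrib sum.delta cong: if_cong)
next
  case (Suc q)
  show ?case
    unfolding add_Suc_right jpow_Suc_right[of a b _ _ n] Suc
    by (simp add: sum_distrib_left sum.distrib[symmetric] algebra_simps)
qed

lemma jpow_diag_square: "jpow a b (2 * p) n n \<ge> (jpow a b p n n)\<^sup>2"
proof -
  have "jpow a b (2 * p) n n = (\<Sum>j\<in>{n - int p..n + int p}. (jpow a b p n j)\<^sup>2)"
    unfolding mult_2 jpow_add by (simp add: power2_eq_square jpow_sym[of a b p _ n])
  also have "\<dots> \<ge> (\<Sum>j\<in>{n}. (jpow a b p n j)\<^sup>2)"
    by (intro sum_mono2) auto
  finally show ?thesis by simp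
qed

text \<open>The base is the squared norm of \<open>H\<close> applied to \<open>kdelta n\<close>,
  that is, the diagonal entry of \<open>H ^ 2\<close>; squaring repeatedly by
  \<open>jpow_diag_square\<close> gives the rest. With exponents \<open>2 ^ k\<close>, any constant
  factor in a bound for the powers disappears after taking roots, so exponential bounds for
  \<open>jpow\<close> turn back into bounds for the coefficients.\<close>

lemma jpow_diag_power2:
  "(a n ^ 2 + a (n - 1) ^ 2 + b n ^ 2) ^ (2 ^ k) \<le> jpow a b (2 ^ Suc k) n n"
proof (induction k)
  case 0
  show ?case by (simp add: numeral_2_eq_2 jpow_Suc jpow_0)
next
  case (Suc k)
  have "(a n ^ 2 + a (n - 1) ^ 2 + b n ^ 2) ^ (2 ^ Suc k) = ((a n ^ 2 + a (n - 1) ^ 2 + b n ^ 2) ^ (2 ^ k))\<^sup>2"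
    by (simp add: power_mult[symmetric] mult.commute)
  also have "\<dots> \<le> (jpow a b (2 ^ Suc k) n n)\<^sup>2"
    by (intro power_mono Suc) simp
  also have "\<dots> \<le> jpow a b (2 ^ Suc (Suc k)) n n"
    using jpow_diag_square[of a b "2 ^ Suc k" n] by simp
  finally show ?case .
qed

text \<open>Upper minus lower triangular part of the combination of powers of \<open>H\<close> with
  weights \<open>c (s - l)\<close>: the skew operator \<open>P\<close> of the Lax pair. The diagonal
  drops out because \<open>sgn 0 = 0\<close>. For \<open>s = r + 1\<close> its commutator with
  \<open>H\<close> is the right-hand side of the hierarchy.\<close>

definition lax_kernel :: "(nat \<Rightarrow> real) \<Rightarrow> nat \<Rightarrow> (int \<Rightarrow> real) \<Rightarrow> (int \<Rightarrow> real) \<Rightarrow> int \<Rightarrow> int \<Rightarrow> real"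
  where "lax_kernel c s a b m k = (\<Sum>l=0..s. c (s - l) * (real_of_int (sgn (k - m)) * jpow a b l m k))"

lemma lax_kernel_skew: "lax_kernel c s a b m k = - lax_kernel c s a b k m"
  unfolding lax_kernel_def sum_negf[symmetric]
  by (intro sum.cong refl) (simp add: jpow_sym[of a b _ m k] sgn_if)

lemma lax_kernel_band: "\<bar>k - m\<bar> > int s \<Longrightarrow> lax_kernel c s a b m k = 0"
  unfolding lax_kernel_def by (intro sum.neutral ballI) (auto simp: jpow_band)

lemma lax_kernel_bound:
  assumes "\<And>n. \<bar>a n\<bar> \<le> M" "\<And>n. \<bar>b n\<bar> \<le> M"
  shows "\<bar>lax_kernel c s a b m k\<bar> \<le> (\<Sum>l=0..s. \<bar>c (s - l)\<bar> * (3 * M) ^ l)"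
  unfolding lax_kernel_def
proof (rule order_trans[OF sum_abs], rule sum_mono)
  fix l
  have "\<bar>real_of_int (sgn (k - m)) * jpow a b l m k\<bar> \<le> 1 * (3 * M) ^ l"
    unfolding abs_mult by (intro mult_mono jpow_bound assms) (auto simp: sgn_if)
  then show "\<bar>c (s - l) * (real_of_int (sgn (k - m)) * jpow a b l m k)\<bar> \<le> \<bar>c (s - l)\<bar> * (3 * M) ^ l"
    unfolding abs_mult[of "c (s - l)"] by (intro mult_left_mono) auto
qed

text \<open>Splitting \<open>H ^ l\<close> into its strictly upper part \<open>U\<close>, its diagonal \<open>D\<close> and its strictly lower part
  \<open>L\<close>, the fact that \<open>U + D + L\<close> commutes with \<open>H\<close> makes the commutator \<open>[U - L, H] = [2 U + D, H] =
  - [2 L + D, H]\<close> tridiagonal.\<close>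

lemma lax_entry_jpow:
  fixes a b :: "int \<Rightarrow> real" and l :: nat
  defines "P \<equiv> \<lambda>m k. real_of_int (sgn (k - m)) * jpow a b l m k"
  shows "a (k - 1) * P m (k - 1) + a k * P m (k + 1) + b k * P m k
      - (a m * P (m + 1) k + a (m - 1) * P (m - 1) k + b m * P m k)
    = (if k = m + 1 then a m * (g_tilde a b l (m + 1) - g_tilde a b l m) else 0)
      + (if k = m - 1 then a (m - 1) * (g_tilde a b l m - g_tilde a b l (m - 1)) else 0)
      + (if k = m then h_tilde a b l m - h_tilde a b l (m - 1) else 0)"
proof -
  have comm: "a k * jpow a b l m (k + 1) + a (k - 1) * jpow a b l m (k - 1) + b k * jpow a b l m k
    = a m * jpow a b l (m + 1) k + a (m - 1) * jpow a b l (m - 1) k + b m * jpow a b l m k"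
    using jpow_Suc[of a b l m k] jpow_Suc_right[of a b l m k] by simp
  \<comment> \<open>Two or more sites off the diagonal all signs agree and \<open>comm\<close> gives
    0. For \<open>k = m + 1\<close> and \<open>k = m - 1\<close> the entries with equal indices are
    suppressed by the sign, and what \<open>comm\<close> then lacks are the \<open>g_tilde\<close>
    terms. For \<open>k = m\<close> the two halves of the commutator carry opposite signs, so the
    off-diagonal entries double to \<open>h_tilde\<close>.\<close>
  consider "k \<ge> m + 2" | "k \<le> m - 2" | "k = m + 1" | "k = m - 1" | "k = m" by linarith
  then show ?thesis
  proof cases
    case 1
    then show ?thesis using comm by (simp add: P_def)
  next
    case 2
    then show ?thesis using comm by (simp add: P_def)
  next
    case 3
    show ?thesis using comm unfolding 3 by (simp add: P_def g_tilde_jpow algebra_simps)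
  next
    case 4
    show ?thesis using comm unfolding 4 by (simp add: P_def g_tilde_jpow algebra_simps)
  next
    case 5
    show ?thesis using comm unfolding 5
      by (simp add: P_def h_tilde_jpow algebra_simps jpow_sym[of a b l m "m + 1"] jpow_sym[of a b l m "m - 1"])
  qed
qed

lemma lax_entry:
  fixes a b :: "int \<Rightarrow> real" and c :: "nat \<Rightarrow> real" and s :: nat
  defines "P \<equiv> lax_kernel c s a b"
  shows "a (k - 1) * P m (k - 1) + a k * P m (k + 1) + b k * P m k
      - (a m * P (m + 1) k + a (m - 1) * P (m - 1) k + b m * P m k)
    = (if k = m + 1 then a m * (toda_g c a b s (m + 1) - toda_g c a b s m) else 0)
      + (if k = m - 1 then a (m - 1) * (toda_g c a b s m - toda_g c a b s (m - 1)) else 0)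
      + (if k = m then toda_h c a b s m - toda_h c a b s (m - 1) else 0)"
    (is "?l = ?r")
proof -
  define Q where "Q l m k = real_of_int (sgn (k - m)) * jpow a b l m k" for l m k
  have "?l = (\<Sum>l=0..s. c (s - l) * (a (k - 1) * Q l m (k - 1) + a k * Q l m (k + 1) + b k * Q l m k
      - (a m * Q l (m + 1) k + a (m - 1) * Q l (m - 1) k + b m * Q l m k)))"
    unfolding P_def lax_kernel_def Q_def
    by (simp only: sum_distrib_left sum.distrib[symmetric] sum_subtractf[symmetric])
      (intro sum.cong refl, simp add: algebra_simps)
  also have "\<dots> = ?r"
    unfolding Q_def lax_entry_jpow toda_g_def toda_h_def
    by (simp add: sum_distrib_left sum_subtractf[symmetric] algebra_simps)
  finally show ?thesis .
qed

definition lax_op :: "(nat \<Rightarrow> real) \<Rightarrow> nat \<Rightarrow> (int \<Rightarrow> real) \<Rightarrow> (int \<Rightarrow> real) \<Rightarrow> (int \<Rightarrow> real) \<Rightarrow> int \<Rightarrow> real"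
  where "lax_op c s a b f m = (\<Sum>k\<in>{m - int s..m + int s}. lax_kernel c s a b m k * f k)"

lemma sum_shift_up:
  fixes g h :: "int \<Rightarrow> real"
  assumes "\<And>k. k \<notin> {p<..<q} \<Longrightarrow> g k = 0"
  shows "(\<Sum>k\<in>{p..q}. g k * h (k + 1)) = (\<Sum>k\<in>{p..q}. g (k - 1) * h k)"
proof -
  have "(\<Sum>k\<in>{p..q}. g k * h (k + 1)) = (\<Sum>k\<in>{p+1..q+1}. g (k - 1) * h k)"
    by (rule sum.reindex_bij_witness[of _ "\<lambda>k. k - 1" "\<lambda>k. k + 1"]) auto
  also have "\<dots> = (\<Sum>k\<in>{p..q+1}. g (k - 1) * h k)"
    by (rule sum.mono_neutral_left) (use assms in auto)
  also have "\<dots> = (\<Sum>k\<in>{p..q}. g (k - 1) * h k)"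
    by (rule sum.mono_neutral_right) (use assms in auto)
  finally show ?thesis .
qed

lemma sum_shift_down:
  fixes g h :: "int \<Rightarrow> real"
  assumes "\<And>k. k \<notin> {p<..<q} \<Longrightarrow> g k = 0"
  shows "(\<Sum>k\<in>{p..q}. g k * h (k - 1)) = (\<Sum>k\<in>{p..q}. g (k + 1) * h k)"
proof -
  have "(\<Sum>k\<in>{p..q}. g k * h (k - 1)) = (\<Sum>k\<in>{p-1..q-1}. g (k + 1) * h k)"
    by (rule sum.reindex_bij_witness[of _ "\<lambda>k. k + 1" "\<lambda>k. k - 1"]) auto
  also have "\<dots> = (\<Sum>k\<in>{p-1..q}. g (k + 1) * h k)"
    by (rule sum.mono_neutral_left) (use assms in auto)
  also have "\<dots> = (\<Sum>k\<in>{p..q}. g (k + 1) * h k)"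
    by (rule sum.mono_neutral_right) (use assms in auto)
  finally show ?thesis .
qed

lemma lax_op_window:
  assumes "p \<le> m - int s" "q \<ge> m + int s"
  shows "lax_op c s a b f m = (\<Sum>k\<in>{p..q}. lax_kernel c s a b m k * f k)"
  unfolding lax_op_def
  by (rule sum.mono_neutral_left) (use assms lax_kernel_band[of s _ m c a b] in \<open>auto simp: not_le\<close>)

text \<open>The Lax equation in the form \<open>P H = H P + H'\<close>, with \<open>H'\<close> the
  right-hand side of the hierarchy. The shifts in \<open>jacobi a b f\<close> are moved from
  \<open>f\<close> to the kernel, where \<open>lax_entry\<close> applies; the kernel has finite
  bandwidth, so \<open>f\<close> may be any sequence.\<close>

lemma lax_op_lax:
  fixes a b f :: "int \<Rightarrow> real" and c :: "nat \<Rightarrow> real" and s :: nat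
  defines "g \<equiv> toda_g c a b s" and "h \<equiv> toda_h c a b s"
  shows "lax_op c s a b (jacobi a b f) m = jacobi a b (lax_op c s a b f) m
    + (a m * (g (m + 1) - g m) * f (m + 1) + a (m - 1) * (g m - g (m - 1)) * f (m - 1) + (h m - h (m - 1)) * f m)"
proof -
  define P where "P = lax_kernel c s a b"
  \<comment> \<open>The margin keeps the kernel rows \<open>m - 1\<close>, \<open>m\<close>,
    \<open>m + 1\<close> and their shifts by one inside the window, so that shifting the summation
    index produces no boundary terms.\<close>
  define p q where "p = m - int s - 3" and "q = m + int s + 3"
  have band: "P m' k = 0" if "\<bar>k - m'\<bar> > int s" for m' k
    using that unfolding P_def by (rule lax_kernel_band)
  have "lax_op c s a b (jacobi a b f) m = (\<Sum>k\<in>{p..q}. P m k * jacobi a b f k)"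
    unfolding P_def p_def q_def by (rule lax_op_window) auto
  also have "\<dots> = (\<Sum>k\<in>{p..q}. (P m k * a k) * f (k + 1)) + (\<Sum>k\<in>{p..q}. (P m k * a (k - 1)) * f (k - 1))
      + (\<Sum>k\<in>{p..q}. P m k * b k * f k)"
    unfolding jacobi_def by (simp add: sum.distrib[symmetric] algebra_simps)
  also have "(\<Sum>k\<in>{p..q}. (P m k * a k) * f (k + 1)) = (\<Sum>k\<in>{p..q}. (P m (k - 1) * a (k - 1)) * f k)"
    by (rule sum_shift_up) (auto simp: p_def q_def band)
  also have "(\<Sum>k\<in>{p..q}. (P m k * a (k - 1)) * f (k - 1)) = (\<Sum>k\<in>{p..q}. (P m (k + 1) * a (k + 1 - 1)) * f k)"
    by (rule sum_shift_down) (auto simp: p_def q_def band)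
  also have "(\<Sum>k\<in>{p..q}. (P m (k - 1) * a (k - 1)) * f k) + (\<Sum>k\<in>{p..q}. (P m (k + 1) * a (k + 1 - 1)) * f k)
      + (\<Sum>k\<in>{p..q}. P m k * b k * f k)
    = (\<Sum>k\<in>{p..q}. (a (k - 1) * P m (k - 1) + a k * P m (k + 1) + b k * P m k) * f k)"
    by (simp add: sum.distrib[symmetric] algebra_simps)
  also have "\<dots> = (\<Sum>k\<in>{p..q}. ((a m * P (m + 1) k + a (m - 1) * P (m - 1) k + b m * P m k)
      + ((if k = m + 1 then a m * (g (m + 1) - g m) else 0)
      + (if k = m - 1 then a (m - 1) * (g m - g (m - 1)) else 0)
      + (if k = m then h m - h (m - 1) else 0))) * f k)"
  proof (intro sum.cong refl arg_cong2[where f = "(*)"])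
    fix k
    show "a (k - 1) * P m (k - 1) + a k * P m (k + 1) + b k * P m k
      = (a m * P (m + 1) k + a (m - 1) * P (m - 1) k + b m * P m k)
        + ((if k = m + 1 then a m * (g (m + 1) - g m) else 0)
        + (if k = m - 1 then a (m - 1) * (g m - g (m - 1)) else 0)
        + (if k = m then h m - h (m - 1) else 0))"
      using lax_entry[of a k c s b m] unfolding P_def g_def h_def by linarith
  qed
  also have "\<dots> = (\<Sum>k\<in>{p..q}. (a m * P (m + 1) k + a (m - 1) * P (m - 1) k + b m * P m k) * f k)
      + (\<Sum>k\<in>{p..q}. if k = m + 1 then a m * (g (m + 1) - g m) * f k else 0)
      + (\<Sum>k\<in>{p..q}. if k = m - 1 then a (m - 1) * (g m - g (m - 1)) * f k else 0)
      + (\<Sum>k\<in>{p..q}. if k = m then (h m - h (m - 1)) * f k else 0)"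
    unfolding sum.distrib[symmetric] by (intro sum.cong refl) (simp add: algebra_simps)
  also have "\<dots> = (\<Sum>k\<in>{p..q}. (a m * P (m + 1) k + a (m - 1) * P (m - 1) k + b m * P m k) * f k)
     + (a m * (g (m + 1) - g m) * f (m + 1) + a (m - 1) * (g m - g (m - 1)) * f (m - 1) + (h m - h (m - 1)) * f m)"
    by (simp add: p_def q_def)
  also have "(\<Sum>k\<in>{p..q}. (a m * P (m + 1) k + a (m - 1) * P (m - 1) k + b m * P m k) * f k)
      = a m * (\<Sum>k\<in>{p..q}. P (m + 1) k * f k) + a (m - 1) * (\<Sum>k\<in>{p..q}. P (m - 1) k * f k)
        + b m * (\<Sum>k\<in>{p..q}. P m k * f k)"
    by (simp add: sum_distrib_left sum.distrib[symmetric] algebra_simps)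
  also have "\<dots> = jacobi a b (lax_op c s a b f) m"
    unfolding jacobi_def P_def
    by (simp add: lax_op_window[of p "m + 1" s q] lax_op_window[of p "m - 1" s q] lax_op_window[of p m s q] p_def q_def)
  finally show ?thesis .
qed

lemma lax_op_linear:
  "lax_op c s a b (\<lambda>j. x * u j + y * v j + w * r j) m
    = x * lax_op c s a b u m + y * lax_op c s a b v m + w * lax_op c s a b r m"
  unfolding lax_op_def by (simp add: sum_distrib_left sum.distrib[symmetric] algebra_simps)

text \<open>The entry of the commutator of \<open>P\<close> with \<open>H ^ l\<close>. The second
  summand has a plus sign because \<open>P\<close> acts there on the second index and is
  skew.\<close>

definition jpow_dot where
  "jpow_dot c s a b l m n = lax_op c s a b (\<lambda>j. jpow a b l j n) m + lax_op c s a b (\<lambda>j. jpow a b l m j) n"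

text \<open>Leibniz rule for \<open>H ^ Suc l = H H ^ l\<close>: commuting \<open>P\<close> past the
  first \<open>H\<close> by \<open>lax_op_lax\<close> supplies exactly the derivative of that
  factor. For \<open>l = 0\<close> the two summands of \<open>jpow_dot\<close> cancel by
  skewness.\<close>

lemma jpow_has_derivative:
  fixes a b :: "int \<Rightarrow> real \<Rightarrow> real"
  assumes "toda_hierarchy r c a b"
  shows "((\<lambda>t. jpow (\<lambda>m. a m t) (\<lambda>m. b m t) l m n) has_real_derivative
    jpow_dot c (r + 1) (\<lambda>m. a m t) (\<lambda>m. b m t) l m n) (at t)"
proof (induction l arbitrary: m)
  case 0
  define A B where "A = (\<lambda>m. a m t)" and "B = (\<lambda>m. b m t)"
  have 1: "lax_op c (r + 1) A B (\<lambda>j. if j = n then 1 else 0) m = lax_kernel c (r + 1) A B m n" for n m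
    using lax_kernel_band[of "r + 1" n m c A B] by (auto simp: lax_op_def if_distrib cong: if_cong)
  have 2: "lax_op c (r + 1) A B (\<lambda>j. if m = j then 1 else 0) n = lax_kernel c (r + 1) A B n m"
    using 1[of m n] by (simp add: eq_commute)
  show ?case
    unfolding jpow_dot_def jpow_0 A_def[symmetric] B_def[symmetric] 1 2 using lax_kernel_skew[of c "r + 1" A B m n] by simp
next
  case (Suc l)
  define A B where "A = (\<lambda>m. a m t)" and "B = (\<lambda>m. b m t)"
  define g h where "g = toda_g c A B (r + 1)" and "h = toda_h c A B (r + 1)"
  have da: "(a m has_real_derivative A m * (g (m + 1) - g m)) (at t)" for m
    using assms by (simp add: toda_hierarchy_def Let_def g_def A_def B_def)
  have db: "(b m has_real_derivative h m - h (m - 1)) (at t)" for m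
    using assms by (simp add: toda_hierarchy_def Let_def h_def A_def B_def)
  let ?W = "\<lambda>l m n. jpow A B l m n"
  have IH: "((\<lambda>t. jpow (\<lambda>m. a m t) (\<lambda>m. b m t) l m n) has_real_derivative jpow_dot c (r + 1) A B l m n) (at t)" for m
    using Suc unfolding A_def B_def .
  have W: "jpow (\<lambda>m. a m t) (\<lambda>m. b m t) l = jpow A B l" by (simp add: A_def B_def)
  let ?D = "(A m * (g (m + 1) - g m) * ?W l (m + 1) n + jpow_dot c (r + 1) A B l (m + 1) n * A m)
    + (A (m - 1) * (g m - g (m - 1)) * ?W l (m - 1) n + jpow_dot c (r + 1) A B l (m - 1) n * A (m - 1))
    + ((h m - h (m - 1)) * ?W l m n + jpow_dot c (r + 1) A B l m n * B m)"
  have "((\<lambda>t. jpow (\<lambda>m. a m t) (\<lambda>m. b m t) (Suc l) m n) has_real_derivative ?D) (at t)"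
    unfolding jpow_Suc
    by (rule DERIV_cong, (rule DERIV_add DERIV_mult da db IH)+) (simp add: A_def B_def)
  moreover have "?D = jpow_dot c (r + 1) A B (Suc l) m n"
  proof -
    have 1: "(\<lambda>j. ?W (Suc l) m j) = (\<lambda>j. A m * ?W l (m + 1) j + A (m - 1) * ?W l (m - 1) j + B m * ?W l m j)"
      by (simp add: jpow_Suc fun_eq_iff)
    have 2: "(\<lambda>j. ?W (Suc l) j n) = jacobi A B (\<lambda>j. ?W l j n)"
      by (simp add: jpow_Suc jacobi_def fun_eq_iff)
    show ?thesis
      unfolding jpow_dot_def 1 2 lax_op_linear lax_op_lax[of c "r + 1" A B "\<lambda>j. ?W l j n" m, folded g_def h_def]
      unfolding jacobi_def by (simp only: algebra_simps)
  qed
  ultimately show ?case unfolding A_def B_def by simp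
qed

lemma lax_op_bound:
  assumes "\<And>n. \<bar>a n\<bar> \<le> M" "\<And>n. \<bar>b n\<bar> \<le> M" and f: "\<And>k. \<bar>f k\<bar> \<le> \<sigma>"
  shows "\<bar>lax_op c s a b f m\<bar> \<le> (2 * real s + 1) * (\<Sum>l=0..s. \<bar>c (s - l)\<bar> * (3 * M) ^ l) * \<sigma>"
proof -
  define C where "C = (\<Sum>l=0..s. \<bar>c (s - l)\<bar> * (3 * M) ^ l)"
  have P: "\<bar>lax_kernel c s a b m k\<bar> \<le> C" for k
    unfolding C_def by (rule lax_kernel_bound) fact+
  have "\<bar>lax_op c s a b f m\<bar> \<le> (\<Sum>k\<in>{m - int s..m + int s}. C * \<sigma>)"
    unfolding lax_op_def
  proof (rule order_trans[OF sum_abs], rule sum_mono)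
    fix k
    have "0 \<le> C" using P[of k] by linarith
    then show "\<bar>lax_kernel c s a b m k * f k\<bar> \<le> C * \<sigma>"
      unfolding abs_mult using P f by (intro mult_mono) auto
  qed
  also have "\<dots> = (2 * real s + 1) * C * \<sigma>"
    by simp
  finally show ?thesis unfolding C_def .
qed

lemma jpow_dot_bound:
  assumes "\<And>n. \<bar>a n\<bar> \<le> M" "\<And>n. \<bar>b n\<bar> \<le> M" and "\<And>m n. \<bar>jpow a b l m n\<bar> \<le> \<sigma>"
  shows "\<bar>jpow_dot c s a b l m n\<bar> \<le> 2 * ((2 * real s + 1) * (\<Sum>l=0..s. \<bar>c (s - l)\<bar> * (3 * M) ^ l)) * \<sigma>"
proof -
  have "\<bar>lax_op c s a b (\<lambda>j. jpow a b l j n) m\<bar> \<le> (2 * real s + 1) * (\<Sum>l=0..s. \<bar>c (s - l)\<bar> * (3 * M) ^ l) * \<sigma>"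
    "\<bar>lax_op c s a b (\<lambda>j. jpow a b l m j) n\<bar> \<le> (2 * real s + 1) * (\<Sum>l=0..s. \<bar>c (s - l)\<bar> * (3 * M) ^ l) * \<sigma>"
    by (rule lax_op_bound assms)+
  then show ?thesis
    unfolding jpow_dot_def by linarith
qed

text \<open>The conserved quantity behind this bound is the operator norm of \<open>H\<close>, read off from the growth of
  the matrix elements of its powers: these change at most by a factor independent of the power.\<close>

lemma toda_bound_transfer:
  fixes a b :: "int \<Rightarrow> real \<Rightarrow> real"
  assumes toda: "toda_hierarchy r c a b"
    and bdd: "\<And>n t. t \<in> {u..v} \<Longrightarrow> \<bar>a n t\<bar> \<le> B" "\<And>n t. t \<in> {u..v} \<Longrightarrow> \<bar>b n t\<bar> \<le> B"
    and s: "s \<in> {u..v}" "\<And>n. \<bar>a n s\<bar> \<le> M" "\<And>n. \<bar>b n s\<bar> \<le> M"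
    and t: "t \<in> {u..v}"
  shows "\<bar>a n t\<bar> \<le> 3 * M \<and> \<bar>b n t\<bar> \<le> 3 * M"
proof -
  \<comment> \<open>The rate depends on the crude bound \<open>B\<close> but not on the power
    \<open>l\<close>. The exponents \<open>2 ^ k\<close> below therefore make the factor
    \<open>exp (K * \<bar>t - s\<bar>)\<close> harmless, and \<open>B\<close> is absent from the
    conclusion.\<close>
  define K where "K = 2 * ((2 * real (r + 1) + 1) * (\<Sum>l=0..r+1. \<bar>c (r + 1 - l)\<bar> * (3 * B) ^ l))"
  let ?A = "\<lambda>t m. a m t" and ?B = "\<lambda>t m. b m t"
  have M0: "M \<ge> 0" using s(2)[of 0] by linarith
  have W: "\<bar>jpow (?A t) (?B t) l m n\<bar> \<le> (3 * M) ^ l * exp (K * \<bar>t - s\<bar>)" for l m n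
  proof -
    define x where "x = (\<lambda>(m, n) t. jpow (?A t) (?B t) l m n)"
    define x' where "x' = (\<lambda>(m, n) t. jpow_dot c (r + 1) (?A t) (?B t) l m n)"
    have der: "(x i has_real_derivative x' i t) (at t)" for i t
      using jpow_has_derivative[OF toda] by (cases i) (simp add: x_def x'_def)
    have bd: "\<bar>x i t\<bar> \<le> (3 * B) ^ l" if "t \<in> {u..v}" for i t
      unfolding x_def split_beta by (rule jpow_bound) (use bdd that in auto)
    have gr: "\<bar>x' i t\<bar> \<le> K * \<sigma>" if "t \<in> {u..v}" "\<And>j. \<bar>x j t\<bar> \<le> \<sigma>" for i t \<sigma>
      using jpow_dot_bound[of "?A t" B "?B t" l \<sigma> c "r + 1" "fst i" "snd i"] bdd that
      by (cases i) (auto simp: x_def x'_def K_def)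
    have init: "\<bar>x i s\<bar> \<le> (3 * M) ^ l" for i
      unfolding x_def split_beta by (rule jpow_bound) (use s in auto)
    have "\<bar>x (m, n) t\<bar> \<le> (3 * M) ^ l * exp (K * \<bar>t - s\<bar>)"
    proof (cases "s \<le> t")
      case True
      have "\<bar>x (m, n) t\<bar> \<le> (3 * M) ^ l * exp (K * (t - s))"
        by (rule gronwall_family[where u = v and B = "(3 * B) ^ l" and x' = x'])
          (use der bd gr init s t True in auto)
      then show ?thesis using True by simp
    next
      case False
      have "\<bar>x (m, n) t\<bar> \<le> (3 * M) ^ l * exp (K * (s - t))"
        by (rule gronwall_family_reverse[where u = u and B = "(3 * B) ^ l" and x' = x'])
          (use der bd gr init s t False in auto)
      then show ?thesis using False by simp
    qed
    then show ?thesis by (simp add: x_def)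
  qed
  define y where "y = (a n t)\<^sup>2 + (a (n - 1) t)\<^sup>2 + (b n t)\<^sup>2"
  have y0: "y \<ge> 0" by (simp add: y_def)
  have pw: "y ^ (2 ^ k) \<le> ((3 * M)\<^sup>2) ^ (2 ^ k) * exp (K * \<bar>t - s\<bar>)" for k
  proof -
    have "y ^ (2 ^ k) \<le> jpow (?A t) (?B t) (2 ^ Suc k) n n"
      unfolding y_def using jpow_diag_power2[of "?A t" n "?B t" k] by simp
    also have "\<dots> \<le> (3 * M) ^ (2 ^ Suc k) * exp (K * \<bar>t - s\<bar>)"
      using W[of "2 ^ Suc k" n n] by linarith
    finally show ?thesis by (simp only: power_mult[symmetric] power_Suc)
  qed
  have "y \<le> (3 * M)\<^sup>2"
  proof (rule ccontr)
    assume neg: "\<not> y \<le> (3 * M)\<^sup>2"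
    show False
    proof (cases "M = 0")
      case True
      then show False using pw[of 0] neg by simp
    next
      case False
      then have M2: "(3 * M)\<^sup>2 > 0" by simp
      define x where "x = y / (3 * M)\<^sup>2"
      have x: "x > 1" using neg M2 by (simp add: x_def)
      obtain N where N: "exp (K * \<bar>t - s\<bar>) < x ^ N"
        using real_arch_pow[OF x] by blast
      have "x ^ N \<le> x ^ (2 ^ N)" using x by (intro power_increasing) (auto intro: less_imp_le)
      also have "x ^ (2 ^ N) = y ^ (2 ^ N) / ((3 * M)\<^sup>2) ^ (2 ^ N)"
        by (simp add: x_def power_divide)
      also have "\<dots> \<le> exp (K * \<bar>t - s\<bar>)"
        using pw[of N] M2 by (simp add: divide_le_eq mult.commute)
      finally show False using N by simp
    qed
  qed
  then have "(a n t)\<^sup>2 \<le> (3 * M)\<^sup>2" "(b n t)\<^sup>2 \<le> (3 * M)\<^sup>2"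
    unfolding y_def using zero_le_power2[of "a n t"] zero_le_power2[of "a (n - 1) t"] zero_le_power2[of "b n t"]
    by linarith+
  then have "\<bar>a n t\<bar> \<le> \<bar>3 * M\<bar>" "\<bar>b n t\<bar> \<le> \<bar>3 * M\<bar>"
    unfolding abs_le_square_iff .
  then show ?thesis using M0 by simp
qed

section \<open>Uniform boundedness in time\<close>

lemma toda_isCont:
  assumes "toda_hierarchy r c a b"
  shows "isCont (a n) t" "isCont (b n) t"
  using assms unfolding toda_hierarchy_def Let_def by (blast intro: DERIV_isCont)+

text \<open>The supremum norm of the coefficients is only lower semicontinuous in time. By Baire it is
  bounded on an open piece of the closed set of times near which it is unbounded, and
  the norm bound carries this over to the gaps of that set.\<close>

lemma toda_uniformly_bounded:
  fixes a b :: "int \<Rightarrow> real \<Rightarrow> real"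
  assumes toda: "toda_hierarchy r c a b"
    and bdd: "\<forall>t. bounded (range (\<lambda>n. a n t)) \<and> bounded (range (\<lambda>n. b n t))"
  obtains M where "\<And>n t. \<bar>a n t\<bar> \<le> M" "\<And>n t. \<bar>b n t\<bar> \<le> M"
proof -
  define E where "E M = {t. \<forall>n. \<bar>a n t\<bar> \<le> M \<and> \<bar>b n t\<bar> \<le> M}" for M :: real
  have E_mono: "E M \<subseteq> E M'" if "M \<le> M'" for M M'
    using that unfolding E_def by (blast intro: order_trans[OF _ that])
  have closed_E: "closed (E M)" for M
  proof -
    have "E M = (\<Inter>n. {t. \<bar>a n t\<bar> \<le> M} \<inter> {t. \<bar>b n t\<bar> \<le> M})" by (auto simp: E_def)
    moreover have "continuous_on UNIV (\<lambda>t. \<bar>a n t\<bar>)" "continuous_on UNIV (\<lambda>t. \<bar>b n t\<bar>)" for n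
      using toda_isCont[OF toda] by (auto intro!: continuous_on_rabs continuous_at_imp_continuous_on)
    ultimately show ?thesis
      by (auto intro!: closed_INT closed_Int closed_Collect_le continuous_on_const)
  qed
  have E_ex: "\<exists>M. t \<in> E M" for t
  proof -
    obtain A B where "\<And>n. \<bar>a n t\<bar> \<le> A" "\<And>n. \<bar>b n t\<bar> \<le> B"
      using bdd unfolding bounded_iff by (metis rangeI real_norm_def)
    then have "t \<in> E (max A B)" by (auto simp: E_def le_max_iff_disj)
    then show ?thesis ..
  qed
  have transfer: "x \<in> E (3 * M)" if "closed_segment t x \<subseteq> E B" "t \<in> E M" for t x B M
  proof -
    have seg: "{min t x..max t x} = closed_segment t x"
      by (simp add: closed_segment_eq_real_ivl min_def max_def)
    have "\<bar>a n x\<bar> \<le> 3 * M \<and> \<bar>b n x\<bar> \<le> 3 * M" for n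
      by (rule toda_bound_transfer[OF toda, of "min t x" "max t x" B t M x])
        (use that seg in \<open>auto simp: E_def\<close>)
    then show ?thesis by (simp add: E_def)
  qed
  \<comment> \<open>The times with a locally uniform bound. Once the complement is shown to be
    empty, the local bounds combine on compact sets of times, and \<open>transfer\<close> replaces
    the resulting bound by one that depends only on a bound at time 0.\<close>
  define G where "G = {t. \<exists>\<epsilon>>0. \<exists>M. ball t \<epsilon> \<subseteq> E M}"
  have "open G"
    unfolding open_contains_ball
  proof
    fix t assume "t \<in> G"
    then obtain \<epsilon> M where e: "\<epsilon> > 0" "ball t \<epsilon> \<subseteq> E M" by (auto simp: G_def)
    have "ball t \<epsilon> \<subseteq> G"
    proof
      fix x assume "x \<in> ball t \<epsilon>"
      then obtain \<eta> where "\<eta> > 0" "ball x \<eta> \<subseteq> ball t \<epsilon>"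
        by (meson open_ball open_contains_ball)
      then show "x \<in> G" using e unfolding G_def by blast
    qed
    then show "\<exists>\<epsilon>>0. ball t \<epsilon> \<subseteq> G" using e by blast
  qed
  have compact_G: "\<exists>B. S \<subseteq> E B" if S: "compact S" "S \<subseteq> G" for S
  proof -
    have "\<forall>t\<in>S. \<exists>\<epsilon> M. \<epsilon> > 0 \<and> ball t \<epsilon> \<subseteq> E M" using S by (auto simp: G_def)
    then obtain \<epsilon> M where e: "\<And>t. t \<in> S \<Longrightarrow> \<epsilon> t > 0 \<and> ball t (\<epsilon> t) \<subseteq> E (M t)" by metis
    obtain T where T: "T \<subseteq> S" "finite T" "S \<subseteq> (\<Union>t\<in>T. ball t (\<epsilon> t))"
      by (rule compactE_image[OF S(1), of S "\<lambda>t. ball t (\<epsilon> t)"]) (use e in force)+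
    have "S \<subseteq> E (Max (insert 0 (M ` T)))"
    proof
      fix x assume "x \<in> S"
      then obtain t where t: "t \<in> T" "x \<in> ball t (\<epsilon> t)" using T by auto
      then have "x \<in> E (M t)" using e T by blast
      moreover have "M t \<le> Max (insert 0 (M ` T))" using t T by (intro Max_ge) auto
      ultimately show "x \<in> E (Max (insert 0 (M ` T)))" using E_mono by blast
    qed
    then show ?thesis ..
  qed
  have "- G = {}"
  proof (rule ccontr)
    assume ne: "- G \<noteq> {}"
    have closed_F: "closed (- G)" using \<open>open G\<close> by blast
    \<comment> \<open>The closed sets \<open>E (real K)\<close> cover the closed set
      \<open>- G\<close>, so one of them contains a relatively open piece of it; otherwise Baire
      would make the empty intersection of their relative complements dense.\<close>
    have "\<exists>K::nat. \<not> - G \<subseteq> closure (- G - E (real K))"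
    proof (rule ccontr)
      assume *: "\<nexists>K::nat. \<not> - G \<subseteq> closure (- G - E (real K))"
      have "- G \<subseteq> closure (\<Inter>(range (\<lambda>K::nat. - G - E (real K))))"
      proof (rule Baire[OF closed_F])
        fix T assume "T \<in> range (\<lambda>K::nat. - G - E (real K))"
        then obtain K :: nat where T: "T = - G - E (real K)" by auto
        have "openin (top_of_set (- G)) (- G \<inter> - E (real K))"
          using closed_E by (intro openin_open_Int) auto
        then show "openin (top_of_set (- G)) T \<and> - G \<subseteq> closure T"
          using * T by (auto simp: Diff_eq)
      qed auto
      moreover have "\<Inter>(range (\<lambda>K::nat. - G - E (real K))) = {}"
      proof -
        have "\<exists>K::nat. x \<in> E (real K)" for x
          using E_ex[of x] E_mono real_arch_simple by blast
        then show ?thesis by blast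
      qed
      ultimately show False using ne by (simp only: closure_empty subset_empty)
    qed
    then obtain K :: nat and p where p: "p \<in> - G" "p \<notin> closure (- G - E (real K))" by blast
    then obtain \<epsilon> where e: "\<epsilon> > 0" "\<And>y. y \<in> - G - E (real K) \<Longrightarrow> \<not> dist y p < \<epsilon>"
      unfolding closure_approachable by blast
    have "t \<in> E (3 * real K)" if t: "t \<in> ball p \<epsilon>" for t
    proof -
      \<comment> \<open>The time \<open>s\<close> outside \<open>G\<close> nearest to
        \<open>t\<close> on the way to \<open>p\<close> is at most as far from \<open>p\<close> as
        \<open>t\<close> is, hence lies in the piece covered by \<open>E (real K)\<close>. Its bound
        is to be carried back to \<open>t\<close>.\<close>
      define S where "S = - G \<inter> closed_segment t p"
      have "closed S" unfolding S_def using closed_F by (intro closed_Int) auto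
      moreover have "p \<in> S" using p by (simp add: S_def)
      ultimately obtain s where s: "s \<in> S" "\<And>y. y \<in> S \<Longrightarrow> dist t s \<le> dist t y"
        using distance_attains_inf[of S t] by blast
      have sp: "dist s p \<le> dist t p"
        using s(1) unfolding S_def closed_segment_eq_real_ivl by (auto simp: dist_real_def split: if_splits)
      then have sE: "s \<in> E (real K)"
        using e(2)[of s] s(1) t by (auto simp: S_def dist_commute)
      obtain Kt where Kt: "t \<in> E Kt" using E_ex by blast
      \<comment> \<open>Carrying the bound of \<open>s\<close> to \<open>t\<close> needs some bound
        on the whole segment between them. It comes from the other end: compact subsegments avoiding
        \<open>s\<close> lie in \<open>G\<close>, the transfer from \<open>t\<close> gives them the
        common bound \<open>3 * Kt\<close>, and closedness of \<open>E (3 * Kt)\<close> adds the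
        endpoint \<open>s\<close>.\<close>
      have near: "x \<in> E (3 * Kt)" if x: "x \<in> closed_segment t s" "x \<noteq> s" for x
      proof -
        have "closed_segment t x \<subseteq> G"
        proof
          fix y assume y: "y \<in> closed_segment t x"
          show "y \<in> G"
          proof (rule ccontr)
            assume "y \<notin> G"
            then have "y \<in> S" using y x s(1)
              unfolding S_def closed_segment_eq_real_ivl by (auto split: if_splits)
            from s(2)[OF this] y x show False
              unfolding closed_segment_eq_real_ivl by (auto simp: dist_real_def split: if_splits)
          qed
        qed
        then obtain B where "closed_segment t x \<subseteq> E B"
          using compact_G[of "closed_segment t x"] by auto
        then show ?thesis using transfer Kt by blast
      qed
      have "closed_segment s t \<subseteq> E (3 * Kt)"
      proof (cases "s = t")
        case True
        then have "t \<in> E (3 * Kt)" using transfer[of t t Kt Kt] Kt by auto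
        then show ?thesis using True by simp
      next
        case False
        then have "closure (open_segment t s) = closed_segment t s" by simp
        moreover have "open_segment t s \<subseteq> E (3 * Kt)" using near by (auto simp: open_segment_def)
        ultimately show ?thesis using closed_E closure_minimal by (metis closed_segment_commute)
      qed
      then show ?thesis using transfer sE by blast
    qed
    then have "p \<in> G" unfolding G_def using e(1) by blast
    then show False using p by simp
  qed
  then have G: "G = UNIV" by blast
  obtain M where M: "0 \<in> E M" using E_ex by blast
  have "t \<in> E (3 * M)" for t
  proof -
    obtain B where "closed_segment 0 t \<subseteq> E B"
      using compact_G[of "closed_segment 0 t"] G by auto
    then show ?thesis using transfer M by blast
  qed
  then show thesis using that[of "3 * M"] by (auto simp: E_def)
qed

section \<open>Comparison of powers with those of the constant background\<close>

abbreviation free_pow :: "real \<Rightarrow> real \<Rightarrow> nat \<Rightarrow> int \<Rightarrow> int \<Rightarrow> real"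
  where "free_pow a0 b0 \<equiv> jpow (\<lambda>_. a0) (\<lambda>_. b0)"

lemma free_pow_shift: "free_pow a0 b0 l (m + i) (n + i) = free_pow a0 b0 l m n"
proof (induction l arbitrary: m)
  case 0
  then show ?case by (simp add: jpow_0)
next
  case (Suc l)
  from Suc[of "m + 1"] Suc[of "m - 1"] Suc[of m] show ?case
    by (simp add: jpow_Suc algebra_simps)
qed

fun dev_const :: "real \<Rightarrow> real \<Rightarrow> nat \<Rightarrow> real"
  where "dev_const M e 0 = 0"
  | "dev_const M e (Suc l) = 3 * (3 * M) ^ l + (2 * M * e + M) * dev_const M e l"

lemma dev_const_nonneg: "M \<ge> 0 \<Longrightarrow> e \<ge> 0 \<Longrightarrow> dev_const M e l \<ge> 0"
  by (induction l) auto

text \<open>Induction along \<open>H ^ Suc l - H0 ^ Suc l = (H - H0) H ^ l + H0 (H ^ l - H0 ^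
  l)\<close>, where \<open>H0\<close> is the constant background; the two terms are the two summands
  in \<open>dev_const\<close>. A weight that changes by at most the factor \<open>e\<close> between
  neighbours passes through each shift at the price of one \<open>e\<close>.\<close>

lemma jpow_deviation:
  fixes w :: "int \<Rightarrow> real"
  assumes bnd: "\<And>n. \<bar>a n\<bar> \<le> M" "\<And>n. \<bar>b n\<bar> \<le> M" "\<bar>a0\<bar> \<le> M" "\<bar>b0\<bar> \<le> M"
    and w: "\<And>j. w j \<ge> 0" "\<And>j. w j \<le> e * w (j + 1)" "\<And>j. w j \<le> e * w (j - 1)" "e \<ge> 1"
    and dev: "\<And>j. \<bar>a j - a0\<bar> * w j \<le> \<sigma>" "\<And>j. \<bar>b j - b0\<bar> * w j \<le> \<sigma>"
  shows "\<bar>jpow a b l m n - free_pow a0 b0 l m n\<bar> * w m \<le> dev_const M e l * e ^ l * \<sigma>"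
proof (induction l arbitrary: m)
  case 0
  then show ?case by (simp add: jpow_0)
next
  case (Suc l)
  have M: "M \<ge> 0" using bnd(3) by linarith
  have e: "e \<ge> 0" using w(4) by simp
  have s0: "\<sigma> \<ge> 0" using dev(1)[of 0] w(1)[of 0] by (meson abs_ge_zero mult_nonneg_nonneg order_trans)
  define u where "u j = jpow a b l j n" for j
  define v where "v j = free_pow a0 b0 l j n" for j
  define C where "C = dev_const M e l * e ^ l * \<sigma>"
  have C0: "C \<ge> 0" unfolding C_def using M e s0 by (simp add: dev_const_nonneg)
  have u: "\<bar>u j\<bar> \<le> (3 * M) ^ l" for j unfolding u_def by (rule jpow_bound) fact+
  have IH: "\<bar>u j - v j\<bar> * w j \<le> C" for j using Suc unfolding u_def v_def C_def .
  have nb: "\<bar>u j - v j\<bar> * w m \<le> e * C" if "w m \<le> e * w j" for j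
  proof -
    have "\<bar>u j - v j\<bar> * w m \<le> \<bar>u j - v j\<bar> * (e * w j)" using that by (intro mult_left_mono) auto
    also have "\<dots> = e * (\<bar>u j - v j\<bar> * w j)" by simp
    also have "\<dots> \<le> e * C" using IH e by (intro mult_left_mono)
    finally show ?thesis .
  qed
  have t1: "\<bar>x * u j\<bar> * w m \<le> e * \<sigma> * (3 * M) ^ l" if "\<bar>x\<bar> * w m \<le> e * \<sigma>" for x j
  proof -
    have "\<bar>x * u j\<bar> * w m = (\<bar>x\<bar> * w m) * \<bar>u j\<bar>" by (simp add: abs_mult)
    also have "\<dots> \<le> (e * \<sigma>) * (3 * M) ^ l"
      by (rule mult_mono[OF that u]) (use e s0 in auto)
    finally show ?thesis .
  qed
  have sl: "\<bar>x\<bar> * w m \<le> e * \<sigma>" if "w m \<le> e * w j" "\<bar>x\<bar> * w j \<le> \<sigma>" for x j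
  proof -
    have "\<bar>x\<bar> * w m \<le> \<bar>x\<bar> * (e * w j)" using that by (intro mult_left_mono) auto
    also have "\<dots> = e * (\<bar>x\<bar> * w j)" by simp
    also have "\<dots> \<le> e * \<sigma>" using that e by (intro mult_left_mono)
    finally show ?thesis .
  qed
  have t2: "\<bar>x * (u j - v j)\<bar> * w m \<le> M * D" if "\<bar>x\<bar> \<le> M" "\<bar>u j - v j\<bar> * w m \<le> D" for x j D
  proof -
    have "\<bar>x * (u j - v j)\<bar> * w m = \<bar>x\<bar> * (\<bar>u j - v j\<bar> * w m)" by (simp add: abs_mult)
    also have "\<dots> \<le> M * D" using that w(1)[of m] M by (intro mult_mono) auto
    finally show ?thesis .
  qed
  have wm: "w m \<le> e * w m" using w(1)[of m] w(4) by (simp add: mult_le_cancel_right1)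
  have "jpow a b (Suc l) m n - free_pow a0 b0 (Suc l) m n
    = (a m - a0) * u (m + 1) + (a (m - 1) - a0) * u (m - 1) + (b m - b0) * u m
      + a0 * (u (m + 1) - v (m + 1)) + a0 * (u (m - 1) - v (m - 1)) + b0 * (u m - v m)" (is "?l = ?r")
    by (simp add: jpow_Suc u_def v_def algebra_simps)
  then have "\<bar>?l\<bar> \<le> \<bar>(a m - a0) * u (m + 1)\<bar> + \<bar>(a (m - 1) - a0) * u (m - 1)\<bar> + \<bar>(b m - b0) * u m\<bar>
      + \<bar>a0 * (u (m + 1) - v (m + 1))\<bar> + \<bar>a0 * (u (m - 1) - v (m - 1))\<bar> + \<bar>b0 * (u m - v m)\<bar>"
    by linarith
  then have "\<bar>?l\<bar> * w m \<le> (\<bar>(a m - a0) * u (m + 1)\<bar> + \<bar>(a (m - 1) - a0) * u (m - 1)\<bar> + \<bar>(b m - b0) * u m\<bar>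
      + \<bar>a0 * (u (m + 1) - v (m + 1))\<bar> + \<bar>a0 * (u (m - 1) - v (m - 1))\<bar> + \<bar>b0 * (u m - v m)\<bar>) * w m"
    using w(1) by (rule mult_right_mono)
  also have "\<dots> \<le> e * \<sigma> * (3 * M) ^ l + e * \<sigma> * (3 * M) ^ l + e * \<sigma> * (3 * M) ^ l + M * (e * C) + M * (e * C) + M * C"
    unfolding distrib_right
    by (intro add_mono t1 t2 nb IH sl[of m] sl[of "m - 1" "a (m - 1) - a0"] bnd dev wm w)
  also have "\<dots> = 3 * (3 * M) ^ l * (e * \<sigma>) + (2 * M * e + M) * C"
    by (simp add: algebra_simps)
  also have "\<dots> \<le> 3 * (3 * M) ^ l * (e ^ Suc l * \<sigma>) + (2 * M * e + M) * (e * C)"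
  proof (intro add_mono mult_left_mono mult_right_mono)
    show "e \<le> e ^ Suc l" using w(4) by simp
    show "C \<le> e * C" using w(4) C0 by (simp add: mult_le_cancel_right1)
  qed (use M e s0 in auto)
  also have "\<dots> = dev_const M e (Suc l) * e ^ Suc l * \<sigma>"
    by (simp add: C_def algebra_simps)
  finally show ?case .
qed

section \<open>Propagation of spatial decay\<close>

lemma lax_kernel_deviation:
  fixes w :: "int \<Rightarrow> real"
  assumes bnd: "\<And>n. \<bar>a n\<bar> \<le> M" "\<And>n. \<bar>b n\<bar> \<le> M" "\<bar>a0\<bar> \<le> M" "\<bar>b0\<bar> \<le> M"
    and w: "\<And>j. w j \<ge> 0" "\<And>j. w j \<le> e * w (j + 1)" "\<And>j. w j \<le> e * w (j - 1)" "e \<ge> 1"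
    and dev: "\<And>j. \<bar>a j - a0\<bar> * w j \<le> \<sigma>" "\<And>j. \<bar>b j - b0\<bar> * w j \<le> \<sigma>"
  shows "\<bar>lax_kernel c s a b m k - lax_kernel c s (\<lambda>_. a0) (\<lambda>_. b0) m k\<bar> * w m
    \<le> (\<Sum>l=0..s. \<bar>c (s - l)\<bar> * (dev_const M e l * e ^ l)) * \<sigma>"
proof -
  have "\<bar>lax_kernel c s a b m k - lax_kernel c s (\<lambda>_. a0) (\<lambda>_. b0) m k\<bar> * w m
    \<le> (\<Sum>l=0..s. \<bar>c (s - l)\<bar> * \<bar>jpow a b l m k - free_pow a0 b0 l m k\<bar>) * w m"
    unfolding lax_kernel_def sum_subtractf[symmetric]
  proof (intro mult_right_mono w order_trans[OF sum_abs] sum_mono)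
    fix l
    have "\<bar>c (s - l) * (real_of_int (sgn (k - m)) * jpow a b l m k) - c (s - l) * (real_of_int (sgn (k - m)) * free_pow a0 b0 l m k)\<bar>
      = \<bar>c (s - l)\<bar> * (\<bar>real_of_int (sgn (k - m))\<bar> * \<bar>jpow a b l m k - free_pow a0 b0 l m k\<bar>)"
      by (simp only: right_diff_distrib[symmetric] abs_mult)
    also have "\<dots> \<le> \<bar>c (s - l)\<bar> * (1 * \<bar>jpow a b l m k - free_pow a0 b0 l m k\<bar>)"
      by (intro mult_left_mono mult_right_mono) (auto simp: sgn_if)
    finally show "\<bar>c (s - l) * (real_of_int (sgn (k - m)) * jpow a b l m k) - c (s - l) * (real_of_int (sgn (k - m)) * free_pow a0 b0 l m k)\<bar>
      \<le> \<bar>c (s - l)\<bar> * \<bar>jpow a b l m k - free_pow a0 b0 l m k\<bar>" by simp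
  qed
  also have "\<dots> = (\<Sum>l=0..s. \<bar>c (s - l)\<bar> * (\<bar>jpow a b l m k - free_pow a0 b0 l m k\<bar> * w m))"
    by (simp only: sum_distrib_right mult.assoc)
  also have "\<dots> \<le> (\<Sum>l=0..s. \<bar>c (s - l)\<bar> * (dev_const M e l * e ^ l * \<sigma>))"
    by (intro sum_mono mult_left_mono jpow_deviation[where \<sigma> = \<sigma>] assms) auto
  also have "\<dots> = (\<Sum>l=0..s. \<bar>c (s - l)\<bar> * (dev_const M e l * e ^ l)) * \<sigma>"
    by (simp only: sum_distrib_right mult.assoc)
  finally show ?thesis .
qed

lemma toda_g_deviation:
  fixes w :: "int \<Rightarrow> real"
  assumes bnd: "\<And>n. \<bar>a n\<bar> \<le> M" "\<And>n. \<bar>b n\<bar> \<le> M" "\<bar>a0\<bar> \<le> M" "\<bar>b0\<bar> \<le> M"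
    and w: "\<And>j. w j \<ge> 0" "\<And>j. w j \<le> e * w (j + 1)" "\<And>j. w j \<le> e * w (j - 1)" "e \<ge> 1"
    and dev: "\<And>j. \<bar>a j - a0\<bar> * w j \<le> \<sigma>" "\<And>j. \<bar>b j - b0\<bar> * w j \<le> \<sigma>"
  shows "\<bar>toda_g c a b s n - toda_g c (\<lambda>_. a0) (\<lambda>_. b0) s n\<bar> * w n
    \<le> (\<Sum>l=0..s. \<bar>c (s - l)\<bar> * (dev_const M e l * e ^ l)) * \<sigma>"
proof -
  have "\<bar>toda_g c a b s n - toda_g c (\<lambda>_. a0) (\<lambda>_. b0) s n\<bar> * w n
    \<le> (\<Sum>l=0..s. \<bar>c (s - l)\<bar> * \<bar>jpow a b l n n - free_pow a0 b0 l n n\<bar>) * w n"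
    unfolding toda_g_def sum_subtractf[symmetric] g_tilde_jpow
    by (intro mult_right_mono w order_trans[OF sum_abs] sum_mono) (simp add: right_diff_distrib[symmetric] abs_mult)
  also have "\<dots> = (\<Sum>l=0..s. \<bar>c (s - l)\<bar> * (\<bar>jpow a b l n n - free_pow a0 b0 l n n\<bar> * w n))"
    by (simp only: sum_distrib_right mult.assoc)
  also have "\<dots> \<le> (\<Sum>l=0..s. \<bar>c (s - l)\<bar> * (dev_const M e l * e ^ l * \<sigma>))"
    by (intro sum_mono mult_left_mono jpow_deviation[where \<sigma> = \<sigma>] assms) auto
  also have "\<dots> = (\<Sum>l=0..s. \<bar>c (s - l)\<bar> * (dev_const M e l * e ^ l)) * \<sigma>"
    by (simp only: sum_distrib_right mult.assoc)
  finally show ?thesis .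
qed

lemma toda_h_deviation:
  fixes w :: "int \<Rightarrow> real"
  assumes bnd: "\<And>n. \<bar>a n\<bar> \<le> M" "\<And>n. \<bar>b n\<bar> \<le> M" "\<bar>a0\<bar> \<le> M" "\<bar>b0\<bar> \<le> M"
    and w: "\<And>j. w j \<ge> 0" "\<And>j. w j \<le> e * w (j + 1)" "\<And>j. w j \<le> e * w (j - 1)" "e \<ge> 1"
    and dev: "\<And>j. \<bar>a j - a0\<bar> * w j \<le> \<sigma>" "\<And>j. \<bar>b j - b0\<bar> * w j \<le> \<sigma>"
  shows "\<bar>toda_h c a b s n - toda_h c (\<lambda>_. a0) (\<lambda>_. b0) s n\<bar> * w n
    \<le> (\<Sum>l=0..s. \<bar>c (s - l)\<bar> * (2 * (3 * M) ^ l + 2 * M * (dev_const M e l * e ^ l))) * \<sigma>"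
proof -
  have s0: "\<sigma> \<ge> 0" using dev(1)[of 0] w(1)[of 0] by (meson abs_ge_zero mult_nonneg_nonneg order_trans)
  have M: "M \<ge> 0" using bnd(3) by linarith
  have *: "\<bar>h_tilde a b l n - h_tilde (\<lambda>_. a0) (\<lambda>_. b0) l n\<bar> * w n
    \<le> (2 * (3 * M) ^ l + 2 * M * (dev_const M e l * e ^ l)) * \<sigma>" for l
  proof -
    let ?u = "jpow a b l n (n + 1)" and ?v = "free_pow a0 b0 l n (n + 1)"
    have "\<bar>h_tilde a b l n - h_tilde (\<lambda>_. a0) (\<lambda>_. b0) l n\<bar> = \<bar>2 * ((a n - a0) * ?u) + 2 * (a0 * (?u - ?v))\<bar>"
      unfolding h_tilde_jpow jpow_sym[of _ _ l "n + 1" n] by (simp add: algebra_simps)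
    also have "\<dots> \<le> 2 * (\<bar>a n - a0\<bar> * \<bar>?u\<bar>) + 2 * (\<bar>a0\<bar> * \<bar>?u - ?v\<bar>)"
      unfolding abs_mult[symmetric] by linarith
    finally have "\<bar>h_tilde a b l n - h_tilde (\<lambda>_. a0) (\<lambda>_. b0) l n\<bar> * w n
      \<le> (2 * (\<bar>a n - a0\<bar> * \<bar>?u\<bar>) + 2 * (\<bar>a0\<bar> * \<bar>?u - ?v\<bar>)) * w n"
      using w(1) by (rule mult_right_mono)
    also have "\<dots> = 2 * (\<bar>?u\<bar> * (\<bar>a n - a0\<bar> * w n)) + 2 * (\<bar>a0\<bar> * (\<bar>?u - ?v\<bar> * w n))"
      by (simp add: algebra_simps)
    also have "\<dots> \<le> 2 * ((3 * M) ^ l * \<sigma>) + 2 * (M * (dev_const M e l * e ^ l * \<sigma>))"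
      using M s0 w(1)[of n]
      by (intro add_mono mult_left_mono mult_mono jpow_bound jpow_deviation[where \<sigma> = \<sigma>] assms mult_nonneg_nonneg) auto
    finally show ?thesis by (simp add: algebra_simps)
  qed
  have "\<bar>toda_h c a b s n - toda_h c (\<lambda>_. a0) (\<lambda>_. b0) s n\<bar> * w n
    \<le> (\<Sum>l=0..s. \<bar>c (s - l)\<bar> * \<bar>h_tilde a b l n - h_tilde (\<lambda>_. a0) (\<lambda>_. b0) l n\<bar>) * w n"
    unfolding toda_h_def sum_subtractf[symmetric]
    by (intro mult_right_mono w order_trans[OF sum_abs] sum_mono) (simp add: right_diff_distrib[symmetric] abs_mult)
  also have "\<dots> = (\<Sum>l=0..s. \<bar>c (s - l)\<bar> * (\<bar>h_tilde a b l n - h_tilde (\<lambda>_. a0) (\<lambda>_. b0) l n\<bar> * w n))"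
    by (simp only: sum_distrib_right mult.assoc)
  also have "\<dots> \<le> (\<Sum>l=0..s. \<bar>c (s - l)\<bar> * ((2 * (3 * M) ^ l + 2 * M * (dev_const M e l * e ^ l)) * \<sigma>))"
    by (intro sum_mono mult_left_mono *) auto
  also have "\<dots> = (\<Sum>l=0..s. \<bar>c (s - l)\<bar> * (2 * (3 * M) ^ l + 2 * M * (dev_const M e l * e ^ l))) * \<sigma>"
    by (simp only: sum_distrib_right mult.assoc)
  finally show ?thesis .
qed

text \<open>For the constant background \<open>toda_g\<close> and \<open>toda_h\<close> do not
  depend on the site, so the background is a stationary solution. The deviations from it therefore
  satisfy a homogeneous linear differential inequality in a weighted supremum norm, to which
  \<open>gronwall_family\<close> applies in both time directions.\<close>

lemma toda_decay_propagation:
  fixes a b :: "int \<Rightarrow> real \<Rightarrow> real"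
  assumes toda: "toda_hierarchy r c a b"
    and bnd: "\<And>n t. \<bar>a n t\<bar> \<le> M" "\<And>n t. \<bar>b n t\<bar> \<le> M" "\<bar>a0\<bar> \<le> M" "\<bar>b0\<bar> \<le> M"
    and \<kappa>: "\<kappa> \<ge> 0"
    and init: "\<And>j. \<bar>a j s - a0\<bar> * exp (\<kappa> * real_of_int j) \<le> \<sigma>" "\<And>j. \<bar>b j s - b0\<bar> * exp (\<kappa> * real_of_int j) \<le> \<sigma>"
  obtains K where "K \<ge> 0" "\<And>j t. \<bar>a j t - a0\<bar> * exp (\<kappa> * real_of_int j) \<le> \<sigma> * exp (K * \<bar>t - s\<bar>)"
    "\<And>j t. \<bar>b j t - b0\<bar> * exp (\<kappa> * real_of_int j) \<le> \<sigma> * exp (K * \<bar>t - s\<bar>)"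
proof -
  define e where "e = exp \<kappa>"
  have e: "e \<ge> 1" using \<kappa> by (simp add: e_def)
  have M: "M \<ge> 0" using bnd(3) by linarith
  define Cg where "Cg = (\<Sum>l=0..r+1. \<bar>c (r + 1 - l)\<bar> * (dev_const M e l * e ^ l))"
  define Ch where "Ch = (\<Sum>l=0..r+1. \<bar>c (r + 1 - l)\<bar> * (2 * (3 * M) ^ l + 2 * M * (dev_const M e l * e ^ l)))"
  define K where "K = (M * (e + 1)) * Cg + (e + 1) * Ch"
  have Cg0: "Cg \<ge> 0" unfolding Cg_def using M e by (intro sum_nonneg mult_nonneg_nonneg dev_const_nonneg zero_le_power) auto
  have Ch0: "Ch \<ge> 0" unfolding Ch_def using M e
    by (intro sum_nonneg mult_nonneg_nonneg add_nonneg_nonneg dev_const_nonneg zero_le_power) auto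
  have K0: "K \<ge> 0" unfolding K_def using M e Cg0 Ch0 by (intro add_nonneg_nonneg mult_nonneg_nonneg) auto
  define g0 h0 where "g0 = toda_g c (\<lambda>_. a0) (\<lambda>_. b0) (r + 1)" and "h0 = toda_h c (\<lambda>_. a0) (\<lambda>_. b0) (r + 1)"
  have free: "g0 (n + i) = g0 n" "h0 (n + i) = h0 n" for n i
    using free_pow_shift[of a0 b0 _ n i n] free_pow_shift[of a0 b0 _ "n + 1" i n]
    by (simp_all add: g0_def h0_def toda_g_def toda_h_def g_tilde_jpow h_tilde_jpow add_ac)
  define g h where "g t = toda_g c (\<lambda>m. a m t) (\<lambda>m. b m t) (r + 1)"
    and "h t = toda_h c (\<lambda>m. a m t) (\<lambda>m. b m t) (r + 1)" for t
  \<comment> \<open>The weight \<open>exp (\<kappa> * real_of_int j)\<close> is unbounded and would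
    leave Gronwall without its a priori bound. Cut off at \<open>L\<close> it is bounded, and
    neighbours still differ by at most the factor \<open>e\<close>. Since \<open>K\<close> does not
    depend on \<open>L\<close>, the choice \<open>L = j\<close> at the end restores the full
    weight.\<close>
  have main: "\<bar>a j t - a0\<bar> * exp (\<kappa> * real_of_int (min j L)) \<le> \<sigma> * exp (K * \<bar>t - s\<bar>) \<and>
     \<bar>b j t - b0\<bar> * exp (\<kappa> * real_of_int (min j L)) \<le> \<sigma> * exp (K * \<bar>t - s\<bar>)" for j t L
  proof -
    define w where "w j = exp (\<kappa> * real_of_int (min j L))" for j
    have w0: "w j \<ge> 0" for j by (simp add: w_def)
    have w1: "w j \<le> e * w (j + 1)" "w j \<le> e * w (j - 1)" for j
    proof -
      have le: "\<kappa> * real_of_int (min j L) \<le> \<kappa> + \<kappa> * real_of_int (min j' L)" if "min j L \<le> 1 + min j' L" for j'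
      proof -
        have "real_of_int (min j L) \<le> 1 + real_of_int (min j' L)" using that by linarith
        then have "\<kappa> * real_of_int (min j L) \<le> \<kappa> * (1 + real_of_int (min j' L))" using \<kappa> by (rule mult_left_mono)
        then show ?thesis by (simp add: distrib_left)
      qed
      show "w j \<le> e * w (j + 1)" "w j \<le> e * w (j - 1)"
        unfolding w_def e_def exp_add[symmetric] by (auto intro!: le)
    qed
    have wle: "w j \<le> exp (\<kappa> * real_of_int j)" for j
      unfolding w_def using \<kappa> by (auto intro!: mult_left_mono)
    have wL: "w j \<le> exp (\<kappa> * real_of_int L)" for j
      unfolding w_def using \<kappa> by (auto intro!: mult_left_mono)
    define x where "x = (\<lambda>(i :: bool, j) t. if i then (a j t - a0) * w j else (b j t - b0) * w j)"
    define x' where "x' = (\<lambda>(i :: bool, j) t. if i then a j t * (g t (j + 1) - g t j) * w j else (h t j - h t (j - 1)) * w j)"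
    have der: "(x i has_real_derivative x' i t) (at t)" for i t
    proof -
      have "(a j has_real_derivative a j t * (g t (j + 1) - g t j)) (at t)"
        "(b j has_real_derivative h t j - h t (j - 1)) (at t)" for j
        using toda by (simp_all add: toda_hierarchy_def Let_def g_def h_def)
      note d = this
      have "((\<lambda>t. (a j t - a0) * w j) has_real_derivative (a j t * (g t (j + 1) - g t j)) * w j) (at t)"
        "((\<lambda>t. (b j t - b0) * w j) has_real_derivative (h t j - h t (j - 1)) * w j) (at t)" for j
        by (rule DERIV_cong, (rule DERIV_cmult_right DERIV_diff d DERIV_const)+, simp)+
      then show ?thesis by (cases i) (auto simp: x_def x'_def)
    qed
    have bd: "\<bar>x i t\<bar> \<le> (2 * M) * exp (\<kappa> * real_of_int L)" for i t
    proof -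
      have "\<bar>y * w j\<bar> \<le> (2 * M) * exp (\<kappa> * real_of_int L)" if "\<bar>y\<bar> \<le> 2 * M" for y j
        unfolding abs_mult by (intro mult_mono that) (use wL[of j] w0[of j] M in auto)
      moreover have "\<bar>a j t - a0\<bar> \<le> 2 * M" "\<bar>b j t - b0\<bar> \<le> 2 * M" for j
        using bnd(1)[of j t] bnd(2)[of j t] bnd(3,4) by linarith+
      ultimately show ?thesis by (cases i) (auto simp: x_def)
    qed
    have gr: "\<bar>x' i t\<bar> \<le> K * \<sigma>'" if \<sigma>': "\<And>i. \<bar>x i t\<bar> \<le> \<sigma>'" for i t \<sigma>'
    proof -
      have s0: "\<sigma>' \<ge> 0" using \<sigma>'[of undefined] by linarith
      have dev: "\<bar>a j t - a0\<bar> * w j \<le> \<sigma>'" "\<bar>b j t - b0\<bar> * w j \<le> \<sigma>'" for j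
        using \<sigma>'[of "(True, j)"] \<sigma>'[of "(False, j)"] w0[of j] by (simp_all add: x_def abs_mult)
      have G: "\<bar>g t j - g0 j\<bar> * w j \<le> Cg * \<sigma>'" for j
        unfolding g_def g0_def Cg_def by (rule toda_g_deviation) (use bnd w0 w1 e dev in auto)
      have H: "\<bar>h t j - h0 j\<bar> * w j \<le> Ch * \<sigma>'" for j
        unfolding h_def h0_def Ch_def by (rule toda_h_deviation) (use bnd w0 w1 e dev in auto)
      have shift: "\<bar>y\<bar> * w j \<le> e * C" if "w j \<le> e * w j'" "\<bar>y\<bar> * w j' \<le> C" for y j j' C
      proof -
        have "\<bar>y\<bar> * w j \<le> \<bar>y\<bar> * (e * w j')" using that by (intro mult_left_mono) auto
        also have "\<dots> = e * (\<bar>y\<bar> * w j')" by simp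
        also have "\<dots> \<le> e * C" using that e by (intro mult_left_mono) auto
        finally show ?thesis .
      qed
      have "\<bar>a j t * (g t (j + 1) - g t j) * w j\<bar> \<le> K * \<sigma>'" for j
      proof -
        have "\<bar>g t (j + 1) - g t j\<bar> * w j \<le> (\<bar>g t (j + 1) - g0 (j + 1)\<bar> + \<bar>g t j - g0 j\<bar>) * w j"
          using free[of j 1] w0[of j] by (intro mult_right_mono) auto
        also have "\<dots> \<le> e * (Cg * \<sigma>') + Cg * \<sigma>'"
          unfolding distrib_right using G w1 by (intro add_mono shift) auto
        finally have *: "\<bar>g t (j + 1) - g t j\<bar> * w j \<le> e * (Cg * \<sigma>') + Cg * \<sigma>'" .
        have "\<bar>a j t * (g t (j + 1) - g t j) * w j\<bar> = \<bar>a j t\<bar> * (\<bar>g t (j + 1) - g t j\<bar> * w j)"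
          using w0[of j] by (simp add: abs_mult)
        also have "\<dots> \<le> M * (e * (Cg * \<sigma>') + Cg * \<sigma>')"
          using * bnd M w0[of j] by (intro mult_mono) auto
        also have "\<dots> = ((M * (e + 1)) * Cg) * \<sigma>'" by (simp add: algebra_simps)
        also have "\<dots> \<le> K * \<sigma>'" unfolding K_def using s0 e Ch0 by (intro mult_right_mono) auto
        finally show ?thesis .
      qed
      moreover have "\<bar>(h t j - h t (j - 1)) * w j\<bar> \<le> K * \<sigma>'" for j
      proof -
        have "\<bar>h t j - h t (j - 1)\<bar> * w j \<le> (\<bar>h t j - h0 j\<bar> + \<bar>h t (j - 1) - h0 (j - 1)\<bar>) * w j"
          using free[of "j - 1" 1] w0[of j] by (intro mult_right_mono) auto
        also have "\<dots> \<le> Ch * \<sigma>' + e * (Ch * \<sigma>')"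
          unfolding distrib_right by (intro add_mono H shift[of j "j - 1"] w1)
        also have "\<dots> = ((e + 1) * Ch) * \<sigma>'" by (simp add: algebra_simps)
        also have "\<dots> \<le> K * \<sigma>'" unfolding K_def using s0 e Cg0 M by (intro mult_right_mono) auto
        finally show ?thesis using w0[of j] by (simp add: abs_mult)
      qed
      ultimately show ?thesis by (cases i) (auto simp: x'_def)
    qed
    have ini: "\<bar>x i s\<bar> \<le> \<sigma>" for i
    proof -
      have "\<bar>y * w j\<bar> \<le> \<sigma>" if "\<bar>y\<bar> * exp (\<kappa> * real_of_int j) \<le> \<sigma>" for y j
      proof -
        have "\<bar>y * w j\<bar> = \<bar>y\<bar> * w j" using w0[of j] by (simp add: abs_mult)
        also have "\<dots> \<le> \<bar>y\<bar> * exp (\<kappa> * real_of_int j)" using wle by (intro mult_left_mono) auto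
        finally show ?thesis using that by simp
      qed
      then show ?thesis using init by (cases i) (auto simp: x_def)
    qed
    have "\<bar>x i t\<bar> \<le> \<sigma> * exp (K * \<bar>t - s\<bar>)" for i
    proof (cases "s \<le> t")
      case True
      have "\<bar>x i t\<bar> \<le> \<sigma> * exp (K * (t - s))"
        by (rule gronwall_family[where u = t and B = "(2 * M) * exp (\<kappa> * real_of_int L)" and x' = x'])
          (use der bd gr ini True in auto)
      then show ?thesis using True by simp
    next
      case False
      have "\<bar>x i t\<bar> \<le> \<sigma> * exp (K * (s - t))"
        by (rule gronwall_family_reverse[where u = t and B = "(2 * M) * exp (\<kappa> * real_of_int L)" and x' = x'])
          (use der bd gr ini False in auto)
      then show ?thesis using False by simp
    qed
    from this[of "(True, j)"] this[of "(False, j)"] w0[of j] show ?thesis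
      by (simp add: x_def abs_mult w_def)
  qed
  show thesis
  proof (rule that[OF K0])
    fix j t
    show "\<bar>a j t - a0\<bar> * exp (\<kappa> * real_of_int j) \<le> \<sigma> * exp (K * \<bar>t - s\<bar>)"
      "\<bar>b j t - b0\<bar> * exp (\<kappa> * real_of_int j) \<le> \<sigma> * exp (K * \<bar>t - s\<bar>)"
      using main[of j t j] by simp_all
  qed
qed

section \<open>The resolvent and the reflection coefficient\<close>

text \<open>Kernel of the inverse of \<open>H - z\<close> by its Neumann series, hence the leading
  minus sign; it is used for \<open>z\<close> so large that \<open>jpow_bound\<close> makes the
  series converge.\<close>

definition green :: "(int \<Rightarrow> real) \<Rightarrow> (int \<Rightarrow> real) \<Rightarrow> complex \<Rightarrow> int \<Rightarrow> int \<Rightarrow> complex"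
  where "green a b z m n = - (\<Sum>l. of_real (jpow a b l m n) / z ^ Suc l)"

text \<open>Joukowski parametrisation: \<open>\<zeta> powi n\<close> and
  \<open>\<zeta> powi (- n)\<close> both solve the eigenvalue equation of the constant background at
  this energy.\<close>

definition energy :: "real \<Rightarrow> real \<Rightarrow> complex \<Rightarrow> complex"
  where "energy a0 b0 \<zeta> = of_real a0 * (\<zeta> + 1 / \<zeta>) + of_real b0"

text \<open>The subtracted term is the diagonal of the resolvent of the constant background for
  \<zeta> outside the unit circle.\<close>

definition green_dev :: "(int \<Rightarrow> real) \<Rightarrow> (int \<Rightarrow> real) \<Rightarrow> real \<Rightarrow> real \<Rightarrow> complex \<Rightarrow> int \<Rightarrow> complex"
  where "green_dev a b a0 b0 \<zeta> n = green a b (energy a0 b0 \<zeta>) n n - 1 / (of_real a0 * (1 / \<zeta> - \<zeta>))"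

text \<open>Far to the right the diagonal deviation is a constant multiple of
  \<open>(1 / \<zeta>) ^ (2 * N)\<close> up to the contribution of the tail; the power of \<zeta>
  extracts that constant.\<close>

definition refl_seq :: "(int \<Rightarrow> real) \<Rightarrow> (int \<Rightarrow> real) \<Rightarrow> real \<Rightarrow> real \<Rightarrow> complex \<Rightarrow> nat \<Rightarrow> complex"
  where "refl_seq a b a0 b0 \<zeta> N = \<zeta> ^ (2 * N) * green_dev a b a0 b0 \<zeta> (int N)"

text \<open>Up to the factor \<open>a0 * (1 / \<zeta> - \<zeta>)\<close> this is the right reflection coefficient at the
  spectral parameter \<open>1 / \<zeta>\<close>: with \<open>u\<close> and \<open>v\<close> the Jost solutions asymptotic to \<open>\<zeta> ^ n\<close> and
  \<open>\<zeta> powi (- n)\<close> at \<open>+\<infinity>\<close>, the diagonal of the resolvent is proportional to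
  \<open>(u n + R * v n) * v n\<close>.\<close>

definition refl_coef :: "(int \<Rightarrow> real) \<Rightarrow> (int \<Rightarrow> real) \<Rightarrow> real \<Rightarrow> real \<Rightarrow> complex \<Rightarrow> complex"
  where "refl_coef a b a0 b0 \<zeta> = lim (refl_seq a b a0 b0 \<zeta>)"

definition tail_bound :: "(int \<Rightarrow> real) \<Rightarrow> (int \<Rightarrow> real) \<Rightarrow> real \<Rightarrow> real \<Rightarrow> int \<Rightarrow> real \<Rightarrow> bool"
  where "tail_bound a b a0 b0 m D \<longleftrightarrow> (\<forall>j\<ge>m. \<bar>a j - a0\<bar> \<le> D \<and> \<bar>b j - b0\<bar> \<le> D)"

lemma tail_bound_nonneg: "tail_bound a b a0 b0 m D \<Longrightarrow> D \<ge> 0"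
  unfolding tail_bound_def by (meson abs_ge_zero order_refl order_trans)

text \<open>The recursion is solved from infinity: after \<open>N\<close> steps \<open>B\<close>
  enters only as \<open>B / 2 ^ N\<close>, and the source terms form a geometric series with sum
  \<open>2 * s\<close>.\<close>

lemma halving_bound:
  fixes x :: "nat \<Rightarrow> real"
  assumes "\<And>i. x i \<le> B" "\<And>i. x i \<le> x (Suc i) / 2 + s"
  shows "x i \<le> 2 * s"
proof -
  have *: "x i \<le> B / 2 ^ N + 2 * s * (1 - 1 / 2 ^ N)" for N i
  proof (induction N arbitrary: i)
    case 0
    then show ?case using assms(1) by simp
  next
    case (Suc N)
    have "x i \<le> R / 2 + s" if "x (Suc i) \<le> R" for R
      using assms(2)[of i] that by linarith
    from this[OF Suc[of "Suc i"]] have "x i \<le> (B / 2 ^ N + 2 * s * (1 - 1 / 2 ^ N)) / 2 + s" .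
    also have "\<dots> = B / 2 ^ Suc N + 2 * s * (1 - 1 / 2 ^ Suc N)"
      by (simp add: field_simps)
    finally show ?case .
  qed
  have "(\<lambda>N. B * (1 / 2) ^ N + 2 * s * (1 - (1 / 2) ^ N)) \<longlonglongrightarrow> B * 0 + 2 * s * (1 - 0)"
    by (intro tendsto_intros LIMSEQ_power_zero) auto
  then have "(\<lambda>N. B / 2 ^ N + 2 * s * (1 - 1 / 2 ^ N)) \<longlonglongrightarrow> 2 * s"
    by (simp add: power_one_over field_simps)
  then show ?thesis by (rule tendsto_lowerbound) (use * in auto)
qed

lemma wronskian_step_algebra:
  fixes k \<zeta> :: complex
  assumes "k * \<zeta> = 1" "A * gp + B * gm + C * g = (a0 * (\<zeta> + k) + b0) * g + \<delta>"
  shows "B * (k * gm - g) = k * (A * (k * g - gp)) - k * ((A - a0) * k + (B - a0) * \<zeta> + (C - b0)) * g + k * \<delta>"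
  using assms by algebra

text \<open>The lower bound on \<zeta> gives at once \<open>norm \<zeta> \<ge> 2\<close>,
  \<open>norm z \<ge> 6 * M\<close> and \<open>norm z \<ge> 4\<close>. Thus multiplication by
  \<open>k\<close> contracts by 1/2, the Neumann series has ratio at most 1/2, and every entry of
  \<open>G\<close> has modulus at most 1.\<close>

locale jacobi_energy =
  fixes a b :: "int \<Rightarrow> real" and M a0 b0 :: real and \<zeta> :: complex
  assumes a_bound: "\<And>n. \<bar>a n\<bar> \<le> M" and b_bound: "\<And>n. \<bar>b n\<bar> \<le> M"
    and a0_pos: "a0 > 0" and a0_bound: "a0 \<le> M" and b0_bound: "\<bar>b0\<bar> \<le> M"
    and large: "norm \<zeta> \<ge> (12 * M + 8) / a0 + 2"
begin

abbreviation k :: complex where "k \<equiv> 1 / \<zeta>"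
abbreviation z :: complex where "z \<equiv> energy a0 b0 \<zeta>"
abbreviation G :: "int \<Rightarrow> int \<Rightarrow> complex" where "G \<equiv> green a b z"
abbreviation \<gamma> :: "int \<Rightarrow> complex" where "\<gamma> \<equiv> green_dev a b a0 b0 \<zeta>"
abbreviation tail :: "int \<Rightarrow> real \<Rightarrow> bool" where "tail \<equiv> tail_bound a b a0 b0"

text \<open>Up to the factor \<open>k ^ m\<close>, the Wronskian of the column \<open>G m n\<close>
  with the free decaying solution \<open>k ^ m\<close>. It vanishes exactly when the column makes a
  free step, \<open>G (m + 1) n = k * G m n\<close>.\<close>

definition \<theta> :: "int \<Rightarrow> int \<Rightarrow> complex"
  where "\<theta> m n = of_real (a m) * (k * G m n - G (m + 1) n)"

text \<open>The perturbation \<open>H - H0\<close> applied to the sequence \<open>k ^ m\<close>,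
  divided by \<open>k ^ m\<close>.\<close>

definition v :: "int \<Rightarrow> complex"
  where "v m = of_real (a m - a0) * k + of_real (a (m - 1) - a0) * \<zeta> + of_real (b m - b0)"

lemma M_pos: "M > 0"
  using a0_pos a0_bound by linarith

lemma norm_\<zeta>: "norm \<zeta> \<ge> 2"
proof -
  have "(12 * M + 8) / a0 \<ge> 0" using M_pos a0_pos by simp
  then show ?thesis using large by linarith
qed

lemma \<zeta>_nz: "\<zeta> \<noteq> 0"
  using norm_\<zeta> by auto

lemma norm_k: "norm k \<le> 1 / 2"
proof -
  have "1 / norm \<zeta> \<le> 1 / 2" using norm_\<zeta> by (intro divide_left_mono) auto
  then show ?thesis by (simp add: norm_divide)
qed

lemma z_lower: "norm z \<ge> a0 / 2 * norm \<zeta>" "norm z \<ge> 6 * M" "norm z \<ge> 4"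
proof -
  have big: "a0 * norm \<zeta> \<ge> 12 * M + 8"
  proof -
    have "(12 * M + 8) / a0 \<le> norm \<zeta>" using large by linarith
    then show ?thesis using a0_pos by (simp add: divide_le_eq mult.commute)
  qed
  have "norm (of_real a0 * \<zeta>) \<le> norm z + norm (of_real a0 * k) + norm (of_real b0 :: complex)"
  proof -
    have "of_real a0 * \<zeta> = z - of_real a0 * k - of_real b0"
      by (simp add: energy_def algebra_simps)
    then show ?thesis
      using norm_triangle_ineq4[of "z - of_real a0 * k" "of_real b0"] norm_triangle_ineq4[of z "of_real a0 * k"]
      by simp
  qed
  moreover have "norm (of_real a0 * k) \<le> M"
  proof -
    have "norm (of_real a0 * k) \<le> M * (1 / 2)"
      unfolding norm_mult using norm_k a0_pos a0_bound by (intro mult_mono) auto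
    then show ?thesis using M_pos by linarith
  qed
  ultimately have "a0 * norm \<zeta> \<le> norm z + M + M"
    using a0_pos b0_bound by (simp add: norm_mult)
  then show "norm z \<ge> a0 / 2 * norm \<zeta>" "norm z \<ge> 6 * M" "norm z \<ge> 4"
    using big M_pos by linarith+
qed

lemma z_nz: "z \<noteq> 0"
  using z_lower(3) by auto

lemma ratio: "3 * M / norm z \<ge> 0" "3 * M / norm z \<le> 1 / 2"
proof -
  have "norm z > 0" using z_lower(3) by linarith
  then show "3 * M / norm z \<ge> 0" "3 * M / norm z \<le> 1 / 2"
    using z_lower(2) M_pos by (simp_all add: pos_divide_le_eq)
qed

lemma term_bound: "norm (of_real (jpow a b l m n) / z ^ Suc l) \<le> 1 / norm z * (3 * M / norm z) ^ l"
proof -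
  have "norm (of_real (jpow a b l m n) / z ^ Suc l) = \<bar>jpow a b l m n\<bar> / norm z ^ Suc l"
    by (simp add: norm_divide norm_mult norm_power)
  also have "\<dots> \<le> (3 * M) ^ l / norm z ^ Suc l"
    by (intro divide_right_mono jpow_bound a_bound b_bound) auto
  finally show ?thesis by (simp add: power_divide)
qed

lemma ratio_summable: "summable (\<lambda>l. 1 / norm z * (3 * M / norm z) ^ l)"
  using ratio by (intro summable_mult summable_geometric) auto

lemma green_summable: "summable (\<lambda>l. of_real (jpow a b l m n) / z ^ Suc l)"
  by (rule summable_comparison_test'[OF ratio_summable]) (rule term_bound)

text \<open>By the band structure the terms of order below the distance of \<open>m\<close> and
  \<open>n\<close> vanish, so the geometric majorant starts at that power.\<close>

lemma green_bound: "norm (G m n) \<le> 2 / norm z * (3 * M / norm z) ^ nat \<bar>m - n\<bar>"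
proof -
  define d where "d = nat \<bar>m - n\<bar>"
  define f where "f l = of_real (jpow a b l m n) / z ^ Suc l" for l
  have sf: "summable f" unfolding f_def by (rule green_summable)
  have "(\<Sum>l. f l) = (\<Sum>l. f (l + d)) + (\<Sum>l<d. f l)"
    by (rule suminf_split_initial_segment[OF sf])
  also have "(\<Sum>l<d. f l) = 0"
    by (intro sum.neutral ballI) (auto simp: f_def d_def jpow_band)
  finally have "G m n = - (\<Sum>l. f (l + d))"
    by (simp add: green_def f_def)
  also have "norm \<dots> \<le> (\<Sum>l. 1 / norm z * (3 * M / norm z) ^ d * (1 / 2) ^ l)"
    unfolding norm_minus_cancel
  proof (rule norm_suminf_le)
    fix l
    have "norm (f (l + d)) \<le> 1 / norm z * (3 * M / norm z) ^ (l + d)"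
      unfolding f_def by (rule term_bound)
    also have "\<dots> = 1 / norm z * (3 * M / norm z) ^ d * (3 * M / norm z) ^ l"
      by (simp add: power_add)
    also have "\<dots> \<le> 1 / norm z * (3 * M / norm z) ^ d * (1 / 2) ^ l"
      using ratio M_pos by (intro mult_left_mono power_mono) auto
    finally show "norm (f (l + d)) \<le> 1 / norm z * (3 * M / norm z) ^ d * (1 / 2) ^ l" .
  qed (intro summable_mult summable_geometric, simp)
  also have "\<dots> = 1 / norm z * (3 * M / norm z) ^ d * (\<Sum>l. (1 / 2) ^ l)"
    by (intro suminf_mult summable_geometric) simp
  also have "(\<Sum>l. (1 / 2 :: real) ^ l) = 2"
    by (subst suminf_geometric) auto
  finally show ?thesis by (simp add: d_def mult_ac)
qed

lemma green_le: "norm (G m n) \<le> 2 / norm z"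
proof -
  have "2 / norm z * (3 * M / norm z) ^ nat \<bar>m - n\<bar> \<le> 2 / norm z * 1"
    using ratio by (intro mult_left_mono power_le_one) auto
  then show ?thesis using green_bound[of m n] by linarith
qed

lemma green_le_1: "norm (G m n) \<le> 1"
proof -
  have "norm z \<ge> 2" "norm z > 0" using z_lower(3) by linarith+
  then have "2 / norm z \<le> 1" by (simp add: pos_divide_le_eq)
  then show ?thesis using green_le[of m n] by linarith
qed

lemma green_sym: "G m n = G n m"
  unfolding green_def by (simp add: jpow_sym[of a b _ m n])

lemma green_eq:
  "of_real (a m) * G (m + 1) n + of_real (a (m - 1)) * G (m - 1) n + of_real (b m) * G m n
    = z * G m n + (if m = n then 1 else 0)"
proof -
  define f where "f m l = of_real (jpow a b l m n) / z ^ Suc l" for m l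
  have sf: "f m sums - G m n" for m
    unfolding f_def green_def using green_summable summable_sums by fastforce
  have "(\<lambda>l. of_real (a m) * f (m + 1) l + of_real (a (m - 1)) * f (m - 1) l + of_real (b m) * f m l)
    sums (of_real (a m) * - G (m + 1) n + of_real (a (m - 1)) * - G (m - 1) n + of_real (b m) * - G m n)"
    by (intro sums_add sums_mult sf)
  moreover have "of_real (a m) * f (m + 1) l + of_real (a (m - 1)) * f (m - 1) l + of_real (b m) * f m l
    = z * f m (Suc l)" for l
    using z_nz by (simp add: f_def jpow_Suc field_simps)
  moreover have "(\<lambda>l. z * f m (Suc l)) sums (z * (- G m n - f m 0))"
    by (intro sums_mult) (use sums_Suc_iff[of "f m" "- G m n - f m 0"] sf in simp)
  ultimately have 1: "of_real (a m) * - G (m + 1) n + of_real (a (m - 1)) * - G (m - 1) n + of_real (b m) * - G m n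
    = z * (- G m n - f m 0)"
    using sums_unique2 by simp
  have 2: "z * f m 0 = (if m = n then 1 else 0)"
    using z_nz by (simp add: f_def jpow_0)
  have "of_real (a m) * G (m + 1) n + of_real (a (m - 1)) * G (m - 1) n + of_real (b m) * G m n
    = - (of_real (a m) * - G (m + 1) n + of_real (a (m - 1)) * - G (m - 1) n + of_real (b m) * - G m n)"
    by simp
  also have "\<dots> = z * G m n + z * f m 0"
    unfolding 1 by (simp add: right_diff_distrib)
  also have "\<dots> = z * G m n + (if m = n then 1 else 0)"
    unfolding 2 ..
  finally show ?thesis .
qed

text \<open>The Wronskian identity, read from right to left. In this direction the factor
  \<open>k\<close> contracts, so \<theta> at \<open>m\<close> is controlled by the coefficients to
  the right of \<open>m\<close>.\<close>

lemma \<theta>_rec: "\<theta> (m - 1) n = k * \<theta> m n - k * v m * G m n + (if m = n then k else 0)"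
proof -
  have "k * \<zeta> = 1" using \<zeta>_nz by simp
  from wronskian_step_algebra[OF this, of "of_real (a m)" "G (m + 1) n" "of_real (a (m - 1))" "G (m - 1) n"
      "of_real (b m)" "G m n" "of_real a0" "of_real b0" "if m = n then 1 else 0"] green_eq[of m n]
  show ?thesis by (auto simp: \<theta>_def v_def energy_def)
qed

lemma v_bound:
  assumes "tail m D" "j > m"
  shows "norm (k * v j) \<le> 3 * D"
proof -
  have D: "D \<ge> 0" using assms(1) by (rule tail_bound_nonneg)
  have d: "\<bar>a j - a0\<bar> \<le> D" "\<bar>a (j - 1) - a0\<bar> \<le> D" "\<bar>b j - b0\<bar> \<le> D"
    using assms unfolding tail_bound_def by auto
  have "k * v j = of_real (a j - a0) * (k * k) + of_real (a (j - 1) - a0) + of_real (b j - b0) * k"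
    using \<zeta>_nz by (simp add: v_def field_simps)
  moreover have "norm (of_real (a j - a0) * (k * k)) \<le> D * 1"
    unfolding norm_mult using d D norm_k
    by (intro mult_mono mult_le_one) (auto simp del: of_real_diff)
  moreover have "norm (of_real (b j - b0) * k) \<le> D * 1"
    unfolding norm_mult using d D norm_k
    by (intro mult_mono) (auto simp del: of_real_diff)
  moreover have "norm (of_real (a (j - 1) - a0) :: complex) \<le> D"
    using d by (simp del: of_real_diff)
  ultimately show ?thesis
    using norm_triangle_ineq[of "of_real (a j - a0) * (k * k) + of_real (a (j - 1) - a0)" "of_real (b j - b0) * k"]
      norm_triangle_ineq[of "of_real (a j - a0) * (k * k)" "of_real (a (j - 1) - a0)"] by simp
qed

text \<open>\<open>\<theta>_rec\<close> is summed from infinity by \<open>halving_bound\<close>. The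
  sites \<open>j > m\<close> never meet the source at \<open>n\<close>, and each contributes at most
  \<open>3 * D * g\<close>.\<close>

lemma \<theta>_bound:
  assumes D: "tail m D" and mn: "n \<le> m" and g: "\<And>j. j > m \<Longrightarrow> norm (G j n) \<le> g"
  shows "norm (\<theta> m n) \<le> 6 * D * g"
proof -
  have D0: "D \<ge> 0" using D by (rule tail_bound_nonneg)
  define x where "x i = norm (\<theta> (m + int i) n)" for i
  have "x 0 \<le> 2 * (3 * D * g)"
  proof (rule halving_bound[where x = x and B = "M * 2"])
    fix i
    have "x i \<le> M * (1 + 1)"
      unfolding x_def \<theta>_def norm_mult
    proof (rule mult_mono)
      have "norm (k * G (m + int i) n) \<le> 1"
        unfolding norm_mult using norm_k green_le_1[of "m + int i" n] by (intro mult_le_one) auto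
      then show "norm (k * G (m + int i) n - G (m + int i + 1) n) \<le> 1 + 1"
        using green_le_1[of "m + int i + 1" n] norm_triangle_ineq4[of "k * G (m + int i) n" "G (m + int i + 1) n"]
        by linarith
    qed (use a_bound M_pos in auto)
    then show "x i \<le> M * 2" by simp
    let ?j = "m + int (Suc i)"
    have "\<theta> (m + int i) n = k * \<theta> ?j n - k * v ?j * G ?j n"
      using \<theta>_rec[of ?j n] mn by simp
    then have "x i \<le> norm (k * \<theta> ?j n) + norm (k * v ?j * G ?j n)"
      unfolding x_def by (metis norm_triangle_ineq4)
    also have "norm (k * \<theta> ?j n) \<le> 1 / 2 * x (Suc i)"
      unfolding norm_mult x_def using norm_k by (intro mult_right_mono) auto
    also have "norm (k * v ?j * G ?j n) \<le> 3 * D * g"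
      unfolding norm_mult[of "k * v ?j"] using D0 by (intro mult_mono v_bound[OF D] g) auto
    finally show "x i \<le> x (Suc i) / 2 + 3 * D * g" by simp
  qed
  then show ?thesis by (simp add: x_def)
qed

text \<open>The definition of \<theta> solved for the error of one free step, with
  \<open>a m\<close> replaced by \<open>a0\<close>; 7 is 1 + 6, the 6 coming from
  \<open>\<theta>_bound\<close>. The parameter \<open>g\<close> is kept because
  \<open>green_column_bound\<close> needs the smallness of the column itself, not only the bound 1
  of \<open>green_step'\<close>.\<close>

lemma green_step:
  assumes D: "tail m D" and mn: "n \<le> m" and g: "\<And>j. j > m \<Longrightarrow> norm (G j n) \<le> g"
  shows "norm (G (m + 1) n - k * G m n) \<le> D / a0 * (7 * g + norm k * norm (G m n))"
proof -
  have D0: "D \<ge> 0" using D by (rule tail_bound_nonneg)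
  have eq: "of_real a0 * (G (m + 1) n - k * G m n) = of_real (a0 - a m) * G (m + 1) n - of_real (a0 - a m) * (k * G m n) - \<theta> m n"
    unfolding \<theta>_def of_real_diff left_diff_distrib right_diff_distrib by (simp only: add_diff_eq diff_diff_eq2 ac_simps) simp
  have "norm (of_real (a0 - a m) * G (m + 1) n) \<le> D * g"
    unfolding norm_mult using D D0 g[of "m + 1"]
    by (intro mult_mono) (auto simp: tail_bound_def abs_minus_commute simp del: of_real_diff)
  moreover have "norm (of_real (a0 - a m) * (k * G m n)) \<le> D * (norm k * norm (G m n))"
    unfolding norm_mult using D D0
    by (intro mult_right_mono) (auto simp: tail_bound_def abs_minus_commute simp del: of_real_diff)
  moreover have "norm (\<theta> m n) \<le> 6 * D * g" by (rule \<theta>_bound) fact+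
  ultimately have "norm (of_real a0 * (G (m + 1) n - k * G m n)) \<le> D * g + D * (norm k * norm (G m n)) + 6 * D * g"
    unfolding eq
    using norm_triangle_ineq4[of "of_real (a0 - a m) * G (m + 1) n" "of_real (a0 - a m) * (k * G m n)"]
      norm_triangle_ineq4[of "of_real (a0 - a m) * G (m + 1) n - of_real (a0 - a m) * (k * G m n)" "\<theta> m n"]
    by linarith
  then have "a0 * norm (G (m + 1) n - k * G m n) \<le> D * (7 * g + norm k * norm (G m n))"
    using a0_pos by (simp only: norm_mult norm_of_real) (simp add: algebra_simps)
  then show ?thesis
    using a0_pos by (simp add: pos_le_divide_eq mult.commute)
qed

lemma green_step': "tail m D \<Longrightarrow> n \<le> m \<Longrightarrow> norm (G (m + 1) n - k * G m n) \<le> 8 / a0 * D"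
proof -
  assume *: "tail m D" "n \<le> m"
  have D0: "D \<ge> 0" using *(1) by (rule tail_bound_nonneg)
  have "norm k * norm (G m n) \<le> 1"
    using norm_k green_le_1[of m n] by (intro mult_le_one) auto
  then have "D / a0 * (7 * 1 + norm k * norm (G m n)) \<le> D / a0 * 8"
    using D0 a0_pos by (intro mult_left_mono) auto
  then show ?thesis using green_step[OF *, of 1] green_le_1 by (simp add: mult.commute)
qed

lemma k_\<zeta>_nz: "k - \<zeta> \<noteq> 0"
proof
  assume "k - \<zeta> = 0"
  then have "norm k = norm \<zeta>" by simp
  then show False using norm_k norm_\<zeta> by linarith
qed

text \<open>Moving each of the two arguments of \<open>G\<close> by one site costs a factor
  \<open>k\<close>. The second move crosses the source of \<open>\<theta>_rec\<close>, which adds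
  \<open>k\<close>, and this is precisely what the free diagonal satisfies, so it cancels in the
  deviation. The constant is 17 = 1 + 1 + 6 + 6 + 3.\<close>

lemma green_dev_step:
  assumes D: "tail (n - 1) D"
  shows "norm (\<gamma> n - k ^ 2 * \<gamma> (n - 1)) \<le> 17 / a0 * D"
proof -
  have D0: "D \<ge> 0" using D by (rule tail_bound_nonneg)
  have Dn: "tail n D" using D by (auto simp: tail_bound_def)
  let ?a = "of_real (a (n - 1)) :: complex"
  have "?a * (k ^ 2 * G (n - 1) (n - 1) - G n n) = k * \<theta> (n - 1) (n - 1) + \<theta> (n - 1) n"
    by (simp add: \<theta>_def green_sym[of n "n - 1"] power2_eq_square algebra_simps)
  also have "\<dots> = k * \<theta> (n - 1) (n - 1) + (k * \<theta> n n - k * v n * G n n + k)"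
    using \<theta>_rec[of n n] by simp
  finally have e: "?a * (k ^ 2 * G (n - 1) (n - 1) - G n n) = k * \<theta> (n - 1) (n - 1) + (k * \<theta> n n - k * v n * G n n + k)" .
  have free: "of_real a0 * ((k ^ 2 - 1) * (1 / (of_real a0 * (k - \<zeta>)))) = k"
  proof -
    have "k ^ 2 - 1 = k * (k - \<zeta>)" using \<zeta>_nz by (simp add: power2_eq_square algebra_simps)
    then show ?thesis using k_\<zeta>_nz a0_pos by simp
  qed
  have "of_real a0 * (k ^ 2 * (g' - g0) - (g - g0)) = of_real a0 * (k ^ 2 * g' - g) - of_real a0 * ((k ^ 2 - 1) * g0)"
    for g g' g0 by (simp add: algebra_simps)
  then have "of_real a0 * (k ^ 2 * \<gamma> (n - 1) - \<gamma> n)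
      = of_real a0 * (k ^ 2 * G (n - 1) (n - 1) - G n n) - of_real a0 * ((k ^ 2 - 1) * (1 / (of_real a0 * (k - \<zeta>))))"
    unfolding green_dev_def by blast
  also have "\<dots> = of_real a0 * (k ^ 2 * G (n - 1) (n - 1) - G n n) - k"
    unfolding free ..
  also have "\<dots> = of_real (a0 - a (n - 1)) * (k ^ 2 * G (n - 1) (n - 1)) - of_real (a0 - a (n - 1)) * G n n
      + (k * \<theta> (n - 1) (n - 1) + (k * \<theta> n n - k * v n * G n n))"
    using e by (simp add: algebra_simps)
  finally have eq: "of_real a0 * (k ^ 2 * \<gamma> (n - 1) - \<gamma> n) = \<dots>" .
  have t1: "norm (of_real (a0 - a (n - 1)) * y) \<le> D" if "norm y \<le> 1" for y :: complex
  proof -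
    have "norm (of_real (a0 - a (n - 1)) * y) \<le> D * 1"
      unfolding norm_mult using D D0 that
      by (intro mult_mono) (auto simp: tail_bound_def abs_minus_commute simp del: of_real_diff)
    then show ?thesis by simp
  qed
  have t2: "norm (k * y) \<le> 6 * D" if "norm y \<le> 6 * D" for y
  proof -
    have "norm (k * y) \<le> 1 * (6 * D)"
      unfolding norm_mult using norm_k that D0 by (intro mult_mono) auto
    then show ?thesis by simp
  qed
  have "norm (\<theta> n n) \<le> 6 * D * 1" "norm (\<theta> (n - 1) (n - 1)) \<le> 6 * D * 1"
    by (intro \<theta>_bound Dn D green_le_1 order_refl)+
  then have th: "norm (k * \<theta> n n) \<le> 6 * D" "norm (k * \<theta> (n - 1) (n - 1)) \<le> 6 * D"
    using t2[of "\<theta> n n"] t2[of "\<theta> (n - 1) (n - 1)"] by simp_all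
  have vG: "norm (k * v n * G n n) \<le> 3 * D * 1"
    unfolding norm_mult[of "k * v n"] using D0 by (intro mult_mono v_bound[OF D] green_le_1) auto
  have kG: "norm (k ^ 2 * G (n - 1) (n - 1)) \<le> 1"
    unfolding norm_mult norm_power using norm_k green_le_1[of "n - 1" "n - 1"]
    by (intro mult_le_one power_le_one) auto
  have "norm (of_real a0 * (k ^ 2 * \<gamma> (n - 1) - \<gamma> n)) \<le> D + D + (6 * D + (6 * D + 3 * D * 1))"
    unfolding eq
    by (intro norm_triangle_le norm_triangle_le_diff add_mono t1 kG green_le_1 th vG)
  then have "a0 * norm (\<gamma> n - k ^ 2 * \<gamma> (n - 1)) \<le> 17 * D"
    using a0_pos by (simp only: norm_mult norm_of_real norm_minus_commute[of "\<gamma> n"] abs_of_pos)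
  then show ?thesis
    using a0_pos by (simp add: pos_le_divide_eq mult.commute)
qed

lemma refl_seq_step:
  assumes "tail (int N) D"
  shows "norm (refl_seq a b a0 b0 \<zeta> (Suc N) - refl_seq a b a0 b0 \<zeta> N) \<le> 17 / a0 * (norm \<zeta> ^ (2 * Suc N) * D)"
proof -
  have "\<zeta> ^ (2 * Suc N) * (\<gamma> (int (Suc N)) - k ^ 2 * \<gamma> (int (Suc N) - 1)) = refl_seq a b a0 b0 \<zeta> (Suc N) - refl_seq a b a0 b0 \<zeta> N"
    using \<zeta>_nz by (simp add: refl_seq_def power2_eq_square field_simps)
  then have "norm (refl_seq a b a0 b0 \<zeta> (Suc N) - refl_seq a b a0 b0 \<zeta> N)
      = norm \<zeta> ^ (2 * Suc N) * norm (\<gamma> (int (Suc N)) - k ^ 2 * \<gamma> (int (Suc N) - 1))"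
    by (metis norm_mult norm_power)
  also have "\<dots> \<le> norm \<zeta> ^ (2 * Suc N) * (17 / a0 * D)"
    using green_dev_step[of "int (Suc N)" D] assms by (intro mult_left_mono) auto
  finally show ?thesis by (simp add: mult_ac)
qed

lemma refl_seq_tendsto:
  assumes tail: "\<And>n. tail (int n) (D n)" and sm: "summable (\<lambda>n. norm \<zeta> ^ (2 * Suc n) * D n)"
  shows "refl_seq a b a0 b0 \<zeta> \<longlonglongrightarrow> refl_coef a b a0 b0 \<zeta>"
    and "norm (refl_coef a b a0 b0 \<zeta> - refl_seq a b a0 b0 \<zeta> N) \<le> 17 / a0 * (\<Sum>n. norm \<zeta> ^ (2 * Suc (n + N)) * D (n + N))"
proof -
  let ?X = "refl_seq a b a0 b0 \<zeta>"
  define e where "e n = 17 / a0 * (norm \<zeta> ^ (2 * Suc n) * D n)" for n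
  have se: "summable e" unfolding e_def by (intro summable_mult sm)
  have le: "norm (?X (Suc n) - ?X n) \<le> e n" for n
    unfolding e_def by (rule refl_seq_step) (rule tail)
  have sX: "summable (\<lambda>n. ?X (Suc n) - ?X n)"
    by (rule summable_comparison_test'[OF se]) (rule le)
  then have "(\<lambda>N. ?X 0 + (\<Sum>n<N. ?X (Suc n) - ?X n)) \<longlonglongrightarrow> ?X 0 + (\<Sum>n. ?X (Suc n) - ?X n)"
    by (intro tendsto_add tendsto_const summable_LIMSEQ)
  then have "?X \<longlonglongrightarrow> ?X 0 + (\<Sum>n. ?X (Suc n) - ?X n)"
    by (simp add: sum_lessThan_telescope)
  then show lim: "?X \<longlonglongrightarrow> refl_coef a b a0 b0 \<zeta>"
    unfolding refl_coef_def using limI by metis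
  have "(\<lambda>n. ?X (Suc (n + N)) - ?X (n + N)) sums (refl_coef a b a0 b0 \<zeta> - ?X (0 + N))"
    using telescope_sums[of "\<lambda>n. ?X (n + N)" "refl_coef a b a0 b0 \<zeta>"] LIMSEQ_ignore_initial_segment[OF lim, of N] by simp
  then have "refl_coef a b a0 b0 \<zeta> - ?X N = (\<Sum>n. ?X (Suc (n + N)) - ?X (n + N))"
    by (simp add: sums_unique)
  also have "norm \<dots> \<le> (\<Sum>n. e (n + N))"
    by (rule norm_suminf_le) (use le se summable_ignore_initial_segment in auto)
  also have "\<dots> = 17 / a0 * (\<Sum>n. norm \<zeta> ^ (2 * Suc (n + N)) * D (n + N))"
    unfolding e_def by (rule suminf_mult) (rule summable_ignore_initial_segment[OF sm])
  finally show "norm (refl_coef a b a0 b0 \<zeta> - ?X N) \<le> 17 / a0 * (\<Sum>n. norm \<zeta> ^ (2 * Suc (n + N)) * D (n + N))" .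
qed

end

text \<open>Decay faster than every exponential: strong enough to beat the weight
  \<open>\<zeta> ^ (2 * N)\<close> for each \<zeta>, and stable under the flow by
  \<open>toda_rapid_decay\<close>.\<close>

definition rapid_decay :: "(int \<Rightarrow> real) \<Rightarrow> (int \<Rightarrow> real) \<Rightarrow> real \<Rightarrow> real \<Rightarrow> bool"
  where "rapid_decay a b a0 b0 \<longleftrightarrow> (\<forall>q. 0 < q \<longrightarrow> q < 1 \<longrightarrow> (\<exists>K. \<forall>n. tail_bound a b a0 b0 (int n) (K * q ^ n)))"

section \<open>Resolvent entries at a fixed distance from the diagonal\<close>

context jacobi_energy
begin

lemma green_far:
  assumes D: "tail n D"
  shows "norm (G (n + int i) n - k ^ i * G n n) \<le> real i * (8 / a0 * D)"
proof (induction i)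
  case 0
  then show ?case by simp
next
  case (Suc i)
  have Di: "tail (n + int i) D" using D by (auto simp: tail_bound_def)
  have D0: "D \<ge> 0" using D by (rule tail_bound_nonneg)
  have "G (n + int (Suc i)) n - k ^ Suc i * G n n
    = (G (n + int i + 1) n - k * G (n + int i) n) + k * (G (n + int i) n - k ^ i * G n n)"
    by (simp add: right_diff_distrib ac_simps del: times_divide_eq_left)
  moreover have "norm (G (n + int i + 1) n - k * G (n + int i) n) \<le> 8 / a0 * D"
    by (rule green_step'[OF Di]) simp
  moreover have "norm (k * (G (n + int i) n - k ^ i * G n n)) \<le> 1 * (real i * (8 / a0 * D))"
    unfolding norm_mult using Suc norm_k by (intro mult_mono) auto
  ultimately show ?case
    using norm_triangle_ineq[of "G (n + int i + 1) n - k * G (n + int i) n" "k * (G (n + int i) n - k ^ i * G n n)"]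
    by (simp only: of_nat_Suc distrib_right)
qed

lemma green_dev_far:
  assumes D: "tail (n - int i) D"
  shows "norm (\<gamma> n - k ^ (2 * i) * \<gamma> (n - int i)) \<le> real i * (17 / a0 * D)"
  using D
proof (induction i)
  case 0
  then show ?case by simp
next
  case (Suc i)
  have Di: "tail (n - int i) D" using Suc.prems by (auto simp: tail_bound_def)
  have D0: "D \<ge> 0" using Suc.prems by (rule tail_bound_nonneg)
  have st: "norm (\<gamma> (n - int i) - k ^ 2 * \<gamma> (n - int i - 1)) \<le> 17 / a0 * D"
    using Suc.prems by (intro green_dev_step) (simp add: algebra_simps)
  have "\<gamma> n - k ^ (2 * Suc i) * \<gamma> (n - int (Suc i))
    = (\<gamma> n - k ^ (2 * i) * \<gamma> (n - int i)) + k ^ (2 * i) * (\<gamma> (n - int i) - k ^ 2 * \<gamma> (n - int i - 1))"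
    by (simp add: right_diff_distrib power_add power2_eq_square ac_simps diff_diff_eq del: times_divide_eq_left)
  moreover have "norm (k ^ (2 * i) * (\<gamma> (n - int i) - k ^ 2 * \<gamma> (n - int i - 1))) \<le> 1 * (17 / a0 * D)"
    unfolding norm_mult norm_power using st norm_k by (intro mult_mono power_le_one) auto
  ultimately show ?case
    using Suc.IH[OF Di] norm_triangle_ineq[of "\<gamma> n - k ^ (2 * i) * \<gamma> (n - int i)" "k ^ (2 * i) * (\<gamma> (n - int i) - k ^ 2 * \<gamma> (n - int i - 1))"]
    by (simp only: of_nat_Suc distrib_right)
qed

text \<open>To the right, \<open>G (n + i) n\<close> is close to \<open>k ^ i * G n n\<close>. To
  the left, symmetry gives \<open>k ^ i * G (n - i) (n - i)\<close>, and
  \<open>green_dev_far\<close> turns \<open>k ^ i * \<gamma> (n - i)\<close> into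
  \<open>\<zeta> ^ i * \<gamma> n\<close>. The free diagonal cancels in the difference. This is
  where the summands of \<open>dispersion\<close> come from; 33 = 8 + 8 + 17.\<close>

lemma green_offdiag_pair:
  assumes D: "tail (n - int i) D"
  shows "norm (G (n + int i) n - G (n - int i) n - (k ^ i - \<zeta> ^ i) * \<gamma> n)
    \<le> real i * (33 / a0 * D) * norm \<zeta> ^ i"
proof -
  define g0 where "g0 = 1 / (of_real a0 * (k - \<zeta>))"
  have Dn: "tail n D" using D by (auto simp: tail_bound_def)
  have D0: "D \<ge> 0" using D by (rule tail_bound_nonneg)
  define e1 where "e1 = G (n + int i) n - k ^ i * G n n"
  define e2 where "e2 = G n (n - int i) - k ^ i * G (n - int i) (n - int i)"
  define e3 where "e3 = \<gamma> n - k ^ (2 * i) * \<gamma> (n - int i)"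
  have e1: "norm e1 \<le> real i * (8 / a0 * D)" unfolding e1_def by (rule green_far) fact
  have e2: "norm e2 \<le> real i * (8 / a0 * D)" unfolding e2_def using green_far[OF D, of i] by simp
  have e3: "norm e3 \<le> real i * (17 / a0 * D)" unfolding e3_def by (rule green_dev_far) fact
  have kz: "\<zeta> ^ i * k ^ (2 * i) = k ^ i"
  proof -
    have "\<zeta> ^ i * k ^ (2 * i) = (\<zeta> * k) ^ i * k ^ i"
      by (simp only: mult_2 power_add power_mult_distrib mult.assoc)
    then show ?thesis using \<zeta>_nz by simp
  qed
  have "\<zeta> ^ i * e3 = \<zeta> ^ i * \<gamma> n - k ^ i * \<gamma> (n - int i)"
    unfolding e3_def right_diff_distrib mult.assoc[symmetric] kz ..
  note z = this
  have g: "G n n = g0 + \<gamma> n" "G (n - int i) (n - int i) = g0 + \<gamma> (n - int i)"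
    by (simp_all add: green_dev_def g0_def)
  have "G (n + int i) n - G (n - int i) n - (k ^ i - \<zeta> ^ i) * \<gamma> n = e1 - e2 + \<zeta> ^ i * e3"
    unfolding z unfolding e1_def e2_def green_sym[of "n - int i" n] g by (simp only: algebra_simps)
  also have "norm \<dots> \<le> norm e1 + norm e2 + norm (\<zeta> ^ i * e3)"
    by (meson norm_triangle_ineq norm_triangle_ineq4 add_mono order_refl order_trans)
  also have "\<dots> \<le> real i * (8 / a0 * D) * norm \<zeta> ^ i + real i * (8 / a0 * D) * norm \<zeta> ^ i + real i * (17 / a0 * D) * norm \<zeta> ^ i"
  proof (intro add_mono)
    have "1 \<le> norm \<zeta> ^ i" using norm_\<zeta> by (intro one_le_power) linarith
    then have "real i * (8 / a0 * D) * 1 \<le> real i * (8 / a0 * D) * norm \<zeta> ^ i"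
      using D0 a0_pos by (intro mult_left_mono) auto
    then show "norm e1 \<le> real i * (8 / a0 * D) * norm \<zeta> ^ i" "norm e2 \<le> real i * (8 / a0 * D) * norm \<zeta> ^ i"
      using e1 e2 by linarith+
    show "norm (\<zeta> ^ i * e3) \<le> real i * (17 / a0 * D) * norm \<zeta> ^ i"
      unfolding norm_mult norm_power using e3 by (subst mult.commute) (intro mult_right_mono, auto)
  qed
  also have "\<dots> = real i * (33 / a0 * D) * norm \<zeta> ^ i"
    by (simp add: field_simps)
  finally show ?thesis .
qed

lemma green_dev_norm: "norm (\<gamma> n) \<le> 1 + 1 / a0"
proof -
  have "norm \<zeta> - norm k \<le> norm (k - \<zeta>)" by (metis norm_minus_commute norm_triangle_ineq2)
  then have ge: "1 \<le> norm (k - \<zeta>)" using norm_\<zeta> norm_k by linarith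
  have "norm (1 / (of_real a0 * (k - \<zeta>))) = 1 / (a0 * norm (k - \<zeta>))"
    using a0_pos by (simp only: norm_divide norm_mult norm_of_real norm_one abs_of_pos)
  also have "\<dots> \<le> 1 / (a0 * 1)"
    using ge a0_pos by (intro divide_left_mono mult_left_mono mult_pos_pos) auto
  finally show ?thesis
    unfolding green_dev_def using green_le_1[of n n] norm_triangle_ineq4[of "G n n" "1 / (of_real a0 * (k - \<zeta>))"] by simp
qed

end

lemma refl_uniform_limit:
  assumes bnd: "\<And>n. \<bar>a n\<bar> \<le> M" "\<And>n. \<bar>b n\<bar> \<le> M" "a0 > 0" "a0 \<le> M" "\<bar>b0\<bar> \<le> M"
    and decay: "rapid_decay a b a0 b0" and p: "0 < p" "p < 1"
  shows "\<exists>C. \<forall>\<zeta> N. (12 * M + 8) / a0 + 2 \<le> norm \<zeta> \<longrightarrow> norm \<zeta> \<le> \<rho> \<longrightarrow>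
    norm (refl_coef a b a0 b0 \<zeta> - refl_seq a b a0 b0 \<zeta> N) \<le> C * p ^ N"
proof -
  define \<rho>' where "\<rho>' = max \<rho> 1"
  have \<rho>': "\<rho>' \<ge> 1" "\<rho> \<le> \<rho>'" by (auto simp: \<rho>'_def)
  \<comment> \<open>The weight is at most \<open>\<rho>' ^ (2 * N)\<close> times a constant, so a
    tail of order \<open>q ^ N\<close> leaves \<open>p ^ N\<close>, uniformly for
    \<open>norm \<zeta> \<le> \<rho>\<close>. The maximum with 1 in \<open>\<rho>'\<close>
    guarantees \<open>q < 1\<close>.\<close>
  define q where "q = p / \<rho>' ^ 2"
  have "q > 0" using p \<rho>' by (simp add: q_def)
  moreover have "q < 1"
  proof -
    have "1 \<le> \<rho>' ^ 2" using \<rho>' by simp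
    then have "p < \<rho>' ^ 2" using p by linarith
    then show ?thesis using \<rho>' by (simp add: q_def divide_less_eq)
  qed
  ultimately obtain K where K: "\<And>n. tail_bound a b a0 b0 (int n) (K * q ^ n)"
    using decay unfolding rapid_decay_def by blast
  have K0: "K \<ge> 0" using tail_bound_nonneg[OF K[of 0]] by simp
  define C where "C = 17 / a0 * (K * \<rho>' ^ 2 * (1 / (1 - p)))"
  have "norm (refl_coef a b a0 b0 \<zeta> - refl_seq a b a0 b0 \<zeta> N) \<le> C * p ^ N"
    if \<zeta>: "(12 * M + 8) / a0 + 2 \<le> norm \<zeta>" "norm \<zeta> \<le> \<rho>" for \<zeta> N
  proof -
    interpret jacobi_energy a b M a0 b0 \<zeta> by unfold_locales (use bnd \<zeta> in auto)
    have le: "norm \<zeta> ^ (2 * Suc n) * (K * q ^ n) \<le> K * \<rho>' ^ 2 * p ^ n" for n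
    proof -
      have "norm \<zeta> ^ (2 * Suc n) \<le> \<rho>' ^ (2 * Suc n)" using \<zeta> \<rho>' by (intro power_mono) auto
      then have "norm \<zeta> ^ (2 * Suc n) * (K * q ^ n) \<le> \<rho>' ^ (2 * Suc n) * (K * q ^ n)"
        using K0 \<open>q > 0\<close> by (intro mult_right_mono) auto
      also have "\<dots> = K * \<rho>' ^ 2 * (\<rho>' ^ 2 * q) ^ n"
        by (simp add: power_mult power_mult_distrib power2_eq_square)
      also have "\<rho>' ^ 2 * q = p" using \<rho>' by (simp add: q_def)
      finally show ?thesis .
    qed
    have sg: "summable (\<lambda>n. K * \<rho>' ^ 2 * p ^ n)"
      using p by (intro summable_mult summable_geometric) auto
    have sm: "summable (\<lambda>n. norm \<zeta> ^ (2 * Suc n) * (K * q ^ n))"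
      by (rule summable_comparison_test'[OF sg])
        (use le K0 \<open>q > 0\<close> in \<open>simp add: abs_mult power_abs\<close>)
    have "(\<Sum>n. norm \<zeta> ^ (2 * Suc (n + N)) * (K * q ^ (n + N))) \<le> (\<Sum>n. K * \<rho>' ^ 2 * p ^ (n + N))"
      by (intro suminf_le le) (use summable_ignore_initial_segment[OF sm, of N] summable_ignore_initial_segment[OF sg, of N] in auto)
    also have "\<dots> = (\<Sum>n. K * \<rho>' ^ 2 * p ^ N * p ^ n)"
      by (simp add: power_add mult_ac)
    also have "\<dots> = K * \<rho>' ^ 2 * p ^ N * (1 / (1 - p))"
      using p by (subst suminf_mult) (auto intro!: summable_geometric simp: suminf_geometric)
    finally have "17 / a0 * (\<Sum>n. norm \<zeta> ^ (2 * Suc (n + N)) * (K * q ^ (n + N))) \<le> 17 / a0 * (K * \<rho>' ^ 2 * p ^ N * (1 / (1 - p)))"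
      using a0_pos by (intro mult_left_mono) auto
    then show ?thesis
      using refl_seq_tendsto(2)[of "\<lambda>n. K * q ^ n" N, OF K sm] by (simp add: C_def mult_ac)
  qed
  then show ?thesis by blast
qed

lemma refl_coef_holomorphic:
  assumes bnd: "\<And>n. \<bar>a n\<bar> \<le> M" "\<And>n. \<bar>b n\<bar> \<le> M" "a0 > 0" "a0 \<le> M" "\<bar>b0\<bar> \<le> M"
    and decay: "rapid_decay a b a0 b0"
  shows "refl_coef a b a0 b0 holomorphic_on {\<zeta>. (12 * M + 8) / a0 + 2 < norm \<zeta>}"
proof -
  define R where "R = (12 * M + 8) / a0 + 2"
  define S where "S = {\<zeta> :: complex. R < norm \<zeta>}"
  have M: "M > 0" using bnd by linarith
  have R: "R > 0" unfolding R_def using M bnd(3) by (intro add_nonneg_pos divide_nonneg_pos) auto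
  have opS: "open S" unfolding S_def by (intro open_Collect_less continuous_intros)
  have loc: "jacobi_energy a b M a0 b0 \<zeta>" if "\<zeta> \<in> S" for \<zeta>
    using that bnd by unfold_locales (auto simp: S_def R_def)
  have hol: "(\<lambda>\<zeta>. refl_seq a b a0 b0 \<zeta> N) holomorphic_on S" for N
  proof -
    define n where "n = int N"
    \<comment> \<open>The Neumann series as a power series in \<open>w = 1 / z\<close>. The set
      \<open>S\<close> is mapped into its disc of convergence, so each \<open>refl_seq\<close> is
      holomorphic by composition.\<close>
    define f where "f w = (\<Sum>l. of_real (jpow a b l n n) * w ^ l)" for w :: complex
    have "f holomorphic_on ball 0 (1 / (3 * M))"
    proof (rule power_series_holomorphic)
      fix w :: complex assume "w \<in> ball 0 (1 / (3 * M))"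
      then have w: "3 * M * norm w < 1" using M by (simp add: field_simps)
      have "summable (\<lambda>l. of_real (jpow a b l n n) * w ^ l)"
      proof (rule summable_comparison_test')
        show "summable (\<lambda>l. (3 * M * norm w) ^ l)" using w M by (intro summable_geometric) auto
        fix l
        have "norm (of_real (jpow a b l n n) * w ^ l) \<le> (3 * M) ^ l * norm w ^ l"
          unfolding norm_mult norm_power norm_of_real by (intro mult_right_mono jpow_bound bnd) auto
        then show "norm (of_real (jpow a b l n n) * w ^ l) \<le> (3 * M * norm w) ^ l"
          by (simp only: power_mult_distrib)
      qed
      then show "(\<lambda>l. of_real (jpow a b l n n) * (w - 0) ^ l) sums f w"
        unfolding f_def by (simp add: summable_sums)
    qed
    moreover have "(\<lambda>\<zeta>. 1 / energy a0 b0 \<zeta>) ` S \<subseteq> ball 0 (1 / (3 * M))"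
    proof (intro image_subsetI)
      fix \<zeta> assume "\<zeta> \<in> S"
      then interpret jacobi_energy a b M a0 b0 \<zeta> by (rule loc)
      have "norm z > 3 * M" using z_lower(2) M by linarith
      then have "norm (1 / z) < 1 / (3 * M)"
        using M by (simp only: norm_divide norm_one) (intro divide_strict_left_mono mult_pos_pos, auto)
      then show "1 / z \<in> ball 0 (1 / (3 * M))" by simp
    qed
    moreover have e: "(\<lambda>\<zeta>. 1 / energy a0 b0 \<zeta>) holomorphic_on S"
    proof -
      have "energy a0 b0 \<zeta> \<noteq> 0" if "\<zeta> \<in> S" for \<zeta>
        using jacobi_energy.z_nz[OF loc[OF that]] .
      moreover have "energy a0 b0 holomorphic_on S"
        unfolding energy_def by (intro holomorphic_intros) (use R in \<open>auto simp: S_def\<close>)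
      ultimately show ?thesis by (intro holomorphic_intros) auto
    qed
    ultimately have fh: "(\<lambda>\<zeta>. f (1 / energy a0 b0 \<zeta>)) holomorphic_on S"
      using holomorphic_on_compose_gen[of "\<lambda>\<zeta>. 1 / energy a0 b0 \<zeta>" S f "ball 0 (1 / (3 * M))"] by (simp add: o_def)
    have geq: "green a b (energy a0 b0 \<zeta>) n n = - (1 / energy a0 b0 \<zeta> * f (1 / energy a0 b0 \<zeta>))" if "\<zeta> \<in> S" for \<zeta>
    proof -
      interpret jacobi_energy a b M a0 b0 \<zeta> using that by (rule loc)
      have "summable (\<lambda>l. z * (of_real (jpow a b l n n) / z ^ Suc l))"
        by (intro summable_mult green_summable)
      then have "summable (\<lambda>l. of_real (jpow a b l n n) * (1 / z) ^ l)"
        using z_nz by (simp add: power_one_over field_simps)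
      then show ?thesis
        unfolding green_def f_def by (subst suminf_mult[symmetric]) (simp_all add: power_one_over field_simps)
    qed
    have "(\<lambda>\<zeta>. \<zeta> ^ (2 * N) * (- (1 / energy a0 b0 \<zeta> * f (1 / energy a0 b0 \<zeta>)) - 1 / (of_real a0 * (1 / \<zeta> - \<zeta>)))) holomorphic_on S"
    proof (intro holomorphic_on_mult holomorphic_on_minus holomorphic_on_diff holomorphic_on_power holomorphic_on_ident fh e)
      have "\<zeta> \<noteq> 0" "of_real a0 * (1 / \<zeta> - \<zeta>) \<noteq> 0" if "\<zeta> \<in> S" for \<zeta>
      proof -
        interpret jacobi_energy a b M a0 b0 \<zeta> using that by (rule loc)
        show "\<zeta> \<noteq> 0" "of_real a0 * (1 / \<zeta> - \<zeta>) \<noteq> 0"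
          using \<zeta>_nz k_\<zeta>_nz a0_pos by auto
      qed
      then show "(\<lambda>\<zeta>. 1 / (of_real a0 * (1 / \<zeta> - \<zeta>))) holomorphic_on S"
        by (intro holomorphic_intros) auto
    qed
    then show ?thesis
      by (rule holomorphic_transform) (simp add: refl_seq_def green_dev_def geq n_def[symmetric])
  qed
  have "refl_coef a b a0 b0 holomorphic_on S"
  proof (rule holomorphic_uniform_sequence[OF opS hol])
    fix x assume "x \<in> S"
    then obtain d where d: "d > 0" "cball x d \<subseteq> S" using opS open_contains_cball by blast
    have "\<exists>C. \<forall>\<zeta> N. R \<le> norm \<zeta> \<longrightarrow> norm \<zeta> \<le> norm x + d \<longrightarrow>
        norm (refl_coef a b a0 b0 \<zeta> - refl_seq a b a0 b0 \<zeta> N) \<le> C * (1 / 2) ^ N"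
      unfolding R_def by (rule refl_uniform_limit) (use bnd decay in auto)
    then obtain C where C: "\<And>\<zeta> N. R \<le> norm \<zeta> \<Longrightarrow> norm \<zeta> \<le> norm x + d \<Longrightarrow>
        norm (refl_coef a b a0 b0 \<zeta> - refl_seq a b a0 b0 \<zeta> N) \<le> C * (1 / 2) ^ N"
      by blast
    have "uniform_limit (cball x d) (\<lambda>N \<zeta>. refl_seq a b a0 b0 \<zeta> N) (refl_coef a b a0 b0) sequentially"
      unfolding uniform_limit_iff
    proof (intro allI impI)
      fix e :: real assume e: "e > 0"
      have "(\<lambda>N. C * (1 / 2) ^ N) \<longlonglongrightarrow> C * 0" by (intro tendsto_intros LIMSEQ_power_zero) auto
      then have "\<forall>\<^sub>F N in sequentially. C * (1 / 2) ^ N < e" using e by (intro order_tendstoD) auto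
      then show "\<forall>\<^sub>F N in sequentially. \<forall>\<zeta>\<in>cball x d. dist (refl_seq a b a0 b0 \<zeta> N) (refl_coef a b a0 b0 \<zeta>) < e"
      proof eventually_elim
        case (elim N)
        show ?case
        proof
          fix \<zeta> assume z: "\<zeta> \<in> cball x d"
          then have "norm \<zeta> \<le> norm x + d" using norm_triangle_sub[of \<zeta> x] by (simp add: dist_norm norm_minus_commute)
          moreover have "R \<le> norm \<zeta>" using z d by (auto simp: S_def subset_iff)
          ultimately show "dist (refl_seq a b a0 b0 \<zeta> N) (refl_coef a b a0 b0 \<zeta>) < e"
            using C[of \<zeta> N] elim by (simp add: dist_norm norm_minus_commute)
        qed
      qed
    qed
    then show "\<exists>d>0. cball x d \<subseteq> S \<and> uniform_limit (cball x d) (\<lambda>N \<zeta>. refl_seq a b a0 b0 \<zeta> N) (refl_coef a b a0 b0) sequentially"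
      using d by blast
  qed
  then show ?thesis by (simp add: S_def R_def)
qed

lemma power_over_fact_le_exp:
  fixes x :: real
  assumes "x \<ge> 0"
  shows "x ^ n / fact n \<le> exp x"
proof -
  have "(\<lambda>n. x ^ n / fact n) sums exp x"
    using exp_converges[of x] by (simp add: field_simps)
  then show ?thesis
    using sum_le_suminf[of "\<lambda>n. x ^ n / fact n" "{n}"] assms by (auto simp: sums_iff)
qed

text \<open>Comparison with the bounded term \<open>N = 0\<close> leaves the tail weighted by powers
  \<open>norm \<zeta> ^ (2 * n)\<close>. Against these,
  \<open>\<epsilon> ^ (2 * n) / fact (2 * n)\<close> is a term of the exponential series of
  \<open>\<epsilon> * norm \<zeta>\<close>.\<close>

lemma refl_coef_growth:
  assumes bnd: "\<And>n. \<bar>a n\<bar> \<le> M" "\<And>n. \<bar>b n\<bar> \<le> M" "a0 > 0" "a0 \<le> M" "\<bar>b0\<bar> \<le> M"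
    and decay: "\<And>\<epsilon>. \<epsilon> > 0 \<Longrightarrow> \<exists>K. \<forall>n. tail_bound a b a0 b0 (int n) (K * (\<epsilon> ^ (2 * n) / fact (2 * n)))"
    and \<epsilon>: "\<epsilon> > 0"
  shows "\<exists>C. \<forall>\<zeta>. (12 * M + 8) / a0 + 2 \<le> norm \<zeta> \<longrightarrow> norm (refl_coef a b a0 b0 \<zeta>) \<le> C * exp (\<epsilon> * norm \<zeta>)"
proof -
  \<comment> \<open>Two halvings of the rate: the one in \<open>\<eta> / 2\<close> below yields the
    summable factor \<open>(1 / 4) ^ n\<close>, the one here absorbs the extra
    \<open>norm \<zeta> ^ 2\<close> of the weight into the exponential.\<close>
  define \<eta> where "\<eta> = \<epsilon> / 2"
  have \<eta>: "\<eta> > 0" using \<epsilon> by (simp add: \<eta>_def)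
  obtain K where K: "\<And>n. tail_bound a b a0 b0 (int n) (K * ((\<eta> / 2) ^ (2 * n) / fact (2 * n)))"
    using decay[of "\<eta> / 2"] \<eta> by auto
  have K0: "K \<ge> 0" using tail_bound_nonneg[OF K[of 0]] by simp
  define C1 where "C1 = 17 / a0 * (4 / 3 * K)"
  define C where "C = (1 + 1 / a0) + C1 * (2 / \<eta> ^ 2)"
  have C1: "C1 \<ge> 0" using K0 bnd by (simp add: C1_def)
  have "norm (refl_coef a b a0 b0 \<zeta>) \<le> C * exp (\<epsilon> * norm \<zeta>)" if \<zeta>: "(12 * M + 8) / a0 + 2 \<le> norm \<zeta>" for \<zeta>
  proof -
    interpret jacobi_energy a b M a0 b0 \<zeta> by unfold_locales (use bnd \<zeta> in auto)
    define x where "x = norm \<zeta>"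
    have x: "x \<ge> 0" by (simp add: x_def)
    define D where "D n = K * ((\<eta> / 2) ^ (2 * n) / fact (2 * n))" for n :: nat
    have le: "x ^ (2 * Suc n) * D n \<le> K * x ^ 2 * exp (\<eta> * x) * (1 / 4) ^ n" for n
    proof -
      have "(\<eta> / 2) ^ (2 * n) = \<eta> ^ (2 * n) * (1 / 4) ^ n"
        by (simp add: power_divide power_mult)
      then have "x ^ (2 * Suc n) * D n = K * x ^ 2 * ((\<eta> * x) ^ (2 * n) / fact (2 * n)) * (1 / 4) ^ n"
        unfolding D_def by (simp add: power_mult_distrib power2_eq_square)
      also have "\<dots> \<le> K * x ^ 2 * exp (\<eta> * x) * (1 / 4) ^ n"
        using K0 \<eta> x by (intro mult_right_mono mult_left_mono power_over_fact_le_exp) auto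
      finally show ?thesis .
    qed
    have sg: "summable (\<lambda>n. K * x ^ 2 * exp (\<eta> * x) * (1 / 4) ^ n)"
      by (intro summable_mult summable_geometric) auto
    have D0: "D n \<ge> 0" for n using K0 \<eta> by (simp add: D_def)
    have sm: "summable (\<lambda>n. norm \<zeta> ^ (2 * Suc n) * D n)"
      by (rule summable_comparison_test'[OF sg])
        (use le D0 x in \<open>simp add: x_def[symmetric] abs_mult\<close>)
    have "(\<Sum>n. norm \<zeta> ^ (2 * Suc n) * D n) \<le> (\<Sum>n. K * x ^ 2 * exp (\<eta> * x) * (1 / 4) ^ n)"
      by (intro suminf_le sg sm) (use le in \<open>simp add: x_def\<close>)
    also have "\<dots> = K * x ^ 2 * exp (\<eta> * x) * (4 / 3)"
      by (subst suminf_mult) (auto intro!: summable_geometric simp: suminf_geometric)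
    finally have "17 / a0 * (\<Sum>n. norm \<zeta> ^ (2 * Suc n) * D n) \<le> 17 / a0 * (K * x ^ 2 * exp (\<eta> * x) * (4 / 3))"
      using a0_pos by (intro mult_left_mono) auto
    moreover have "norm (refl_coef a b a0 b0 \<zeta> - refl_seq a b a0 b0 \<zeta> 0) \<le> 17 / a0 * (\<Sum>n. norm \<zeta> ^ (2 * Suc (n + 0)) * D (n + 0))"
      by (rule refl_seq_tendsto(2)[OF _ sm]) (use K in \<open>simp add: D_def\<close>)
    ultimately have 1: "norm (refl_coef a b a0 b0 \<zeta> - \<gamma> 0) \<le> C1 * (x ^ 2 * exp (\<eta> * x))"
      by (simp add: C1_def refl_seq_def mult_ac)
    have "x ^ 2 \<le> 2 / \<eta> ^ 2 * exp (\<eta> * x)"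
      using power_over_fact_le_exp[of "\<eta> * x" 2] \<eta> x by (simp add: power_mult_distrib field_simps)
    then have "x ^ 2 * exp (\<eta> * x) \<le> 2 / \<eta> ^ 2 * exp (\<eta> * x) * exp (\<eta> * x)"
      by (intro mult_right_mono) auto
    also have "\<dots> = 2 / \<eta> ^ 2 * exp (\<epsilon> * x)"
      by (simp add: exp_add[symmetric] \<eta>_def)
    finally have 2: "C1 * (x ^ 2 * exp (\<eta> * x)) \<le> C1 * (2 / \<eta> ^ 2 * exp (\<epsilon> * x))"
      using C1 by (rule mult_left_mono)
    have "(1 + 1 / a0) * 1 \<le> (1 + 1 / a0) * exp (\<epsilon> * x)"
      using \<epsilon> x a0_pos by (intro mult_left_mono) auto
    then have 3: "norm (\<gamma> 0) \<le> (1 + 1 / a0) * exp (\<epsilon> * x)"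
      by (intro order_trans[OF green_dev_norm]) (simp only: mult_1_right)
    have "norm (refl_coef a b a0 b0 \<zeta>) \<le> norm (refl_coef a b a0 b0 \<zeta> - \<gamma> 0) + norm (\<gamma> 0)"
      by (metis norm_triangle_sub add.commute)
    also have "\<dots> \<le> C1 * (2 / \<eta> ^ 2 * exp (\<epsilon> * x)) + (1 + 1 / a0) * exp (\<epsilon> * x)"
      using 1 2 3 by linarith
    also have "\<dots> = C * exp (\<epsilon> * norm \<zeta>)"
      by (simp add: C_def x_def algebra_simps)
    finally show ?thesis .
  qed
  then show ?thesis by blast
qed

section \<open>Time evolution of the reflection coefficient\<close>

definition free_symbol :: "(nat \<Rightarrow> real) \<Rightarrow> nat \<Rightarrow> real \<Rightarrow> real \<Rightarrow> nat \<Rightarrow> real"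
  where "free_symbol c s a0 b0 i = lax_kernel c s (\<lambda>_. a0) (\<lambda>_. b0) 0 (int i)"

text \<open>Twice the eigenvalue of the background Lax operator on the sequence \<open>k ^ n\<close>
  with \<open>k = 1 / \<zeta>\<close>; the factor 2 appears because both arguments of the diagonal
  of the resolvent evolve.\<close>

definition dispersion :: "(nat \<Rightarrow> real) \<Rightarrow> nat \<Rightarrow> real \<Rightarrow> real \<Rightarrow> complex \<Rightarrow> complex"
  where "dispersion c s a0 b0 \<zeta> = 2 * (\<Sum>i=1..s. of_real (free_symbol c s a0 b0 i) * ((1 / \<zeta>) ^ i - \<zeta> ^ i))"

lemma lax_kernel_free:
  "lax_kernel c s (\<lambda>_. a0) (\<lambda>_. b0) n (n + int i) = free_symbol c s a0 b0 i"
  "lax_kernel c s (\<lambda>_. a0) (\<lambda>_. b0) n (n - int i) = - free_symbol c s a0 b0 i"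
proof -
  have *: "lax_kernel c s (\<lambda>_. a0) (\<lambda>_. b0) n (n + int i) = free_symbol c s a0 b0 i" for n
    unfolding lax_kernel_def free_symbol_def
    using free_pow_shift[of a0 b0 _ 0 n "int i"] by (intro sum.cong) (auto simp: add_ac)
  show "lax_kernel c s (\<lambda>_. a0) (\<lambda>_. b0) n (n + int i) = free_symbol c s a0 b0 i" by (rule *)
  show "lax_kernel c s (\<lambda>_. a0) (\<lambda>_. b0) n (n - int i) = - free_symbol c s a0 b0 i"
    using *[of "n - int i"] lax_kernel_skew[of c s "\<lambda>_. a0" "\<lambda>_. b0" n "n - int i"] by simp
qed

lemma free_pow_top: "free_pow a0 b0 l m (m + int l) = a0 ^ l"
proof (induction l arbitrary: m)
  case 0
  then show ?case by (simp add: jpow_0)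
next
  case (Suc l)
  have "m + int (Suc l) = (m + 1) + int l" by simp
  then have "free_pow a0 b0 l (m + 1) (m + int (Suc l)) = a0 ^ l"
    by (simp only: Suc)
  then show ?case by (simp add: jpow_Suc jpow_band)
qed

lemma free_symbol_top: "c 0 = 1 \<Longrightarrow> s > 0 \<Longrightarrow> free_symbol c s a0 b0 s = a0 ^ s"
proof -
  assume c: "c 0 = 1" and s: "s > 0"
  have "free_symbol c s a0 b0 s = (\<Sum>l\<in>{s}. c (s - l) * (real_of_int (sgn (int s - 0)) * free_pow a0 b0 l 0 (int s)))"
    unfolding free_symbol_def lax_kernel_def by (rule sum.mono_neutral_right) (auto simp: jpow_band)
  then show ?thesis using c s free_pow_top[of a0 b0 s 0] by simp
qed

lemma sum_symmetric_int:
  fixes f :: "int \<Rightarrow> 'a::comm_monoid_add"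
  shows "(\<Sum>k\<in>{N - int s..N + int s}. f k) = f N + (\<Sum>i=1..s. f (N + int i) + f (N - int i))"
proof (induction s)
  case 0
  then show ?case by simp
next
  case (Suc s)
  have "{N - int (Suc s)..N + int (Suc s)} = insert (N + int (Suc s)) (insert (N - int (Suc s)) {N - int s..N + int s})"
    by auto
  then show ?case using Suc by (simp add: add_ac)
qed

lemma toda_rapid_uniform:
  fixes a b :: "int \<Rightarrow> real \<Rightarrow> real"
  assumes toda: "toda_hierarchy r c a b"
    and bnd: "\<And>n t. \<bar>a n t\<bar> \<le> M" "\<And>n t. \<bar>b n t\<bar> \<le> M" "\<bar>a0\<bar> \<le> M" "\<bar>b0\<bar> \<le> M"
    and decay: "rapid_decay (\<lambda>n. a n t0) (\<lambda>n. b n t0) a0 b0"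
    and \<kappa>: "\<kappa> > 0"
  obtains K where "K \<ge> 0" "\<And>j t. \<bar>t - t0\<bar> \<le> T \<Longrightarrow> \<bar>a j t - a0\<bar> * exp (\<kappa> * real_of_int j) \<le> K"
    "\<And>j t. \<bar>t - t0\<bar> \<le> T \<Longrightarrow> \<bar>b j t - b0\<bar> * exp (\<kappa> * real_of_int j) \<le> K"
proof -
  obtain K0 where K0: "\<And>n. tail_bound (\<lambda>n. a n t0) (\<lambda>n. b n t0) a0 b0 (int n) (K0 * exp (- \<kappa>) ^ n)"
    using decay \<kappa> unfolding rapid_decay_def by (metis exp_gt_zero exp_less_one_iff neg_less_0_iff_less)
  have K00: "K0 \<ge> 0" using tail_bound_nonneg[OF K0[of 0]] by simp
  have M: "M \<ge> 0" using bnd(3) by linarith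
  \<comment> \<open>\<open>K0\<close> serves the sites \<open>j \<ge> 0\<close>, where the decay
    hypothesis applies, and \<open>2 * M\<close> the sites \<open>j < 0\<close>, where the weight is
    at most 1.\<close>
  define \<sigma> where "\<sigma> = K0 + 2 * M"
  have init: "\<bar>y\<bar> * exp (\<kappa> * real_of_int j) \<le> \<sigma>" if y: "\<bar>y\<bar> \<le> 2 * M" "\<And>n. int n = j \<Longrightarrow> \<bar>y\<bar> \<le> K0 * exp (- \<kappa>) ^ n" for y j
  proof (cases "j \<ge> 0")
    case True
    then obtain n where n: "j = int n" using nonneg_int_cases by blast
    have "\<bar>y\<bar> * exp (\<kappa> * real_of_int j) \<le> K0 * exp (- \<kappa>) ^ n * exp (\<kappa> * real n)"
      using y(2)[of n] n by (intro mult_mono) (use K00 in auto)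
    also have "\<dots> = K0"
      by (simp add: exp_minus power_inverse mult.commute[of \<kappa>] exp_of_nat_mult)
    finally show ?thesis using M by (simp add: \<sigma>_def)
  next
    case False
    then have "exp (\<kappa> * real_of_int j) \<le> 1" using \<kappa> by (simp add: mult_nonneg_nonpos)
    then have "\<bar>y\<bar> * exp (\<kappa> * real_of_int j) \<le> (2 * M) * 1" using y M by (intro mult_mono) auto
    then show ?thesis using K00 by (simp add: \<sigma>_def)
  qed
  obtain L where L: "L \<ge> 0" "\<And>j t. \<bar>a j t - a0\<bar> * exp (\<kappa> * real_of_int j) \<le> \<sigma> * exp (L * \<bar>t - t0\<bar>)"
    "\<And>j t. \<bar>b j t - b0\<bar> * exp (\<kappa> * real_of_int j) \<le> \<sigma> * exp (L * \<bar>t - t0\<bar>)"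
  proof (rule toda_decay_propagation[OF toda bnd, where \<kappa> = \<kappa> and s = t0 and \<sigma> = \<sigma>])
    fix j
    have "\<bar>a j t0 - a0\<bar> \<le> 2 * M" "\<bar>b j t0 - b0\<bar> \<le> 2 * M"
      using bnd(1)[of j t0] bnd(2)[of j t0] bnd(3,4) by linarith+
    then show "\<bar>a j t0 - a0\<bar> * exp (\<kappa> * real_of_int j) \<le> \<sigma>" "\<bar>b j t0 - b0\<bar> * exp (\<kappa> * real_of_int j) \<le> \<sigma>"
      using K0 by (auto intro!: init simp: tail_bound_def)
  qed (use \<kappa> in auto)
  have \<sigma>0: "\<sigma> \<ge> 0" using K00 M by (simp add: \<sigma>_def)
  show thesis
  proof (rule that[of "\<sigma> * exp (L * \<bar>T\<bar>)"])
    fix j t assume t: "\<bar>t - t0\<bar> \<le> T"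
    have "\<sigma> * exp (L * \<bar>t - t0\<bar>) \<le> \<sigma> * exp (L * \<bar>T\<bar>)"
      using t L(1) \<sigma>0 by (auto intro!: mult_left_mono)
    then show "\<bar>a j t - a0\<bar> * exp (\<kappa> * real_of_int j) \<le> \<sigma> * exp (L * \<bar>T\<bar>)"
      "\<bar>b j t - b0\<bar> * exp (\<kappa> * real_of_int j) \<le> \<sigma> * exp (L * \<bar>T\<bar>)"
      using L(2,3)[of j t] by linarith+
  qed (use \<sigma>0 in auto)
qed

lemma tail_bound_exp:
  assumes "\<And>j. \<bar>a j - a0\<bar> * exp (\<kappa> * real_of_int j) \<le> K" "\<And>j. \<bar>b j - b0\<bar> * exp (\<kappa> * real_of_int j) \<le> K"
    and \<kappa>: "\<kappa> > 0" and K: "K \<ge> 0"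
  shows "tail_bound a b a0 b0 n (K * exp (- (\<kappa> * real_of_int n)))"
proof -
  have *: "y \<le> K * exp (- (\<kappa> * real_of_int n))" if "n \<le> j" "y * exp (\<kappa> * real_of_int j) \<le> K" for y j
  proof -
    have "y \<le> K * exp (- (\<kappa> * real_of_int j))" using that(2) by (simp add: exp_minus field_simps)
    also have "\<dots> \<le> K * exp (- (\<kappa> * real_of_int n))" using that(1) \<kappa> K by (intro mult_left_mono) auto
    finally show ?thesis .
  qed
  show ?thesis unfolding tail_bound_def using assms by (auto intro: *)
qed

lemma toda_rapid_decay:
  fixes a b :: "int \<Rightarrow> real \<Rightarrow> real"
  assumes toda: "toda_hierarchy r c a b"
    and bnd: "\<And>n t. \<bar>a n t\<bar> \<le> M" "\<And>n t. \<bar>b n t\<bar> \<le> M" "\<bar>a0\<bar> \<le> M" "\<bar>b0\<bar> \<le> M"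
    and decay: "rapid_decay (\<lambda>n. a n t0) (\<lambda>n. b n t0) a0 b0"
  shows "rapid_decay (\<lambda>n. a n t) (\<lambda>n. b n t) a0 b0"
  unfolding rapid_decay_def
proof (intro allI impI)
  fix q :: real assume q: "0 < q" "q < 1"
  define \<kappa> where "\<kappa> = - ln q"
  have \<kappa>: "\<kappa> > 0" using q by (simp add: \<kappa>_def)
  obtain K where K: "K \<ge> 0" "\<And>j t'. \<bar>t' - t0\<bar> \<le> \<bar>t - t0\<bar> \<Longrightarrow> \<bar>a j t' - a0\<bar> * exp (\<kappa> * real_of_int j) \<le> K"
    "\<And>j t'. \<bar>t' - t0\<bar> \<le> \<bar>t - t0\<bar> \<Longrightarrow> \<bar>b j t' - b0\<bar> * exp (\<kappa> * real_of_int j) \<le> K"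
    using toda_rapid_uniform[OF toda bnd decay \<kappa>, of "\<bar>t - t0\<bar>"] by blast
  have "tail_bound (\<lambda>n. a n t) (\<lambda>n. b n t) a0 b0 (int n) (K * q ^ n)" for n
  proof -
    have "exp (- (\<kappa> * real_of_int (int n))) = q ^ n"
      using q by (simp add: \<kappa>_def mult.commute exp_of_nat_mult)
    then show ?thesis
      using tail_bound_exp[of "\<lambda>n. a n t" a0 \<kappa> K "\<lambda>n. b n t" b0 "int n"] K \<kappa> by simp
  qed
  then show "\<exists>K. \<forall>n. tail_bound (\<lambda>n. a n t) (\<lambda>n. b n t) a0 b0 (int n) (K * q ^ n)" by blast
qed

section \<open>Time derivative of the resolvent\<close>

definition green_dot where
  "green_dot c s a b z m n = (\<Sum>k\<in>{m - int s..m + int s}. of_real (lax_kernel c s a b m k) * green a b z k n)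
    + (\<Sum>k\<in>{n - int s..n + int s}. of_real (lax_kernel c s a b n k) * green a b z m k)"

text \<open>Termwise differentiation of the Neumann series: the bound for \<open>jpow_dot\<close>
  exceeds the one for \<open>jpow\<close> only by a constant independent of \<open>l\<close> and
  \<open>t\<close>, so the derivatives have a geometric majorant uniform in time.\<close>

lemma green_has_derivative:
  fixes a b :: "int \<Rightarrow> real \<Rightarrow> real"
  assumes toda: "toda_hierarchy r c a b"
    and bnd: "\<And>n t. \<bar>a n t\<bar> \<le> M" "\<And>n t. \<bar>b n t\<bar> \<le> M" "a0 > 0" "a0 \<le> M" "\<bar>b0\<bar> \<le> M"
    and \<zeta>: "(12 * M + 8) / a0 + 2 \<le> norm \<zeta>"
  shows "((\<lambda>t. green (\<lambda>n. a n t) (\<lambda>n. b n t) (energy a0 b0 \<zeta>) m n) has_vector_derivative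
    green_dot c (r + 1) (\<lambda>n. a n t) (\<lambda>n. b n t) (energy a0 b0 \<zeta>) m n) (at t)"
proof -
  let ?A = "\<lambda>t n. a n t" and ?B = "\<lambda>t n. b n t"
  define z where "z = energy a0 b0 \<zeta>"
  have loc: "jacobi_energy (?A t) (?B t) M a0 b0 \<zeta>" for t
    using bnd \<zeta> by unfold_locales auto
  have z: "norm z \<ge> 6 * M" "z \<noteq> 0"
    unfolding z_def using jacobi_energy.z_lower(2)[OF loc[of 0]] jacobi_energy.z_nz[OF loc[of 0]] by auto
  have M: "M > 0" using bnd by linarith
  have ratio: "3 * M / norm z \<le> 1 / 2" "0 \<le> 3 * M / norm z"
    using z M by (simp_all add: pos_divide_le_eq)
  define C where "C = 2 * ((2 * real (r + 1) + 1) * (\<Sum>l=0..r+1. \<bar>c (r + 1 - l)\<bar> * (3 * M) ^ l))"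
  define f where "f l t = of_real (jpow (?A t) (?B t) l m n) / z ^ Suc l" for l t
  define f' where "f' l t = of_real (jpow_dot c (r + 1) (?A t) (?B t) l m n) / z ^ Suc l" for l t
  have df: "(f l has_derivative (\<lambda>h. h *\<^sub>R f' l t)) (at t within UNIV)" for l t
  proof -
    have "((\<lambda>t. of_real (jpow (?A t) (?B t) l m n)) has_vector_derivative
        of_real (jpow_dot c (r + 1) (?A t) (?B t) l m n)) (at t)"
      by (rule has_vector_derivative_of_real) (rule jpow_has_derivative[OF toda])
    then have "(f l has_vector_derivative f' l t) (at t)"
      unfolding f_def f'_def divide_inverse by (rule has_vector_derivative_mult_left)
    then show ?thesis by (simp add: has_vector_derivative_def)
  qed
  have bd: "norm (f' l t) \<le> C / norm z * (1 / 2) ^ l" for l t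
  proof -
    have "\<bar>jpow_dot c (r + 1) (?A t) (?B t) l m n\<bar> \<le> C * (3 * M) ^ l"
      unfolding C_def by (rule jpow_dot_bound jpow_bound bnd)+
    then have "norm (f' l t) \<le> C * (3 * M) ^ l / norm z ^ Suc l"
      unfolding f'_def norm_divide norm_power norm_of_real by (intro divide_right_mono) auto
    also have "\<dots> = C / norm z * (3 * M / norm z) ^ l"
      by (simp add: power_divide)
    also have "\<dots> \<le> C / norm z * (1 / 2) ^ l"
    proof (intro mult_left_mono power_mono ratio)
      show "0 \<le> C / norm z" unfolding C_def using M
        by (intro divide_nonneg_nonneg mult_nonneg_nonneg sum_nonneg) auto
    qed
    finally show ?thesis .
  qed
  have sg: "summable (\<lambda>l. C / norm z * (1 / 2) ^ l)"
    by (intro summable_mult summable_geometric) auto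
  have unif: "uniform_limit UNIV (\<lambda>n t. \<Sum>l<n. f' l t) (\<lambda>t. \<Sum>l. f' l t) sequentially"
    by (rule Weierstrass_m_test[OF _ sg]) (rule bd)
  have "\<exists>g. \<forall>t\<in>UNIV. (\<lambda>l. f l t) sums g t \<and> (g has_derivative (\<lambda>h. h *\<^sub>R (\<Sum>l. f' l t))) (at t within UNIV)"
  proof (rule has_derivative_series[where f' = "\<lambda>l t h. h *\<^sub>R f' l t" and x = 0])
    fix e :: real assume "e > 0"
    then have "\<forall>\<^sub>F n in sequentially. \<forall>t\<in>UNIV. dist (\<Sum>l<n. f' l t) (\<Sum>l. f' l t) < e"
      using unif unfolding uniform_limit_iff by blast
    then show "\<forall>\<^sub>F n in sequentially. \<forall>t\<in>UNIV. \<forall>h. norm ((\<Sum>l<n. h *\<^sub>R f' l t) - h *\<^sub>R (\<Sum>l. f' l t)) \<le> e * norm h"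
    proof eventually_elim
      case (elim n)
      show ?case
      proof (intro ballI allI)
        fix t h :: real
        have "norm ((\<Sum>l<n. h *\<^sub>R f' l t) - h *\<^sub>R (\<Sum>l. f' l t)) = \<bar>h\<bar> * dist (\<Sum>l<n. f' l t) (\<Sum>l. f' l t)"
          by (simp add: scaleR_sum_right[symmetric] scaleR_diff_right[symmetric] dist_norm)
        also have "\<dots> \<le> \<bar>h\<bar> * e" using elim by (intro mult_left_mono) (auto intro: less_imp_le)
        finally show "norm ((\<Sum>l<n. h *\<^sub>R f' l t) - h *\<^sub>R (\<Sum>l. f' l t)) \<le> e * norm h" by (simp add: mult.commute)
      qed
    qed
  next
    show "(\<lambda>l. f l 0) sums (\<Sum>l. f l 0)"
      unfolding f_def z_def by (rule summable_sums) (rule jacobi_energy.green_summable[OF loc])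
  qed (use df in auto)
  then obtain g where g: "\<And>t. (\<lambda>l. f l t) sums g t" "\<And>t. (g has_vector_derivative (\<Sum>l. f' l t)) (at t)"
    by (auto simp: has_vector_derivative_def)
  have "(\<lambda>t. green (?A t) (?B t) z m n) = (\<lambda>t. - g t)"
    unfolding green_def using sums_unique[OF g(1)] by (simp add: f_def)
  moreover have "green_dot c (r + 1) (?A t) (?B t) z m n = - (\<Sum>l. f' l t)"
  proof -
    let ?P = "lax_kernel c (r + 1) (?A t) (?B t)"
    have sG: "(\<lambda>l. of_real (jpow (?A t) (?B t) l i j) / z ^ Suc l) sums - green (?A t) (?B t) z i j" for i j
      using summable_sums[OF jacobi_energy.green_summable[OF loc[of t], of i j]] unfolding green_def z_def by simp
    have "(\<lambda>l. (\<Sum>k\<in>{m - int (r + 1)..m + int (r + 1)}. of_real (?P m k) * (of_real (jpow (?A t) (?B t) l k n) / z ^ Suc l))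
        + (\<Sum>k\<in>{n - int (r + 1)..n + int (r + 1)}. of_real (?P n k) * (of_real (jpow (?A t) (?B t) l m k) / z ^ Suc l)))
      sums ((\<Sum>k\<in>{m - int (r + 1)..m + int (r + 1)}. of_real (?P m k) * - green (?A t) (?B t) z k n)
        + (\<Sum>k\<in>{n - int (r + 1)..n + int (r + 1)}. of_real (?P n k) * - green (?A t) (?B t) z m k))"
      by (intro sums_add sums_sum sums_mult sG)
    moreover have "(\<Sum>k\<in>{m - int (r + 1)..m + int (r + 1)}. of_real (?P m k) * (of_real (jpow (?A t) (?B t) l k n) / z ^ Suc l))
        + (\<Sum>k\<in>{n - int (r + 1)..n + int (r + 1)}. of_real (?P n k) * (of_real (jpow (?A t) (?B t) l m k) / z ^ Suc l)) = f' l t" for l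
      unfolding f'_def jpow_dot_def lax_op_def of_real_add of_real_sum of_real_mult add_divide_distrib sum_divide_distrib
      by simp
    ultimately have "(\<lambda>l. f' l t) sums - green_dot c (r + 1) (?A t) (?B t) z m n"
      by (simp add: green_dot_def sum_negf)
    then have "- green_dot c (r + 1) (?A t) (?B t) z m n = (\<Sum>l. f' l t)" by (rule sums_unique)
    then show ?thesis by (metis minus_minus)
  qed
  ultimately show ?thesis
    unfolding z_def[symmetric] using has_vector_derivative_minus[OF g(2)[of t]] by simp
qed

text \<open>On the diagonal both halves of the commutator coincide by symmetry of \<open>G\<close>.
  With the kernel replaced by its background value, skewness pairs the sites \<open>n + i\<close>
  and \<open>n - i\<close> into differences, which \<open>green_offdiag_pair\<close>
  evaluates.\<close>

lemma (in jacobi_energy) green_dot_diag: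
  fixes c :: "nat \<Rightarrow> real" and s :: nat
  assumes D: "tail (n - int s) D"
    and P: "\<And>k. \<bar>lax_kernel c s a b n k - lax_kernel c s (\<lambda>_. a0) (\<lambda>_. b0) n k\<bar> \<le> D'"
  shows "norm (green_dot c s a b z n n - dispersion c s a0 b0 \<zeta> * \<gamma> n)
    \<le> 2 * (\<Sum>i=1..s. 2 * D' + \<bar>free_symbol c s a0 b0 i\<bar> * (real i * (33 / a0 * D) * norm \<zeta> ^ i))"
proof -
  define P where "P = lax_kernel c s a b n"
  define p where "p = free_symbol c s a0 b0"
  define S where "S = (\<Sum>k\<in>{n - int s..n + int s}. of_real (P k) * G k n)"
  have D0: "D' \<ge> 0" using assms(2)[of 0] by linarith
  have "green_dot c s a b z n n = 2 * S"
    unfolding green_dot_def S_def P_def green_sym[of n] by simp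
  moreover have "P n = 0" unfolding P_def using lax_kernel_skew[of c s a b n n] by simp
  then have "S = (\<Sum>i=1..s. of_real (P (n + int i)) * G (n + int i) n + of_real (P (n - int i)) * G (n - int i) n)"
    unfolding S_def sum_symmetric_int by simp
  moreover have "dispersion c s a0 b0 \<zeta> * \<gamma> n = 2 * (\<Sum>i=1..s. of_real (p i) * (k ^ i - \<zeta> ^ i) * \<gamma> n)"
    by (simp only: dispersion_def p_def sum_distrib_right mult.assoc)
  ultimately have eq: "green_dot c s a b z n n - dispersion c s a0 b0 \<zeta> * \<gamma> n
    = 2 * (\<Sum>i=1..s. (of_real (P (n + int i)) * G (n + int i) n + of_real (P (n - int i)) * G (n - int i) n)
        - of_real (p i) * (k ^ i - \<zeta> ^ i) * \<gamma> n)"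
    by (simp only: sum_subtractf right_diff_distrib)
  have "norm (green_dot c s a b z n n - dispersion c s a0 b0 \<zeta> * \<gamma> n)
    = 2 * norm (\<Sum>i=1..s. (of_real (P (n + int i)) * G (n + int i) n + of_real (P (n - int i)) * G (n - int i) n)
        - of_real (p i) * (k ^ i - \<zeta> ^ i) * \<gamma> n)"
    unfolding eq by (simp only: norm_mult norm_numeral)
  also have "\<dots> \<le> 2 * (\<Sum>i=1..s. 2 * D' + \<bar>p i\<bar> * (real i * (33 / a0 * D) * norm \<zeta> ^ i))"
  proof (rule mult_left_mono[OF sum_norm_le])
    fix i assume i: "i \<in> {1..s}"
    have Di: "tail (n - int i) D" using D i by (auto simp: tail_bound_def)
    have eq: "(of_real (P (n + int i)) * G (n + int i) n + of_real (P (n - int i)) * G (n - int i) n) - of_real (p i) * (k ^ i - \<zeta> ^ i) * \<gamma> n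
      = of_real (P (n + int i) - p i) * G (n + int i) n + of_real (P (n - int i) + p i) * G (n - int i) n
        + of_real (p i) * (G (n + int i) n - G (n - int i) n - (k ^ i - \<zeta> ^ i) * \<gamma> n)"
      by (simp only: of_real_diff of_real_add algebra_simps)
    have "norm ((of_real (P (n + int i)) * G (n + int i) n + of_real (P (n - int i)) * G (n - int i) n) - of_real (p i) * (k ^ i - \<zeta> ^ i) * \<gamma> n)
      \<le> norm (of_real (P (n + int i) - p i) * G (n + int i) n) + norm (of_real (P (n - int i) + p i) * G (n - int i) n)
        + norm (of_real (p i) * (G (n + int i) n - G (n - int i) n - (k ^ i - \<zeta> ^ i) * \<gamma> n))"
      unfolding eq by (rule order_trans[OF norm_triangle_ineq]) (rule add_right_mono[OF norm_triangle_ineq])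
    also have "\<dots> \<le> D' * 1 + D' * 1 + \<bar>p i\<bar> * (real i * (33 / a0 * D) * norm \<zeta> ^ i)"
    proof (intro add_mono)
      have "\<bar>P (n + int i) - p i\<bar> \<le> D'" "\<bar>P (n - int i) + p i\<bar> \<le> D'"
        using assms(2)[of "n + int i"] assms(2)[of "n - int i"] by (simp_all add: P_def p_def lax_kernel_free)
      then show "norm (of_real (P (n + int i) - p i) * G (n + int i) n) \<le> D' * 1"
        "norm (of_real (P (n - int i) + p i) * G (n - int i) n) \<le> D' * 1"
        unfolding norm_mult norm_of_real using D0 by (intro mult_mono green_le_1; simp)+
      show "norm (of_real (p i) * (G (n + int i) n - G (n - int i) n - (k ^ i - \<zeta> ^ i) * \<gamma> n))
          \<le> \<bar>p i\<bar> * (real i * (33 / a0 * D) * norm \<zeta> ^ i)"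
        unfolding norm_mult norm_of_real by (intro mult_left_mono green_offdiag_pair Di) auto
    qed
    finally show "norm ((of_real (P (n + int i)) * G (n + int i) n + of_real (P (n - int i)) * G (n - int i) n)
        - of_real (p i) * (k ^ i - \<zeta> ^ i) * \<gamma> n) \<le> 2 * D' + \<bar>p i\<bar> * (real i * (33 / a0 * D) * norm \<zeta> ^ i)" by simp
  qed simp
  finally show ?thesis unfolding p_def .
qed

lemma refl_coef_evolution:
  fixes a b :: "int \<Rightarrow> real \<Rightarrow> real"
  assumes toda: "toda_hierarchy r c a b"
    and bnd: "\<And>n t. \<bar>a n t\<bar> \<le> M" "\<And>n t. \<bar>b n t\<bar> \<le> M" "a0 > 0" "a0 \<le> M" "\<bar>b0\<bar> \<le> M"
    and decay: "rapid_decay (\<lambda>n. a n t0) (\<lambda>n. b n t0) a0 b0"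
    and \<zeta>: "(12 * M + 8) / a0 + 2 \<le> norm \<zeta>"
  shows "refl_coef (\<lambda>n. a n t1) (\<lambda>n. b n t1) a0 b0 \<zeta>
    = exp (dispersion c (r + 1) a0 b0 \<zeta> * of_real (t1 - t0)) * refl_coef (\<lambda>n. a n t0) (\<lambda>n. b n t0) a0 b0 \<zeta>"
proof -
  let ?A = "\<lambda>t n. a n t" and ?B = "\<lambda>t n. b n t"
  define s where "s = r + 1"
  define \<alpha> where "\<alpha> = dispersion c s a0 b0 \<zeta>"
  define T where "T = \<bar>t1 - t0\<bar>"
  have loc: "jacobi_energy (?A t) (?B t) M a0 b0 \<zeta>" for t
    using bnd \<zeta> by unfold_locales auto
  have M: "M > 0" using bnd by linarith
  have a0M: "\<bar>a0\<bar> \<le> M" using bnd by simp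
  have n\<zeta>: "norm \<zeta> \<ge> 2" by (rule jacobi_energy.norm_\<zeta>[OF loc[of 0]])
  \<comment> \<open>With \<open>exp \<kappa> = 2 * norm \<zeta> ^ 2\<close>, errors of order
    \<open>exp (- \<kappa> * N)\<close> are still of order \<open>(1 / 2) ^ N\<close> after
    multiplication by \<open>\<zeta> ^ (2 * N)\<close>.\<close>
  define \<kappa> where "\<kappa> = ln (2 * norm \<zeta> ^ 2)"
  have n2: "norm \<zeta> ^ 2 \<ge> 1" using n\<zeta> by (intro one_le_power) linarith
  have \<kappa>: "\<kappa> > 0" unfolding \<kappa>_def using n2 by (intro ln_gt_zero) linarith
  have e\<kappa>: "exp \<kappa> = 2 * norm \<zeta> ^ 2" unfolding \<kappa>_def using n2 by (subst exp_ln) auto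
  obtain K where K: "K \<ge> 0" "\<And>j t. \<bar>t - t0\<bar> \<le> T \<Longrightarrow> \<bar>a j t - a0\<bar> * exp (\<kappa> * real_of_int j) \<le> K"
    "\<And>j t. \<bar>t - t0\<bar> \<le> T \<Longrightarrow> \<bar>b j t - b0\<bar> * exp (\<kappa> * real_of_int j) \<le> K"
    using toda_rapid_uniform[OF toda bnd(1,2) a0M bnd(5) decay \<kappa>, of T] by blast
  define CP where "CP = (\<Sum>l=0..s. \<bar>c (s - l)\<bar> * (dev_const M (exp \<kappa>) l * exp \<kappa> ^ l)) * K"
  define C where "C = 2 * (\<Sum>i=1..s. 2 * CP + \<bar>free_symbol c s a0 b0 i\<bar> * (real i * (33 / a0 * (K * exp (\<kappa> * real s))) * norm \<zeta> ^ i))"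
  define \<gamma> where "\<gamma> t = green_dev (?A t) (?B t) a0 b0 \<zeta>" for t
  define \<gamma>' where "\<gamma>' t n = green_dot c s (?A t) (?B t) (energy a0 b0 \<zeta>) n n" for t n
  have d\<gamma>: "((\<lambda>t. \<gamma> t n) has_vector_derivative \<gamma>' t n) (at t)" for n t
    unfolding \<gamma>_def \<gamma>'_def green_dev_def s_def
    using has_vector_derivative_diff[OF green_has_derivative[OF toda bnd \<zeta>] has_vector_derivative_const] by simp
  have err: "norm (\<gamma>' t n - \<alpha> * \<gamma> t n) \<le> C * exp (- (\<kappa> * real_of_int n))" if t: "\<bar>t - t0\<bar> \<le> T" for t n
  proof -
    interpret jacobi_energy "?A t" "?B t" M a0 b0 \<zeta> by (rule loc)
    let ?E = "exp (- (\<kappa> * real_of_int n))"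
    have "tail (n - int s) (K * exp (- (\<kappa> * real_of_int (n - int s))))"
      by (rule tail_bound_exp) (use K t \<kappa> in auto)
    also have "K * exp (- (\<kappa> * real_of_int (n - int s))) = K * exp (\<kappa> * real s) * ?E"
      by (simp add: exp_add[symmetric] algebra_simps)
    finally have D: "tail (n - int s) (K * exp (\<kappa> * real s) * ?E)" .
    have P: "\<bar>lax_kernel c s (?A t) (?B t) n k - lax_kernel c s (\<lambda>_. a0) (\<lambda>_. b0) n k\<bar> \<le> CP * ?E" for k
    proof -
      have "\<bar>lax_kernel c s (?A t) (?B t) n k - lax_kernel c s (\<lambda>_. a0) (\<lambda>_. b0) n k\<bar> * exp (\<kappa> * real_of_int n) \<le> CP"
        unfolding CP_def
      proof (rule lax_kernel_deviation[where w = "\<lambda>j. exp (\<kappa> * real_of_int j)"])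
        fix j
        show "exp (\<kappa> * real_of_int j) \<le> exp \<kappa> * exp (\<kappa> * real_of_int (j + 1))"
          "exp (\<kappa> * real_of_int j) \<le> exp \<kappa> * exp (\<kappa> * real_of_int (j - 1))"
          using \<kappa> by (simp_all add: exp_add[symmetric] algebra_simps)
      qed (use bnd a0M K t \<kappa> in auto)
      then show ?thesis by (simp add: exp_minus field_simps)
    qed
    have "norm (\<gamma>' t n - \<alpha> * \<gamma> t n) \<le> 2 * (\<Sum>i=1..s. 2 * (CP * ?E) + \<bar>free_symbol c s a0 b0 i\<bar> * (real i * (33 / a0 * (K * exp (\<kappa> * real s) * ?E)) * norm \<zeta> ^ i))"
      unfolding \<gamma>'_def \<alpha>_def \<gamma>_def by (rule green_dot_diag[OF D P])
    also have "\<dots> = C * ?E"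
      unfolding C_def by (simp only: sum_distrib_right sum_distrib_left) (intro sum.cong refl, simp add: algebra_simps)
    finally show ?thesis .
  qed
  define B where "B = exp (norm \<alpha> * T) * C"
  have step: "norm (exp (- (\<alpha> * of_real (t1 - t0))) * refl_seq (?A t1) (?B t1) a0 b0 \<zeta> N - refl_seq (?A t0) (?B t0) a0 b0 \<zeta> N)
    \<le> B * (1 / 2) ^ N * T" for N
  proof -
    \<comment> \<open>The equation \<open>\<gamma>' = \<alpha> * \<gamma>\<close> holds only up to
      \<open>err\<close>. The integrating factor removes \<alpha>, so the derivative of
      \<open>Y\<close> consists of the error alone and the two end values differ by
      \<open>O((1 / 2) ^ N)\<close>; the exact law appears as \<open>N\<close> tends to
      infinity.\<close>
    define Y where "Y t = exp (- (\<alpha> * of_real (t - t0))) * (\<zeta> ^ (2 * N) * \<gamma> t (int N))" for t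
    define Y' where "Y' t = exp (- (\<alpha> * of_real (t - t0))) * (\<zeta> ^ (2 * N) * (\<gamma>' t (int N) - \<alpha> * \<gamma> t (int N)))" for t
    have dY: "(Y has_vector_derivative Y' t) (at t)" for t
    proof -
      have "((\<lambda>t. exp (- (\<alpha> * of_real (t - t0)))) has_vector_derivative (- \<alpha> * exp (- (\<alpha> * of_real (t - t0))))) (at t)"
      proof -
        have "((\<lambda>w. exp (- (\<alpha> * (w - of_real t0)))) has_field_derivative (- \<alpha> * exp (- (\<alpha> * (of_real t - of_real t0))))) (at (of_real t))"
          by (rule derivative_eq_intros refl | simp)+
        from has_vector_derivative_real_field[OF this] show ?thesis by simp
      qed
      then have "(Y has_vector_derivative (exp (- (\<alpha> * of_real (t - t0))) * (\<zeta> ^ (2 * N) * \<gamma>' t (int N))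
          + - \<alpha> * exp (- (\<alpha> * of_real (t - t0))) * (\<zeta> ^ (2 * N) * \<gamma> t (int N)))) (at t)"
        unfolding Y_def by (intro has_vector_derivative_mult has_vector_derivative_mult_right d\<gamma>)
      then show ?thesis by (simp add: Y'_def algebra_simps)
    qed
    have "norm (Y t1 - Y t0) \<le> (B * (1 / 2) ^ N) * norm (t1 - t0)"
    proof (rule differentiable_bound[where S = "closed_segment t0 t1" and f' = "\<lambda>t h. h *\<^sub>R Y' t"])
      fix t assume "t \<in> closed_segment t0 t1"
      then have t: "\<bar>t - t0\<bar> \<le> T" by (auto simp: closed_segment_eq_real_ivl T_def split: if_splits)
      show "(Y has_derivative (\<lambda>h. h *\<^sub>R Y' t)) (at t within closed_segment t0 t1)"
        using dY[of t] has_derivative_at_withinI unfolding has_vector_derivative_def by blast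
      have "norm (Y' t) \<le> exp (norm \<alpha> * T) * (norm \<zeta> ^ (2 * N) * (C * exp (- (\<kappa> * real_of_int (int N)))))"
        unfolding Y'_def norm_mult norm_power
      proof (intro mult_mono err t)
        have "norm (exp (- (\<alpha> * of_real (t - t0)))) \<le> exp (norm (- (\<alpha> * of_real (t - t0))))" by (rule norm_exp)
        also have "norm (- (\<alpha> * of_real (t - t0))) = norm \<alpha> * \<bar>t - t0\<bar>"
          by (simp only: norm_minus_cancel norm_mult norm_of_real)
        also have "exp \<dots> \<le> exp (norm \<alpha> * T)" using t by (simp add: mult_left_mono)
        finally show "norm (exp (- (\<alpha> * of_real (t - t0)))) \<le> exp (norm \<alpha> * T)" .
      qed auto
      also have "norm \<zeta> ^ (2 * N) * (C * exp (- (\<kappa> * real_of_int (int N)))) = C * (1 / 2) ^ N"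
      proof -
        have "exp (- (\<kappa> * real_of_int (int N))) = 1 / exp \<kappa> ^ N"
          by (simp add: exp_minus inverse_eq_divide mult.commute[of \<kappa>] exp_of_nat_mult)
        also have "\<dots> = 1 / ((2 * norm \<zeta> ^ 2) ^ N)" unfolding e\<kappa> ..
        finally have "exp (- (\<kappa> * real_of_int (int N))) = 1 / ((2 * norm \<zeta> ^ 2) ^ N)" .
        moreover have "\<zeta> \<noteq> 0" using n\<zeta> by auto
        ultimately show ?thesis by (simp add: power_mult_distrib power_mult power_one_over)
      qed
      finally have "norm (Y' t) \<le> B * (1 / 2) ^ N" by (simp add: B_def)
      then show "onorm (\<lambda>h. h *\<^sub>R Y' t) \<le> B * (1 / 2) ^ N"
        by (simp add: onorm_scaleR_left onorm_id)
    qed auto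
    then show ?thesis by (simp add: Y_def refl_seq_def \<gamma>_def T_def)
  qed
  have lim: "refl_seq (?A t) (?B t) a0 b0 \<zeta> \<longlonglongrightarrow> refl_coef (?A t) (?B t) a0 b0 \<zeta>" for t
  proof -
    have dec: "rapid_decay (?A t) (?B t) a0 b0"
      by (rule toda_rapid_decay[OF toda bnd(1,2) a0M bnd(5) decay])
    have "\<exists>C. \<forall>\<zeta>' N. (12 * M + 8) / a0 + 2 \<le> norm \<zeta>' \<longrightarrow> norm \<zeta>' \<le> norm \<zeta> \<longrightarrow>
        norm (refl_coef (?A t) (?B t) a0 b0 \<zeta>' - refl_seq (?A t) (?B t) a0 b0 \<zeta>' N) \<le> C * (1 / 2) ^ N"
      by (rule refl_uniform_limit) (use bnd dec in auto)
    then obtain C where C: "\<And>N. norm (refl_coef (?A t) (?B t) a0 b0 \<zeta> - refl_seq (?A t) (?B t) a0 b0 \<zeta> N) \<le> C * (1 / 2) ^ N"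
      using \<zeta> by blast
    have "(\<lambda>N. C * (1 / 2) ^ N) \<longlonglongrightarrow> C * 0" by (intro tendsto_intros LIMSEQ_power_zero) auto
    then have "(\<lambda>N. C * (1 / 2) ^ N) \<longlonglongrightarrow> 0" by simp
    then have "(\<lambda>N. refl_seq (?A t) (?B t) a0 b0 \<zeta> N - refl_coef (?A t) (?B t) a0 b0 \<zeta>) \<longlonglongrightarrow> 0"
      by (rule Lim_null_comparison[rotated]) (use C in \<open>simp add: norm_minus_commute\<close>)
    then show ?thesis by (rule LIM_zero_cancel)
  qed
  let ?d = "\<lambda>N. exp (- (\<alpha> * of_real (t1 - t0))) * refl_seq (?A t1) (?B t1) a0 b0 \<zeta> N - refl_seq (?A t0) (?B t0) a0 b0 \<zeta> N"
  have "?d \<longlonglongrightarrow> exp (- (\<alpha> * of_real (t1 - t0))) * refl_coef (?A t1) (?B t1) a0 b0 \<zeta> - refl_coef (?A t0) (?B t0) a0 b0 \<zeta>"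
    by (intro tendsto_intros lim)
  moreover have "?d \<longlonglongrightarrow> 0"
  proof (rule Lim_null_comparison)
    have "(\<lambda>N. B * (1 / 2) ^ N * T) \<longlonglongrightarrow> B * 0 * T" by (intro tendsto_intros LIMSEQ_power_zero) auto
    then show "(\<lambda>N. B * (1 / 2) ^ N * T) \<longlonglongrightarrow> 0" by simp
    show "\<forall>\<^sub>F N in sequentially. norm (?d N) \<le> B * (1 / 2) ^ N * T" using step by auto
  qed
  ultimately have "exp (- (\<alpha> * of_real (t1 - t0))) * refl_coef (?A t1) (?B t1) a0 b0 \<zeta> - refl_coef (?A t0) (?B t0) a0 b0 \<zeta> = 0"
    by (rule LIMSEQ_unique)
  then have "refl_coef (?A t0) (?B t0) a0 b0 \<zeta> = exp (- (\<alpha> * of_real (t1 - t0))) * refl_coef (?A t1) (?B t1) a0 b0 \<zeta>"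
    by simp
  then show ?thesis
    by (simp only: \<alpha>_def[symmetric] s_def[symmetric] mult.assoc[symmetric] exp_add[symmetric]) simp
qed

section \<open>Functions that are flat at infinity\<close>

text \<open>Phragmen-Lindelof in the coordinate \<open>w = log \<zeta>\<close>, where the sector is
  a half strip and no branch of a power has to be chosen. The damping factor is
  \<open>exp (- \<kappa> * \<zeta> ^ (3 / 2))\<close>: the exponent 3/2 exceeds 1 and beats
  exponential type, while \<open>3 / 2 * pi / 4 = 3 / 8 * pi\<close> stays below
  \<open>pi / 2\<close>, so it really decays in the whole sector. The maximum principle is used on a
  rectangle, and finally \<kappa> tends to 0.\<close>

lemma bounded_sector_log:
  fixes Q :: "complex \<Rightarrow> complex"
  assumes hol: "Q holomorphic_on {\<zeta>. R < norm \<zeta>}" and R: "0 < R'" "R < R'"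
    and growth: "\<And>\<zeta>. R < norm \<zeta> \<Longrightarrow> norm (Q \<zeta>) \<le> C * exp (B * norm \<zeta>)" and B: "B \<ge> 0"
    and side: "\<And>x. ln R' \<le> x \<Longrightarrow> norm (Q (of_real (exp x) * cis (u - h))) \<le> C"
      "\<And>x. ln R' \<le> x \<Longrightarrow> norm (Q (of_real (exp x) * cis (u + h))) \<le> C"
    and h: "0 < h" "h \<le> pi / 4" and x: "ln R' \<le> x" and y: "\<bar>y\<bar> \<le> h"
  shows "norm (Q (of_real (exp x) * cis (u + y))) \<le> C * exp (B * R')"
proof -
  have C0: "C \<ge> 0"
    using side(1)[of "ln R'"] by (meson norm_ge_zero order_refl order_trans)
  have C2: "C \<le> C * exp (B * R')" using C0 B R by (simp add: mult_le_cancel_left1)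
  define d where "d = cos (3 / 8 * pi)"
  have d: "d > 0" unfolding d_def by (rule cos_gt_zero) auto
  have cosd: "cos (3 / 2 * y') \<ge> d" if "\<bar>y'\<bar> \<le> h" for y'
  proof -
    have "\<bar>3 / 2 * y'\<bar> \<le> 3 / 8 * pi" using that h by (auto simp: abs_mult)
    then have "cos (3 / 8 * pi) \<le> cos \<bar>3 / 2 * y'\<bar>" by (intro cos_monotone_0_pi_le) auto
    then show ?thesis by (simp only: d_def cos_abs_real)
  qed
  have main: "norm (Q (of_real (exp x) * cis (u + y))) * exp (- \<kappa> * exp (3 / 2 * x)) \<le> C * exp (B * R')" if \<kappa>: "\<kappa> > 0" for \<kappa>
  proof -
    \<comment> \<open>Far enough to the right that \<open>x\<close> lies inside the rectangle and
      \<open>B * exp L \<le> \<kappa> * d * exp (3 / 2 * L)\<close>; the latter means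
      \<open>exp (L / 2) \<ge> B / (\<kappa> * d)\<close>, so the damping wins on the edge
      \<open>Re w = L\<close>.\<close>
    define L where "L = max (x + 1) (2 * ln (max 1 (B / (\<kappa> * d))))"
    define F where "F w = Q (exp (w + \<i> * of_real u)) * exp (- of_real \<kappa> * exp (of_real (3 / 2) * w))" for w
    define a b where "a = Complex (ln R') (- h)" and "b = Complex L h"
    have norm_exp_arg: "norm (exp (w + \<i> * of_real u)) = exp (Re w)" for w by simp
    have polar: "exp (w + \<i> * of_real u) = of_real (exp (Re w)) * cis (u + Im w)" for w
      by (simp add: exp_eq_polar cis_mult[symmetric] add.commute)
    have damp: "norm (exp (- of_real \<kappa> * exp (of_real (3 / 2) * w))) = exp (- \<kappa> * (exp (3 / 2 * Re w) * cos (3 / 2 * Im w)))" for w :: complex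
      by (simp add: Re_exp)
    have damp_le: "norm (exp (- of_real \<kappa> * exp (of_real (3 / 2) * w))) \<le> exp (- \<kappa> * (exp (3 / 2 * Re w) * d))"
      if "\<bar>Im w\<bar> \<le> h" for w :: complex
      unfolding damp using cosd[OF that] \<kappa> by simp
    have damp_1: "norm (exp (- of_real \<kappa> * exp (of_real (3 / 2) * w))) \<le> 1" if "\<bar>Im w\<bar> \<le> h" for w :: complex
    proof -
      have "exp (- \<kappa> * (exp (3 / 2 * Re w) * d)) \<le> 1" using \<kappa> d by simp
      then show ?thesis using damp_le[OF that] by linarith
    qed
    have box: "ln R' \<le> Re w \<and> Re w \<le> L \<and> \<bar>Im w\<bar> \<le> h" if "w \<in> cbox a b" for w
      using that by (auto simp: in_cbox_complex_iff a_def b_def)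
    have inR: "R < norm (exp (w + \<i> * of_real u))" if "w \<in> cbox a b" for w
    proof -
      have "exp (ln R') \<le> exp (Re w)" using box[OF that] by simp
      then have "R' \<le> exp (Re w)" using R by simp
      then show ?thesis using R by simp
    qed
    have holF: "F holomorphic_on cbox a b"
    proof -
      have "(Q \<circ> (\<lambda>w. exp (w + \<i> * of_real u))) holomorphic_on cbox a b"
        by (rule holomorphic_on_compose_gen[OF _ hol]) (use inR in \<open>auto intro!: holomorphic_intros\<close>)
      then show ?thesis unfolding F_def o_def by (intro holomorphic_intros)
    qed
    have "norm (F (Complex x y)) \<le> C * exp (B * R')"
    proof (rule maximum_modulus_frontier[where S = "cbox a b" and f = F and \<xi> = "Complex x y"])
      show "F holomorphic_on interior (cbox a b)"
        using holF holomorphic_on_subset interior_subset by blast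
      show "continuous_on (closure (cbox a b)) F"
        using holF holomorphic_on_imp_continuous_on by simp
      show "Complex x y \<in> cbox a b"
        using x y by (auto simp: in_cbox_complex_iff a_def b_def L_def)
      fix w assume w: "w \<in> frontier (cbox a b)"
      then have wb: "w \<in> cbox a b" using frontier_cbox by auto
      have "w \<notin> box a b" using w by (simp add: frontier_cbox)
      then have edge: "Re w = ln R' \<or> Re w = L \<or> Im w = - h \<or> Im w = h"
        using box[OF wb] by (auto simp: in_box_complex_iff a_def b_def)
      note bx = box[OF wb]
      have nF: "norm (F w) = norm (Q (exp (w + \<i> * of_real u))) * norm (exp (- of_real \<kappa> * exp (of_real (3 / 2) * w)))"
        by (simp only: F_def norm_mult)
      have small: "norm (F w) \<le> C * exp (B * R')" if "norm (Q (exp (w + \<i> * of_real u))) \<le> C * exp (B * R')"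
      proof -
        have "norm (F w) \<le> (C * exp (B * R')) * 1"
          unfolding nF using that damp_1 bx C0 by (intro mult_mono) auto
        then show ?thesis by simp
      qed
      from edge consider "Re w = ln R'" | "Re w = L" | "Im w = - h" | "Im w = h" by blast
      then show "norm (F w) \<le> C * exp (B * R')"
      proof cases
        case 1
        have "norm (exp (w + \<i> * of_real u)) = R'" using 1 R by (simp only: norm_exp_arg) simp
        then show ?thesis using growth[OF inR[OF wb]] by (intro small) simp
      next
        case 2
        have "norm (F w) \<le> C * exp (B * exp L) * exp (- \<kappa> * (exp (3 / 2 * L) * d))"
          unfolding nF using growth[OF inR[OF wb]] damp_le[of w] bx C0 2
          by (intro mult_mono) (simp_all only: norm_exp_arg, auto)
        also have "\<dots> = C * exp (B * exp L - \<kappa> * (exp (3 / 2 * L) * d))"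
          by (simp add: exp_add[symmetric] mult.assoc)
        also have "\<dots> \<le> C * 1"
        proof -
          have "ln (max 1 (B / (\<kappa> * d))) \<le> L / 2" by (simp add: L_def)
          then have "exp (ln (max 1 (B / (\<kappa> * d)))) \<le> exp (L / 2)" by (simp only: exp_le_cancel_iff)
          moreover have "exp (ln (max 1 (B / (\<kappa> * d)))) = max 1 (B / (\<kappa> * d))" by (intro exp_ln) simp
          ultimately have "max 1 (B / (\<kappa> * d)) \<le> exp (L / 2)" by (simp only:)
          then have "B / (\<kappa> * d) \<le> exp (L / 2)" by simp
          then have "B \<le> \<kappa> * d * exp (L / 2)" using \<kappa> d by (simp add: pos_divide_le_eq mult.commute)
          then have "B * exp L \<le> \<kappa> * d * exp (L / 2) * exp L" by (intro mult_right_mono) auto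
          also have "\<dots> = \<kappa> * (exp (3 / 2 * L) * d)" by (simp add: exp_add[symmetric] mult_ac)
          finally have "B * exp L - \<kappa> * (exp (3 / 2 * L) * d) \<le> 0" by simp
          then show ?thesis using C0 by (intro mult_left_mono) auto
        qed
        finally show ?thesis using C2 by simp
      next
        case 3
        then show ?thesis using side(1)[of "Re w"] bx C2 by (intro small) (simp add: polar)
      next
        case 4
        then show ?thesis using side(2)[of "Re w"] bx C2 by (intro small) (simp add: polar)
      qed
    qed (auto simp: bounded_cbox)
    moreover have "exp (- \<kappa> * exp (3 / 2 * x)) \<le> norm (exp (- of_real \<kappa> * exp (of_real (3 / 2) * Complex x y)))"
      unfolding damp using \<kappa> by simp
    ultimately show ?thesis
      unfolding F_def norm_mult
      by (smt (verit) complex.sel mult_left_mono norm_ge_zero polar)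
  qed
  have "((\<lambda>\<kappa>. norm (Q (of_real (exp x) * cis (u + y))) * exp (- \<kappa> * exp (3 / 2 * x)))
      \<longlongrightarrow> norm (Q (of_real (exp x) * cis (u + y))) * exp (- 0 * exp (3 / 2 * x))) (at_right 0)"
    by (intro tendsto_intros)
  then have "norm (Q (of_real (exp x) * cis (u + y))) * exp (- 0 * exp (3 / 2 * x)) \<le> C * exp (B * R')"
    by (rule tendsto_upperbound) (rule eventually_mono[OF eventually_at_right_less main], simp_all)
  then show ?thesis by simp
qed

text \<open>A function that is not identically zero vanishes at 0 to some finite order
  \<open>m\<close>, whereas \<open>exp (- c / x)\<close> is of order \<open>x ^ Suc m\<close>;
  dividing by the zero forces the nonvanishing cofactor \<open>p\<close> to vanish at 0.\<close>

lemma flat_at_zero: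
  fixes g :: "complex \<Rightarrow> complex"
  assumes hol: "g holomorphic_on ball 0 \<rho>" and \<rho>: "\<rho> > 0" and c: "c > 0"
    and flat: "\<And>x. 0 < x \<Longrightarrow> x < \<rho> \<Longrightarrow> norm (g (of_real x)) \<le> C * exp (- c / x)"
    and w: "w \<in> ball 0 \<rho>"
  shows "g w = 0"
proof (rule ccontr)
  assume "g w \<noteq> 0"
  then have nz: "\<exists>w\<in>ball 0 \<rho>. g w \<noteq> 0" using w by blast
  define n where "n = zorder g 0"
  define p where "p = zor_poly g 0"
  have "(if g 0 = 0 then 0 < n else n = 0) \<and> (\<exists>r>0. cball (0::complex) r \<subseteq> ball 0 \<rho> \<and> p holomorphic_on cball 0 r \<and>
      (\<forall>w\<in>cball 0 r. g w = p w * (w - 0) ^ nat n \<and> p w \<noteq> 0))"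
    unfolding n_def p_def
  proof (rule zorder_exist_zero[where S = "ball 0 \<rho>"])
    show "g holomorphic_on ball 0 \<rho>" by (rule hol)
    show "\<exists>w\<in>ball 0 \<rho>. g w \<noteq> 0" by (rule nz)
  qed (use \<rho> in auto)
  then obtain r where r: "r > 0" "cball (0::complex) r \<subseteq> ball 0 \<rho>" "p holomorphic_on cball 0 r"
    "\<And>w. w \<in> cball 0 r \<Longrightarrow> g w = p w * (w - 0) ^ nat n \<and> p w \<noteq> 0"
    by blast
  define m where "m = nat n"
  define K where "K = C * (fact (Suc m) / c ^ Suc m)"
  have C0: "C \<ge> 0" using flat[of "\<rho> / 2"] \<rho>
    by (smt (verit, best) exp_gt_zero half_gt_zero mult_neg_pos norm_ge_zero field_sum_of_halves)
  have le: "norm (p (of_real x)) \<le> K * x" if x: "0 < x" "x < r" for x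
  proof -
    have "norm (of_real x :: complex) \<le> r" using x by simp
    then have xr: "of_real x \<in> cball (0::complex) r" by simp
    with r(2) have "of_real x \<in> ball (0::complex) \<rho>" by blast
    then have "x < \<rho>" using x by simp
    have e: "exp (- c / x) \<le> fact (Suc m) / c ^ Suc m * x ^ Suc m"
    proof -
      have "(c / x) ^ Suc m / fact (Suc m) \<le> exp (c / x)"
        using c x by (intro power_over_fact_le_exp) auto
      then have "inverse (exp (c / x)) \<le> inverse ((c / x) ^ Suc m / fact (Suc m))"
        using c x by (intro le_imp_inverse_le divide_pos_pos) auto
      also have "\<dots> = fact (Suc m) / c ^ Suc m * x ^ Suc m"
        by (simp only: inverse_divide power_divide) simp
      finally show ?thesis by (simp add: exp_minus)
    qed
    have "norm (p (of_real x)) * x ^ m = norm (g (of_real x))"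
      using r(4)[OF xr] x by (simp add: norm_mult norm_power m_def)
    also have "\<dots> \<le> C * (fact (Suc m) / c ^ Suc m * x ^ Suc m)"
      using flat[OF x(1) \<open>x < \<rho>\<close>] mult_left_mono[OF e C0] by linarith
    also have "\<dots> = (K * x) * x ^ m" by (simp add: K_def)
    finally show ?thesis using x by (simp only: mult_le_cancel_right_pos zero_less_power)
  qed
  have "continuous_on (cball 0 r) p" using r(3) by (rule holomorphic_on_imp_continuous_on)
  then have "isCont p 0" using r(1) by (simp add: continuous_on_interior)
  then have "(p \<longlongrightarrow> p (of_real 0)) (at (of_real 0))" by (simp add: isCont_def)
  moreover have "filterlim (\<lambda>x :: real. of_real x) (at (of_real 0 :: complex)) (at_right 0)"
  proof -
    have "((\<lambda>x :: real. of_real x :: complex) \<longlongrightarrow> of_real 0) (at_right 0)" by (intro tendsto_intros)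
    then show ?thesis unfolding filterlim_at by (auto simp: eventually_at_filter)
  qed
  ultimately have "((\<lambda>x. p (of_real x)) \<longlongrightarrow> p (of_real 0)) (at_right (0::real))"
    by (rule filterlim_compose)
  then have 1: "((\<lambda>x. norm (p (of_real x))) \<longlongrightarrow> norm (p 0)) (at_right (0::real))"
    by (simp add: tendsto_norm)
  have 2: "((\<lambda>x. K * x) \<longlongrightarrow> K * 0) (at_right (0::real))" by (intro tendsto_intros)
  have "norm (p 0) \<le> K * 0"
  proof (rule tendsto_le[OF _ 2 1])
    show "\<forall>\<^sub>F x in at_right 0. norm (p (of_real x)) \<le> K * x"
      using eventually_at_right[of 0 1 "\<lambda>x. norm (p (of_real x)) \<le> K * x"] le r(1) by (auto simp: eventually_at_right_field)
  qed simp
  then show False using r(1,4) by simp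
qed

text \<open>Between two neighbouring rays on which \<open>cos (s \<theta>)\<close> stays away from \<open>0\<close> the function is
  bounded by the Phragmen-Lindelof principle; hence \<open>\<infinity>\<close> is a removable singularity, and the decay
  along the positive axis makes it a zero of infinite order.\<close>

lemma flat_at_infinity:
  fixes Q :: "complex \<Rightarrow> complex"
  assumes hol: "Q holomorphic_on {\<zeta>. R < norm \<zeta>}" and R: "0 \<le> R" and s: "s \<ge> 1"
    and growth: "\<And>\<zeta>. R < norm \<zeta> \<Longrightarrow> norm (Q \<zeta>) \<le> C * exp (B * norm \<zeta>)" and B: "B \<ge> 0"
    and good: "\<And>r \<theta>. R < r \<Longrightarrow> sqrt 2 / 2 \<le> \<bar>cos (real s * \<theta>)\<bar> \<Longrightarrow> norm (Q (of_real r * cis \<theta>)) \<le> C * exp (- c * r)"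
    and c: "c > 0" and \<zeta>: "R < norm \<zeta>"
  shows "Q \<zeta> = 0"
proof -
  define R' where "R' = (R + norm \<zeta>) / 2"
  have R': "0 < R'" "R < R'" "R' < norm \<zeta>" using R \<zeta> by (auto simp: R'_def)
  have C0: "C \<ge> 0"
    using growth[OF \<zeta>] by (meson exp_gt_zero norm_ge_zero order_trans zero_le_mult_iff not_le)
  have good': "norm (Q (of_real (exp x) * cis \<theta>)) \<le> C" if "ln R' \<le> x" "sqrt 2 / 2 \<le> \<bar>cos (real s * \<theta>)\<bar>" for x \<theta>
  proof -
    have "exp (ln R') \<le> exp x" using that(1) by simp
    then have "R' \<le> exp x" using R' by simp
    then have "norm (Q (of_real (exp x) * cis \<theta>)) \<le> C * exp (- c * exp x)"
      using that R' by (intro good) auto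
    also have "\<dots> \<le> C * 1" using C0 c by (intro mult_left_mono) auto
    finally show ?thesis by simp
  qed
  have bdd: "norm (Q w) \<le> C * exp (B * R')" if w: "R' \<le> norm w" for w
  proof -
    have w0: "w \<noteq> 0" using w R' by auto
    define x where "x = ln (norm w)"
    define \<theta> where "\<theta> = Arg w"
    have wp: "w = of_real (exp x) * cis \<theta>"
      using w0 cis_Arg[of w] by (simp add: x_def \<theta>_def sgn_eq)
    have xR: "ln R' \<le> x" using w w0 R' by (simp add: x_def)
    \<comment> \<open>\<open>pi / 2 + j * pi\<close> is the zero of the cosine nearest to
      \<open>s * \<theta>\<close>, and \<delta> the distance with sign. If the modulus of \<delta>
      exceeds \<open>pi / 4\<close>, the ray is good. Otherwise it lies in the sector of
      half-opening \<open>pi / (4 * s)\<close> around that zero, and the two sides of this sector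
      are good rays.\<close>
    define j where "j = round ((real s * \<theta> - pi / 2) / pi)"
    define \<delta> where "\<delta> = real s * \<theta> - pi / 2 - of_int j * pi"
    have d: "\<bar>\<delta>\<bar> \<le> pi / 2"
    proof -
      have "\<bar>of_int j - (real s * \<theta> - pi / 2) / pi\<bar> \<le> 1 / 2"
        unfolding j_def by (rule of_int_round_abs_le)
      then have "\<bar>of_int j - (real s * \<theta> - pi / 2) / pi\<bar> * pi \<le> 1 / 2 * pi" by (intro mult_right_mono) auto
      moreover have "\<bar>of_int j - (real s * \<theta> - pi / 2) / pi\<bar> * pi = \<bar>(of_int j - (real s * \<theta> - pi / 2) / pi) * pi\<bar>"
        by (simp add: abs_mult)
      moreover have "(of_int j - (real s * \<theta> - pi / 2) / pi) * pi = - \<delta>"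
        by (simp add: \<delta>_def field_simps)
      ultimately show ?thesis by simp
    qed
    have cosabs: "\<bar>cos (pi / 2 + of_int j * pi + y)\<bar> = \<bar>sin y\<bar>" for y
    proof -
      have sj: "sin (of_int j * pi) = 0"
        by (simp add: sin_times_pi_eq_0)
      have "cos (pi / 2 + of_int j * pi + y) = - sin (of_int j * pi + y)"
        unfolding add.assoc cos_add[of "pi / 2"] by simp
      also have "\<dots> = - (sin y * cos (of_int j * pi))"
        unfolding sin_add sj by simp
      finally have "\<bar>cos (pi / 2 + of_int j * pi + y)\<bar> = \<bar>sin y\<bar> * \<bar>cos (of_int j * pi)\<bar>"
        by (simp only: abs_minus_cancel abs_mult)
      moreover have "(cos (of_int j * pi))\<^sup>2 = 1"
        using sin_cos_squared_add[of "of_int j * pi"] unfolding sj by simp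
      then have "\<bar>cos (of_int j * pi)\<bar> = 1" by (simp only: abs_square_eq_1)
      ultimately show ?thesis by simp
    qed
    have th: "real s * \<theta> = pi / 2 + of_int j * pi + \<delta>" by (simp add: \<delta>_def)
    show ?thesis
    proof (cases "\<bar>\<delta>\<bar> \<le> pi / 4")
      case False
      have "sqrt 2 / 2 = sin (pi / 4)" by (simp add: sin_45)
      also have "\<dots> \<le> sin \<bar>\<delta>\<bar>" using False d by (intro sin_monotone_2pi_le) auto
      also have "\<dots> \<le> \<bar>sin \<delta>\<bar>" by (simp add: abs_if)
      finally have "sqrt 2 / 2 \<le> \<bar>cos (real s * \<theta>)\<bar>" unfolding th cosabs .
      then have "norm (Q w) \<le> C" unfolding wp using xR by (intro good')
      also have "C \<le> C * exp (B * R')" using C0 B R' by (simp add: mult_le_cancel_left1)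
      finally show ?thesis .
    next
      case True
      define u where "u = (pi / 2 + of_int j * pi) / real s"
      define h where "h = pi / 4 / real s"
      have "norm (Q (of_real (exp x) * cis (u + \<delta> / real s))) \<le> C * exp (B * R')"
      proof (rule bounded_sector_log[OF hol R'(1,2) growth B, where h = h])
        have "real s * (u - h) = pi / 2 + of_int j * pi + - (pi / 4)" "real s * (u + h) = pi / 2 + of_int j * pi + pi / 4"
          using s by (simp_all add: u_def h_def field_simps)
        then have "\<bar>cos (real s * (u - h))\<bar> = sqrt 2 / 2" "\<bar>cos (real s * (u + h))\<bar> = sqrt 2 / 2"
          by (simp_all only: cosabs) (simp_all add: sin_45)
        then show "norm (Q (of_real (exp x') * cis (u - h))) \<le> C" "norm (Q (of_real (exp x') * cis (u + h))) \<le> C"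
          if "ln R' \<le> x'" for x'
          using that by (auto intro!: good')
        show "0 < h" "h \<le> pi / 4" using s by (auto simp: h_def divide_le_eq)
        have "\<bar>\<delta>\<bar> / real s \<le> pi / 4 / real s" using True by (intro divide_right_mono) auto
        then show "\<bar>\<delta> / real s\<bar> \<le> h" by (simp only: h_def abs_divide abs_of_nat)
        show "ln R' \<le> x" by (rule xR)
      qed
      moreover have "u + \<delta> / real s = \<theta>" using s th by (simp add: u_def field_simps)
      ultimately show ?thesis unfolding wp by simp
    qed
  qed
  define f where "f k = Q (1 / k)" for k
  define \<rho> where "\<rho> = 1 / R'"
  have \<rho>: "\<rho> > 0" using R' by (simp add: \<rho>_def)
  have large: "R' < norm (1 / k)" if "k \<in> ball 0 \<rho> - {0}" for k :: complex
  proof -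
    have k: "norm k < 1 / R'" "norm k > 0" using that by (auto simp: \<rho>_def)
    then have "R' < 1 / norm k" using R' by (simp add: pos_less_divide_eq mult.commute)
    then show ?thesis by (simp add: norm_divide)
  qed
  have hf: "f holomorphic_on ball 0 \<rho> - {0}"
  proof -
    have "(Q \<circ> (\<lambda>k. 1 / k)) holomorphic_on ball 0 \<rho> - {0}"
    proof (rule holomorphic_on_compose_gen[OF _ hol])
      show "(\<lambda>k. 1 / k) ` (ball 0 \<rho> - {0}) \<subseteq> {\<zeta> :: complex. R < norm \<zeta>}"
      proof (intro image_subsetI CollectI)
        fix k :: complex assume "k \<in> ball 0 \<rho> - {0}"
        from large[OF this] R'(2) show "R < norm (1 / k)" by linarith
      qed
    qed (auto intro!: holomorphic_intros)
    then show ?thesis by (simp add: f_def[abs_def] o_def)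
  qed
  have "eventually (\<lambda>k. norm (f k) \<le> C * exp (B * R')) (at 0)"
    unfolding eventually_at using large bdd \<rho> by (intro exI[of _ \<rho>]) (auto simp: f_def less_imp_le)
  then obtain g where g: "g holomorphic_on ball 0 \<rho>" "\<And>k. k \<in> ball 0 \<rho> - {0} \<Longrightarrow> g k = f k"
    using holomorphic_on_extend_bounded[OF hf] \<rho> by (auto simp: interior_open)
  have "g (1 / \<zeta>) = 0"
  proof (rule flat_at_zero[OF g(1) \<rho> c, where C = C])
    show "1 / \<zeta> \<in> ball 0 \<rho>" using R' by (simp add: \<rho>_def norm_divide frac_less2)
    fix x assume x: "0 < x" "x < \<rho>"
    then have "g (of_real x) = Q (of_real (1 / x) * cis 0)" by (subst g(2)) (auto simp: f_def)
    moreover have "norm (Q (of_real (1 / x) * cis 0)) \<le> C * exp (- c * (1 / x))"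
    proof (rule good)
      have "R' < 1 / x" using x R' by (simp add: \<rho>_def field_simps)
      then show "R < 1 / x" using R' by simp
      have "sqrt 2 \<le> (2::real)" by (rule real_le_lsqrt) auto
      then show "sqrt 2 / 2 \<le> \<bar>cos (real s * 0)\<bar>" by simp
    qed
    ultimately show "norm (g (of_real x)) \<le> C * exp (- c / x)" by simp
  qed
  moreover have "1 / \<zeta> \<in> ball 0 \<rho> - {0}"
    using R' by (auto simp: \<rho>_def norm_divide frac_less2)
  ultimately have "f (1 / \<zeta>) = 0" using g(2) by metis
  then show ?thesis by (simp add: f_def)
qed

section \<open>Reflectionless operators\<close>

lemma geometric_limit:
  fixes X :: "nat \<Rightarrow> 'a::banach"
  assumes step: "\<And>N. N \<ge> N0 \<Longrightarrow> norm (X (Suc N) - X N) \<le> C * p ^ N" and p: "0 < p" "p < 1"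
  shows "X \<longlonglongrightarrow> lim X" and "N \<ge> N0 \<Longrightarrow> norm (lim X - X N) \<le> C / (1 - p) * p ^ N"
proof -
  have tail: "(\<lambda>i. X (Suc (i + N)) - X (i + N)) sums (lim X - X N)
      \<and> X \<longlonglongrightarrow> lim X \<and> norm (lim X - X N) \<le> C / (1 - p) * p ^ N" if N: "N \<ge> N0" for N
  proof -
    have le: "norm (X (Suc (i + N)) - X (i + N)) \<le> C * p ^ N * p ^ i" for i
      using step[of "i + N"] N by (simp add: power_add mult_ac)
    have sg: "summable (\<lambda>i. C * p ^ N * p ^ i)" using p by (intro summable_mult summable_geometric) auto
    have sm: "summable (\<lambda>i. X (Suc (i + N)) - X (i + N))"
      by (rule summable_comparison_test'[OF sg]) (rule le)
    then have "(\<lambda>n. X (0 + N) + (\<Sum>i<n. X (Suc (i + N)) - X (i + N))) \<longlonglongrightarrow> X (0 + N) + (\<Sum>i. X (Suc (i + N)) - X (i + N))"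
      by (intro tendsto_add tendsto_const summable_LIMSEQ)
    then have "(\<lambda>n. X (n + N)) \<longlonglongrightarrow> X N + (\<Sum>i. X (Suc (i + N)) - X (i + N))"
      using sum_lessThan_telescope[of "\<lambda>i. X (i + N)"] by simp
    then have lim: "X \<longlonglongrightarrow> X N + (\<Sum>i. X (Suc (i + N)) - X (i + N))"
      by (rule LIMSEQ_offset)
    then have L: "lim X = X N + (\<Sum>i. X (Suc (i + N)) - X (i + N))" by (rule limI)
    have "norm (\<Sum>i. X (Suc (i + N)) - X (i + N)) \<le> (\<Sum>i. C * p ^ N * p ^ i)"
      by (rule norm_suminf_le[OF le sg])
    also have "\<dots> = C * p ^ N * (1 / (1 - p))"
      using p by (subst suminf_mult) (auto intro!: summable_geometric simp: suminf_geometric)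
    finally show ?thesis using lim sm by (simp add: L summable_sums)
  qed
  show "X \<longlonglongrightarrow> lim X" using tail[of N0] by simp
  show "norm (lim X - X N) \<le> C / (1 - p) * p ^ N" if "N \<ge> N0" using tail[OF that] by simp
qed

text \<open>Going left, a three-term recursion loses only a fixed exponential factor
  \<open>L\<close> per step. Data at \<open>N\<close> that are smaller than every exponential
  therefore stay negligible at a fixed site.\<close>

lemma backward_bound:
  fixes u :: "int \<Rightarrow> complex"
  assumes rec: "\<And>n. lo < n \<Longrightarrow> n \<le> N \<Longrightarrow> u (n - 1) = \<alpha> n * u n + \<beta> n * u (n + 1)"
    and \<alpha>: "\<And>n. lo < n \<Longrightarrow> n \<le> N \<Longrightarrow> norm (\<alpha> n) \<le> L / 2"
    and \<beta>: "\<And>n. lo < n \<Longrightarrow> n \<le> N \<Longrightarrow> norm (\<beta> n) \<le> L / 2"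
    and L: "L \<ge> 1" and init: "norm (u N) \<le> D" "norm (u (N + 1)) \<le> D"
    and n: "lo \<le> n" "n \<le> N"
  shows "norm (u n) \<le> L ^ nat (N - n) * D"
proof -
  have D: "D \<ge> 0" using init(1) by (meson norm_ge_zero order_trans)
  have "norm (u (N - int i)) \<le> L ^ i * D \<and> norm (u (N - int i + 1)) \<le> L ^ i * D" if "lo \<le> N - int i" for i
    using that
  proof (induction i)
    case 0
    then show ?case using init by simp
  next
    case (Suc i)
    then have IH: "norm (u (N - int i)) \<le> L ^ i * D" "norm (u (N - int i + 1)) \<le> L ^ i * D" by auto
    let ?n = "N - int i"
    have "u (?n - 1) = \<alpha> ?n * u ?n + \<beta> ?n * u (?n + 1)" using Suc.prems by (intro rec) auto
    then have "norm (u (?n - 1)) \<le> norm (\<alpha> ?n) * norm (u ?n) + norm (\<beta> ?n) * norm (u (?n + 1))"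
      by (metis norm_mult norm_triangle_ineq)
    also have "\<dots> \<le> L / 2 * (L ^ i * D) + L / 2 * (L ^ i * D)"
      using Suc.prems L by (intro add_mono mult_mono \<alpha> \<beta> IH) auto
    finally have "norm (u (?n - 1)) \<le> L ^ Suc i * D" by (simp add: field_simps)
    moreover have "L ^ i * D \<le> L ^ Suc i * D"
      using L D by (intro mult_right_mono power_increasing) auto
    ultimately show ?case using IH(1) by (simp add: algebra_simps)
  qed
  from this[of "nat (N - n)"] show ?thesis using n by simp
qed

text \<open>Index \<open>j\<close> stands for the site \<open>N + 1 - j\<close>, so the recursion
  runs to the left from its two starting values at \<open>N + 1\<close> and
  \<open>N\<close>.\<close>

fun jost_back :: "(int \<Rightarrow> real) \<Rightarrow> (int \<Rightarrow> real) \<Rightarrow> real \<Rightarrow> real \<Rightarrow> int \<Rightarrow> complex \<Rightarrow> nat \<Rightarrow> complex"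
  where "jost_back a b a0 b0 N \<zeta> 0 = 1"
  | "jost_back a b a0 b0 N \<zeta> (Suc 0) = 1"
  | "jost_back a b a0 b0 N \<zeta> (Suc (Suc j)) =
      ((of_real a0 * (1 + \<zeta> ^ 2) + of_real (b0 - b (N - int j)) * \<zeta>) * jost_back a b a0 b0 N \<zeta> (Suc j)
        - of_real (a (N - int j)) * \<zeta> ^ 2 * jost_back a b a0 b0 N \<zeta> j) / of_real (a (N - int j - 1))"

text \<open>\<open>\<zeta> powi n * jost_approx a b a0 b0 N n \<zeta>\<close> solves the eigenvalue equation and equals
  \<open>\<zeta> powi n\<close> at the sites \<open>N\<close> and \<open>N + 1\<close>; with the power of \<open>\<zeta>\<close> factored out it is a polynomial
  in \<open>\<zeta>\<close>, so that the limit \<open>jost\<close> is entire.\<close>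

definition jost_approx :: "(int \<Rightarrow> real) \<Rightarrow> (int \<Rightarrow> real) \<Rightarrow> real \<Rightarrow> real \<Rightarrow> nat \<Rightarrow> int \<Rightarrow> complex \<Rightarrow> complex"
  where "jost_approx a b a0 b0 N n \<zeta> = jost_back a b a0 b0 (int N) \<zeta> (nat (int N + 1 - n))"

definition jost :: "(int \<Rightarrow> real) \<Rightarrow> (int \<Rightarrow> real) \<Rightarrow> real \<Rightarrow> real \<Rightarrow> int \<Rightarrow> complex \<Rightarrow> complex"
  where "jost a b a0 b0 n \<zeta> = lim (\<lambda>N. jost_approx a b a0 b0 N n \<zeta>)"

lemma jost_approx_top: "jost_approx a b a0 b0 N (int N) \<zeta> = 1" "jost_approx a b a0 b0 N (int N + 1) \<zeta> = 1"
  by (simp_all add: jost_approx_def)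

lemma jost_approx_rec:
  assumes "n \<le> int N"
  shows "jost_approx a b a0 b0 N (n - 1) \<zeta> =
    ((of_real a0 * (1 + \<zeta> ^ 2) + of_real (b0 - b n) * \<zeta>) * jost_approx a b a0 b0 N n \<zeta>
      - of_real (a n) * \<zeta> ^ 2 * jost_approx a b a0 b0 N (n + 1) \<zeta>) / of_real (a (n - 1))"
proof -
  define j where "j = nat (int N - n)"
  have n: "n = int N - int j" using assms by (simp add: j_def)
  have "nat (int N + 1 - (n - 1)) = Suc (Suc j)" "nat (int N + 1 - n) = Suc j" "nat (int N + 1 - (n + 1)) = j"
    using assms by (auto simp: j_def)
  then show ?thesis unfolding jost_approx_def by (simp add: n)
qed

lemma jost_approx_holomorphic: "jost_approx a b a0 b0 N n holomorphic_on S"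
proof -
  have "(\<lambda>\<zeta>. jost_back a b a0 b0 N' \<zeta> j) holomorphic_on S \<and> (\<lambda>\<zeta>. jost_back a b a0 b0 N' \<zeta> (Suc j)) holomorphic_on S" for N' j
  proof (induction j)
    case 0
    then show ?case by simp
  next
    case (Suc j)
    then show ?case
      unfolding jost_back.simps(3) divide_inverse by (auto intro!: holomorphic_intros)
  qed
  then show ?thesis unfolding jost_approx_def[abs_def] by blast
qed

section \<open>Jost solutions as entire functions of the spectral parameter\<close>

locale jacobi_tail =
  fixes a b :: "int \<Rightarrow> real" and M a0 b0 :: real
  assumes a_bound: "\<And>n. \<bar>a n\<bar> \<le> M" and b_bound: "\<And>n. \<bar>b n\<bar> \<le> M"
    and a0_pos: "a0 > 0" and a0_bound: "a0 \<le> M" and b0_bound: "\<bar>b0\<bar> \<le> M"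
    and a_nz: "\<And>n. a n \<noteq> 0" and decay: "rapid_decay a b a0 b0"
begin

abbreviation E where "E \<equiv> jost a b a0 b0"
abbreviation q where "q \<equiv> jost_approx a b a0 b0"
abbreviation tail :: "int \<Rightarrow> real \<Rightarrow> bool" where "tail \<equiv> tail_bound a b a0 b0"

lemma M_pos: "M > 0"
  using a0_pos a0_bound by linarith

lemma tail_trivial: "tail n (2 * M)"
  unfolding tail_bound_def
proof (intro allI impI)
  fix j
  show "\<bar>a j - a0\<bar> \<le> 2 * M \<and> \<bar>b j - b0\<bar> \<le> 2 * M"
    using a_bound[of j] b_bound[of j] a0_pos a0_bound b0_bound by linarith
qed

lemma tail_mono: "tail n D \<Longrightarrow> n \<le> m \<Longrightarrow> D \<le> D' \<Longrightarrow> tail m D'"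
  unfolding tail_bound_def by (meson order_trans)

lemma tail_shift:
  assumes p: "0 < p" "p < 1"
  obtains K where "K \<ge> 0" "\<And>i. tail (n + int i) (K * p ^ i)"
proof -
  obtain K0 where K0: "\<And>n. tail (int n) (K0 * p ^ n)"
    using decay p unfolding rapid_decay_def by blast
  have K00: "K0 \<ge> 0" using tail_bound_nonneg[OF K0[of 0]] by simp
  define d where "d = nat (- n)"
  define K where "K = (2 * M + K0) / p ^ d"
  have pd: "p ^ d > 0" "p ^ d \<le> 1" using p by (auto intro: power_le_one)
  have "tail (n + int i) (K * p ^ i)" for i
  proof (cases "i < d")
    case True
    have "p ^ d \<le> p ^ i" using True p by (intro power_decreasing) auto
    then have "(2 * M + K0) * 1 \<le> (2 * M + K0) * (p ^ i / p ^ d)"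
      using M_pos K00 pd by (intro mult_left_mono) auto
    then have "2 * M \<le> K * p ^ i" using K00 by (simp add: K_def)
    then show ?thesis by (rule tail_mono[OF tail_trivial order_refl])
  next
    case False
    have le: "int (i - d) \<le> n + int i" using False by (auto simp: d_def)
    have pi: "p ^ i = p ^ (i - d) * p ^ d" using False by (simp add: power_add[symmetric])
    have "K * p ^ i = (2 * M + K0) * p ^ (i - d)" unfolding pi K_def using p by simp
    also have "\<dots> \<ge> K0 * p ^ (i - d)" using M_pos p by (intro mult_right_mono) auto
    finally show ?thesis using tail_mono[OF K0 le] by blast
  qed
  moreover have "K \<ge> 0" using M_pos K00 pd by (simp add: K_def)
  ultimately show thesis using that by blast
qed

text \<open>To the right of \<open>n0\<close> all but finitely many \<open>a j\<close> are within
  \<open>a0 / 2\<close> of \<open>a0\<close>, and the remaining ones are nonzero. This makes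
  division by \<open>a j\<close> uniformly harmless in the leftward recursions.\<close>

lemma a_lower: obtains m where "m > 0" "\<And>j. j \<ge> n0 \<Longrightarrow> m \<le> \<bar>a j\<bar>"
proof -
  obtain K where K: "K \<ge> 0" "\<And>i. tail (n0 + int i) (K * (1 / 2) ^ i)"
    using tail_shift[of "1 / 2" n0] by auto
  have "(\<lambda>i. K * (1 / 2) ^ i) \<longlonglongrightarrow> K * 0" by (intro tendsto_intros LIMSEQ_power_zero) auto
  then have "\<forall>\<^sub>F i in sequentially. K * (1 / 2) ^ i < a0 / 2" using a0_pos by (intro order_tendstoD) auto
  then obtain i where i: "K * (1 / 2) ^ i < a0 / 2" by (auto simp: eventually_sequentially)
  define S where "S = insert (a0 / 2) ((\<lambda>j. \<bar>a j\<bar>) ` {n0..n0 + int i})"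
  have S: "finite S" "S \<noteq> {}" by (auto simp: S_def)
  have "Min S > 0" using S a_nz a0_pos by (auto simp: S_def)
  moreover have "Min S \<le> \<bar>a j\<bar>" if "j \<ge> n0" for j
  proof (cases "j \<le> n0 + int i")
    case True
    then show ?thesis using that S by (intro Min_le) (auto simp: S_def)
  next
    case False
    then have "\<bar>a j - a0\<bar> \<le> K * (1 / 2) ^ i" using K(2)[of i] by (auto simp: tail_bound_def)
    then have "a0 / 2 \<le> \<bar>a j\<bar>" using i by linarith
    moreover have "Min S \<le> a0 / 2" using S by (intro Min_le) (auto simp: S_def)
    ultimately show ?thesis by linarith
  qed
  ultimately show thesis using that by blast
qed

lemma jost_approx_step:
  assumes p: "0 < p" "p < 1" and \<rho>: "\<rho> \<ge> 0"
  obtains C where "\<And>\<zeta> N n. norm \<zeta> \<le> \<rho> \<Longrightarrow> n0 \<le> n \<Longrightarrow> n \<le> int N \<Longrightarrow> norm (q (Suc N) n \<zeta> - q N n \<zeta>) \<le> C * p ^ N"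
proof -
  obtain m where m: "m > 0" "\<And>j. j \<ge> n0 \<Longrightarrow> m \<le> \<bar>a j\<bar>" using a_lower by blast
  define A where "A = M * (1 + \<rho> ^ 2) + 2 * M * \<rho>"
  define L where "L = 2 * (A / m + 1)"
  have A0: "A \<ge> 0" using M_pos \<rho> by (simp add: A_def)
  have L: "L \<ge> 2" using A0 m by (simp add: L_def)
  \<comment> \<open>The recursion amplifies by at most \<open>L\<close> per step over about
    \<open>N\<close> steps; a tail of order \<open>p' ^ N\<close> with \<open>p' = p / L\<close>
    leaves \<open>p ^ N\<close>.\<close>
  define p' where "p' = p / L"
  have p': "0 < p'" "p' < 1" using p L by (auto simp: p'_def divide_less_eq)
  obtain K where K: "\<And>n. tail (int n) (K * p' ^ n)"
    using decay p' unfolding rapid_decay_def by blast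
  have K0: "K \<ge> 0" using tail_bound_nonneg[OF K[of 0]] by simp
  define B where "B = (1 + \<rho> + \<rho> ^ 2) / m"
  have B0: "B \<ge> 0" using \<rho> m by (simp add: B_def)
  define C where "C = L ^ nat (- n0) * (K * B)"
  have "norm (q (Suc N) n \<zeta> - q N n \<zeta>) \<le> C * p ^ N" if \<zeta>: "norm \<zeta> \<le> \<rho>" and n: "n0 \<le> n" "n \<le> int N" for \<zeta> N n
  proof -
    \<comment> \<open>Both approximants solve the same recursion at sites up to \<open>N\<close>,
      hence so does their difference, with value 0 at \<open>N + 1\<close> and a value of the size
      of the tail at \<open>N\<close>.\<close>
    define u where "u n = q (Suc N) n \<zeta> - q N n \<zeta>" for n
    define \<alpha> where "\<alpha> n = (of_real a0 * (1 + \<zeta> ^ 2) + of_real (b0 - b n) * \<zeta>) / of_real (a (n - 1))" for n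
    define \<beta> where "\<beta> n = - (of_real (a n) * \<zeta> ^ 2) / of_real (a (n - 1))" for n
    have z2: "norm (\<zeta> ^ 2) \<le> \<rho> ^ 2" using \<zeta> by (simp add: norm_power power_mono)
    have quot: "norm (x / of_real (a j)) \<le> X / m" if "norm x \<le> X" "j \<ge> n0" for x :: complex and X j
      unfolding norm_divide norm_of_real using that m m(2)[OF that(2)] order_trans[OF norm_ge_zero that(1)]
      by (intro frac_le) auto
    have "norm (u n) \<le> L ^ nat (int N - n) * (K * p' ^ N * B)"
    proof (rule backward_bound[where u = u and N = "int N" and lo = n0 and \<alpha> = \<alpha> and \<beta> = \<beta>
          and n = n and L = L and D = "K * p' ^ N * B"])
      fix n assume n: "n0 < n" "n \<le> int N"
      show "u (n - 1) = \<alpha> n * u n + \<beta> n * u (n + 1)"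
        using n jost_approx_rec[of n N a b a0 b0 \<zeta>] jost_approx_rec[of n "Suc N" a b a0 b0 \<zeta>]
        by (simp add: u_def \<alpha>_def \<beta>_def diff_divide_distrib[symmetric] add_divide_distrib[symmetric] algebra_simps)
      have n1: "n - 1 \<ge> n0" using n by simp
      have "norm (of_real a0 * (1 + \<zeta> ^ 2)) \<le> M * (1 + \<rho> ^ 2)"
        unfolding norm_mult using a0_pos a0_bound M_pos z2 norm_triangle_ineq[of 1 "\<zeta> ^ 2"]
        by (intro mult_mono) auto
      moreover have "norm (of_real (b0 - b n) * \<zeta>) \<le> 2 * M * \<rho>"
        unfolding norm_mult norm_of_real using b0_bound b_bound[of n] M_pos \<zeta>
        by (intro mult_mono) (auto simp: abs_le_iff)
      ultimately have "norm (of_real a0 * (1 + \<zeta> ^ 2) + of_real (b0 - b n) * \<zeta>) \<le> A"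
        unfolding A_def by (rule norm_triangle_mono)
      then have "norm (\<alpha> n) \<le> A / m" unfolding \<alpha>_def using n1 by (rule quot)
      then show "norm (\<alpha> n) \<le> L / 2" by (simp add: L_def)
      have "norm (- (of_real (a n) * \<zeta> ^ 2)) \<le> M * \<rho> ^ 2"
        unfolding norm_minus_cancel norm_mult norm_of_real using a_bound z2 M_pos by (intro mult_mono) auto
      also have "\<dots> \<le> A" using M_pos \<rho> by (simp add: A_def algebra_simps)
      finally have "norm (\<beta> n) \<le> A / m" unfolding \<beta>_def using n1 by (rule quot)
      then show "norm (\<beta> n) \<le> L / 2" by (simp add: L_def)
    next
      show "1 \<le> L" using L by simp
      have "u (int N + 1) = 0"
        using jost_approx_top[of a b a0 b0 "Suc N" \<zeta>] jost_approx_top[of a b a0 b0 N \<zeta>] by (simp add: u_def add.commute)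
      then show "norm (u (int N + 1)) \<le> K * p' ^ N * B" using K0 p' B0 by simp
      have "q (Suc N) (int N) \<zeta> = (of_real a0 * (1 + \<zeta> ^ 2) + of_real (b0 - b (int N + 1)) * \<zeta> - of_real (a (int N + 1)) * \<zeta> ^ 2) / of_real (a (int N))"
        using jost_approx_rec[of "int N + 1" "Suc N" a b a0 b0 \<zeta>] jost_approx_top[of a b a0 b0 "Suc N" \<zeta>]
        by (simp add: add.commute)
      then have uN: "u (int N) = (of_real (a0 - a (int N)) + of_real (b0 - b (int N + 1)) * \<zeta> + of_real (a0 - a (int N + 1)) * \<zeta> ^ 2) / of_real (a (int N))"
        using a_nz[of "int N"] by (simp add: u_def jost_approx_top field_simps)
      let ?D = "K * p' ^ N"
      have d: "\<bar>a0 - a (int N)\<bar> \<le> ?D" "\<bar>b0 - b (int N + 1)\<bar> \<le> ?D" "\<bar>a0 - a (int N + 1)\<bar> \<le> ?D"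
        using K[of N] by (auto simp: tail_bound_def abs_minus_commute)
      have D0: "?D \<ge> 0" using K0 p' by simp
      have "norm (of_real (a0 - a (int N)) + of_real (b0 - b (int N + 1)) * \<zeta> + of_real (a0 - a (int N + 1)) * \<zeta> ^ 2)
        \<le> ?D + ?D * \<rho> + ?D * \<rho> ^ 2"
      proof (intro norm_triangle_mono)
        show "norm (of_real (a0 - a (int N)) :: complex) \<le> ?D" unfolding norm_of_real by (rule d)
        show "norm (of_real (b0 - b (int N + 1)) * \<zeta>) \<le> ?D * \<rho>"
          unfolding norm_mult norm_of_real using d D0 \<zeta> by (intro mult_mono) auto
        show "norm (of_real (a0 - a (int N + 1)) * \<zeta> ^ 2) \<le> ?D * \<rho> ^ 2"
          unfolding norm_mult norm_of_real using d D0 z2 by (intro mult_mono) auto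
      qed
      from quot[OF this, of "int N"] n show "norm (u (int N)) \<le> K * p' ^ N * B"
        by (simp add: uN B_def distrib_left)
    qed (use n in auto)
    also have "\<dots> \<le> L ^ (N + nat (- n0)) * (K * p' ^ N * B)"
      using n L K0 B0 p' by (intro mult_right_mono power_increasing mult_nonneg_nonneg) auto
    also have "\<dots> = C * (L * p') ^ N" by (simp add: C_def power_add power_mult_distrib mult_ac)
    also have "L * p' = p" using L by (simp add: p'_def)
    finally show ?thesis by (simp add: u_def)
  qed
  then show thesis using that by blast
qed

lemma jost_limit: "(\<lambda>N. q N n \<zeta>) \<longlonglongrightarrow> E n \<zeta>"
proof -
  obtain C where "\<And>\<zeta>' N m. norm \<zeta>' \<le> norm \<zeta> \<Longrightarrow> n \<le> m \<Longrightarrow> m \<le> int N \<Longrightarrow> norm (q (Suc N) m \<zeta>' - q N m \<zeta>') \<le> C * (1 / 2) ^ N"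
    using jost_approx_step[of "1 / 2" "norm \<zeta>" n] by auto
  then have "norm (q (Suc N) n \<zeta> - q N n \<zeta>) \<le> C * (1 / 2) ^ N" if "N \<ge> nat n" for N
    using that by auto
  then show ?thesis unfolding jost_def by (rule geometric_limit(1)) auto
qed

lemma jost_approx_error:
  assumes p: "0 < p" "p < 1" and \<rho>: "\<rho> \<ge> 0"
  obtains C where "\<And>\<zeta> N n. norm \<zeta> \<le> \<rho> \<Longrightarrow> n0 \<le> n \<Longrightarrow> n \<le> int N \<Longrightarrow> norm (E n \<zeta> - q N n \<zeta>) \<le> C * p ^ N"
proof -
  obtain C where C: "\<And>\<zeta> N n. norm \<zeta> \<le> \<rho> \<Longrightarrow> n0 \<le> n \<Longrightarrow> n \<le> int N \<Longrightarrow> norm (q (Suc N) n \<zeta> - q N n \<zeta>) \<le> C * p ^ N"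
    using jost_approx_step[OF assms] by blast
  have "norm (E n \<zeta> - q N n \<zeta>) \<le> C / (1 - p) * p ^ N" if "norm \<zeta> \<le> \<rho>" "n0 \<le> n" "n \<le> int N" for \<zeta> N n
    unfolding jost_def
  proof (rule geometric_limit(2)[OF _ p])
    show "norm (q (Suc N) n \<zeta> - q N n \<zeta>) \<le> C * p ^ N" if "N \<ge> nat n" for N
      using \<open>norm \<zeta> \<le> \<rho>\<close> \<open>n0 \<le> n\<close> that by (intro C) auto
    show "nat n \<le> N" using that by simp
  qed
  then show thesis using that by blast
qed

lemma jost_near_1:
  assumes p: "0 < p" "p < 1"
  obtains C where "\<And>N. norm (E (int N) \<zeta> - 1) \<le> C * p ^ N"
proof -
  obtain C where C: "\<And>\<zeta>' N n. norm \<zeta>' \<le> norm \<zeta> \<Longrightarrow> 0 \<le> n \<Longrightarrow> n \<le> int N \<Longrightarrow> norm (E n \<zeta>' - q N n \<zeta>') \<le> C * p ^ N"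
    using jost_approx_error[OF p, of "norm \<zeta>" 0] by auto
  show thesis
  proof (rule that)
    show "norm (E (int N) \<zeta> - 1) \<le> C * p ^ N" for N
      using C[of \<zeta> "int N" N] by (simp add: jost_approx_top)
  qed
qed

lemma jost_holomorphic: "E n holomorphic_on UNIV"
proof (rule holomorphic_uniform_sequence[OF open_UNIV])
  show "q N n holomorphic_on UNIV" for N by (rule jost_approx_holomorphic)
  fix x :: complex
  obtain C where C: "\<And>\<zeta> N m. norm \<zeta> \<le> norm x + 1 \<Longrightarrow> n \<le> m \<Longrightarrow> m \<le> int N \<Longrightarrow> norm (E m \<zeta> - q N m \<zeta>) \<le> C * (1 / 2) ^ N"
    using jost_approx_error[of "1 / 2" "norm x + 1" n] by auto
  have "uniform_limit (cball x 1) (\<lambda>N. q N n) (E n) sequentially"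
    unfolding uniform_limit_iff
  proof (intro allI impI)
    fix e :: real assume e: "e > 0"
    have "(\<lambda>N. C * (1 / 2) ^ N) \<longlonglongrightarrow> C * 0" by (intro tendsto_intros LIMSEQ_power_zero) auto
    then have "\<forall>\<^sub>F N in sequentially. C * (1 / 2) ^ N < e" using e by (intro order_tendstoD) auto
    moreover have "\<forall>\<^sub>F N in sequentially. N \<ge> nat n" by (rule eventually_ge_at_top)
    ultimately show "\<forall>\<^sub>F N in sequentially. \<forall>\<zeta>\<in>cball x 1. dist (q N n \<zeta>) (E n \<zeta>) < e"
    proof eventually_elim
      case (elim N)
      show ?case
      proof
        fix \<zeta> assume "\<zeta> \<in> cball x 1"
        then have "norm \<zeta> \<le> norm x + 1" using norm_triangle_sub[of \<zeta> x] by (simp add: dist_norm norm_minus_commute)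
        moreover have "n \<le> int N" using elim by simp
        ultimately have "norm (E n \<zeta> - q N n \<zeta>) \<le> C * (1 / 2) ^ N" by (intro C) auto
        then show "dist (q N n \<zeta>) (E n \<zeta>) < e"
          using elim by (simp add: dist_norm norm_minus_commute)
      qed
    qed
  qed
  then show "\<exists>d>0. cball x d \<subseteq> UNIV \<and> uniform_limit (cball x d) (\<lambda>N. q N n) (E n) sequentially"
    by (intro exI[of _ 1]) auto
qed

lemma jost_rec:
  "of_real (a (n - 1)) * E (n - 1) \<zeta>
    = (of_real a0 * (1 + \<zeta> ^ 2) + of_real (b0 - b n) * \<zeta>) * E n \<zeta> - of_real (a n) * \<zeta> ^ 2 * E (n + 1) \<zeta>"
proof -
  let ?r = "\<lambda>N. (of_real a0 * (1 + \<zeta> ^ 2) + of_real (b0 - b n) * \<zeta>) * q N n \<zeta> - of_real (a n) * \<zeta> ^ 2 * q N (n + 1) \<zeta>"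
  have lim: "?r \<longlonglongrightarrow> (of_real a0 * (1 + \<zeta> ^ 2) + of_real (b0 - b n) * \<zeta>) * E n \<zeta> - of_real (a n) * \<zeta> ^ 2 * E (n + 1) \<zeta>"
    by (intro tendsto_intros jost_limit)
  have lim': "(\<lambda>N. of_real (a (n - 1)) * q N (n - 1) \<zeta>) \<longlonglongrightarrow> of_real (a (n - 1)) * E (n - 1) \<zeta>"
    by (intro tendsto_intros jost_limit)
  have "\<forall>\<^sub>F N in sequentially. of_real (a (n - 1)) * q N (n - 1) \<zeta> = ?r N"
    using eventually_ge_at_top[of "nat n"]
  proof eventually_elim
    case (elim N)
    then have "n \<le> int N" by simp
    from jost_approx_rec[OF this] show ?case using a_nz[of "n - 1"] by simp
  qed
  from LIMSEQ_unique[OF Lim_transform_eventually[OF lim' this] lim] show ?thesis .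
qed

text \<open>With constant \<open>E\<close> the recursion \<open>jost_rec\<close> is a polynomial
  identity in \<zeta>, and the values 0, 1, -1 separate its three coefficients. The linear one gives
  \<open>b n = b0\<close>; the other two express \<open>e (n + 1)\<close> through \<open>e n\<close>
  in two ways, which determines the square of \<open>a n\<close>.\<close>

lemma trivial_if_jost_constant:
  assumes const: "\<And>n \<zeta>. E n \<zeta> = E n 0"
  shows "\<bar>a n\<bar> = a0 \<and> b n = b0"
proof -
  define e where "e n = E n 0" for n
  have E: "E n \<zeta> = e n" for n \<zeta> using const by (simp add: e_def)
  have r0: "of_real (a (n - 1)) * e (n - 1) = of_real a0 * e n" for n
    using jost_rec[of n 0] by (simp add: E)
  have r1: "of_real (a (n - 1)) * e (n - 1) = (of_real a0 * 2 + of_real (b0 - b n)) * e n - of_real (a n) * e (n + 1)" for n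
    using jost_rec[of n 1] by (simp add: E)
  have r2: "of_real (a (n - 1)) * e (n - 1) = (of_real a0 * 2 - of_real (b0 - b n)) * e n - of_real (a n) * e (n + 1)" for n
    using jost_rec[of n "-1"] by (simp add: E)
  \<comment> \<open>By \<open>r0\<close> a zero of \<open>e\<close> would propagate to all sites
    further right, contradicting \<open>jost_near_1\<close>.\<close>
  have nz: "e n \<noteq> 0" for n
  proof
    assume "e n = 0"
    then have z: "e (n + int i) = 0" for i
    proof (induction i)
      case (Suc i)
      then show ?case using r0[of "n + int (Suc i)"] a0_pos by (simp add: algebra_simps)
    qed simp
    obtain C where C: "\<And>N. norm (E (int N) 0 - 1) \<le> C * (1 / 2) ^ N" using jost_near_1[of "1 / 2" 0] by auto
    have "(\<lambda>N. C * (1 / 2) ^ N) \<longlonglongrightarrow> C * 0" by (intro tendsto_intros LIMSEQ_power_zero) auto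
    then have "\<forall>\<^sub>F N in sequentially. C * (1 / 2) ^ N < 1" by (intro order_tendstoD) auto
    moreover have "\<forall>\<^sub>F N in sequentially. N \<ge> nat n" by (rule eventually_ge_at_top)
    ultimately have "\<forall>\<^sub>F N in sequentially. False"
    proof eventually_elim
      case (elim N)
      have "n \<le> int N" using elim by simp
      then have "e (int N) = 0" using z[of "nat (int N - n)"] by simp
      then show ?case using C[of N] elim by (simp add: E)
    qed
    then show False by simp
  qed
  have "d * x = 0" if "w = (h + d) * x - y" "w = (h - d) * x - y" for d x y w h :: complex
    using that by algebra
  from this[OF r1 r2] have "of_real (b0 - b n) * e n = 0" .
  then have b: "b n = b0" using nz[of n] by simp
  have r3: "of_real a0 * e n = of_real (a n) * e (n + 1)"
    using r0[of n] r1[of n] b by (simp add: algebra_simps)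
  have r4: "of_real (a n) * e n = of_real a0 * e (n + 1)" using r0[of "n + 1"] by simp
  have "(of_real (a n) * of_real (a n)) * e n = of_real (a n) * (of_real (a n) * e n)"
    by (rule mult.assoc)
  also have "\<dots> = of_real a0 * (of_real (a n) * e (n + 1))"
    unfolding r4 by (rule mult.left_commute)
  also have "\<dots> = (of_real a0 * of_real a0) * e n"
    unfolding r3[symmetric] by (rule mult.assoc[symmetric])
  finally have "(of_real (a n) * of_real (a n)) * e n = (of_real a0 * of_real a0) * e n" .
  then have "(of_real (a n * a n) :: complex) = of_real (a0 * a0)" using nz[of n] by simp
  then have "(a n)\<^sup>2 = a0\<^sup>2" by (simp only: of_real_eq_iff power2_eq_square)
  then have "\<bar>a n\<bar> = a0" using a0_pos unfolding power2_eq_iff by auto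
  then show ?thesis using b by simp
qed

text \<open>By \<open>backward_bound\<close> the value at \<open>n\<close> is at most
  \<open>L ^ N\<close> times the data at \<open>N\<close>, up to a constant. The choice
  \<open>p = 1 / (2 * L)\<close> leaves \<open>(1 / 2) ^ N\<close>, which tends to 0.\<close>

lemma backward_zero:
  fixes u :: "int \<Rightarrow> complex" and z :: complex
  assumes eq: "\<And>n. of_real (a n) * u (n + 1) + of_real (a (n - 1)) * u (n - 1) + of_real (b n) * u n = z * u n"
    and small: "\<And>p. 0 < p \<Longrightarrow> p < 1 \<Longrightarrow> \<exists>C. \<forall>N. norm (u (int N)) \<le> C * p ^ N"
  shows "u n = 0"
proof -
  obtain m where m: "m > 0" "\<And>j. j \<ge> n \<Longrightarrow> m \<le> \<bar>a j\<bar>" using a_lower by blast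
  define L where "L = 2 * ((norm z + M) / m + 1)"
  have "L / 2 = (norm z + M) / m + 1" unfolding L_def by (rule nonzero_mult_div_cancel_left) simp
  then have LQ: "(norm z + M) / m \<le> L / 2" by linarith
  have L: "L \<ge> 2" using m M_pos by (simp add: L_def)
  define p where "p = 1 / (2 * L)"
  have p: "0 < p" "p < 1" using L by (auto simp: p_def divide_less_eq)
  obtain C where C: "\<And>N. norm (u (int N)) \<le> C * p ^ N" using small[OF p] by blast
  have C0: "C \<ge> 0" using C[of 0] by (simp add: order_trans[OF norm_ge_zero])
  have "norm (u n) \<le> L ^ nat (- n) * C * (1 / 2) ^ N" if N: "n \<le> int N" for N
  proof -
    have quot: "norm (x / of_real (a j)) \<le> (norm z + M) / m" if "norm x \<le> norm z + M" "j \<ge> n" for x :: complex and j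
      unfolding norm_divide norm_of_real using that m m(2)[OF that(2)] M_pos by (intro frac_le) auto
    have "norm (u n) \<le> L ^ nat (int N - n) * (C * p ^ N)"
    proof (rule backward_bound[where u = u and N = "int N" and lo = n and \<alpha> = "\<lambda>n. (z - of_real (b n)) / of_real (a (n - 1))"
          and \<beta> = "\<lambda>n. - of_real (a n) / of_real (a (n - 1))" and n = n and L = L and D = "C * p ^ N"])
      fix j assume j: "n < j" "j \<le> int N"
      show "u (j - 1) = (z - of_real (b j)) / of_real (a (j - 1)) * u j + - of_real (a j) / of_real (a (j - 1)) * u (j + 1)"
      proof -
        have "of_real (a (j - 1)) * u (j - 1) = (z - of_real (b j)) * u j - of_real (a j) * u (j + 1)"
          using eq[of j] by (simp add: algebra_simps)
        then have "u (j - 1) = ((z - of_real (b j)) * u j - of_real (a j) * u (j + 1)) / of_real (a (j - 1))"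
          using a_nz[of "j - 1"] by (simp add: nonzero_eq_divide_eq mult.commute)
        then show ?thesis by (simp add: diff_divide_distrib left_diff_distrib)
      qed
      have "norm (z - of_real (b j)) \<le> norm z + M"
        using norm_triangle_ineq4[of z "of_real (b j)"] b_bound[of j] by simp
      then have "norm ((z - of_real (b j)) / of_real (a (j - 1))) \<le> (norm z + M) / m" using j by (intro quot) auto
      then show "norm ((z - of_real (b j)) / of_real (a (j - 1))) \<le> L / 2" using LQ by (rule order_trans)
      have "norm (- of_real (a j) :: complex) \<le> norm z + M"
        using a_bound[of j] by (simp add: add_increasing)
      then have "norm (- of_real (a j) / of_real (a (j - 1)) :: complex) \<le> (norm z + M) / m" using j by (intro quot) auto
      then show "norm (- of_real (a j) / of_real (a (j - 1)) :: complex) \<le> L / 2" using LQ by (rule order_trans)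
    next
      show "1 \<le> L" using L by simp
      show "norm (u (int N)) \<le> C * p ^ N" by (rule C)
      have "C * p ^ Suc N \<le> C * p ^ N" using C0 p by (intro mult_left_mono power_decreasing) auto
      then show "norm (u (int N + 1)) \<le> C * p ^ N" using C[of "Suc N"] by (simp add: add.commute)
    qed (use N in auto)
    also have "\<dots> \<le> L ^ (N + nat (- n)) * (C * p ^ N)"
      using N L C0 p by (intro mult_right_mono power_increasing mult_nonneg_nonneg) auto
    also have "\<dots> = L ^ nat (- n) * C * (L * p) ^ N" by (simp add: power_add power_mult_distrib mult_ac)
    also have "L * p = 1 / 2" using L by (simp add: p_def)
    finally show ?thesis .
  qed
  note le = this
  have lim: "(\<lambda>N. L ^ nat (- n) * C * (1 / 2) ^ N) \<longlonglongrightarrow> L ^ nat (- n) * C * 0" by (intro tendsto_intros LIMSEQ_power_zero) auto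
  have "\<forall>\<^sub>F N in sequentially. norm (u n) \<le> L ^ nat (- n) * C * (1 / 2) ^ N"
    using eventually_ge_at_top[of "nat n"] by eventually_elim (rule le, simp)
  from tendsto_lowerbound[OF lim this] have "norm (u n) \<le> L ^ nat (- n) * C * 0" by simp
  then show ?thesis by simp
qed

lemma energy_locale: "(12 * M + 8) / a0 + 2 \<le> norm \<zeta> \<Longrightarrow> jacobi_energy a b M a0 b0 \<zeta>"
  using a_bound b_bound a0_pos a0_bound b0_bound by unfold_locales auto

section \<open>Wronskian of the resolvent with the Jost solution\<close>

definition jost_fun :: "complex \<Rightarrow> int \<Rightarrow> complex"
  where "jost_fun \<zeta> n = \<zeta> powi n * E n \<zeta>"

lemma jost_fun_eq:
  assumes "\<zeta> \<noteq> 0"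
  shows "of_real (a n) * jost_fun \<zeta> (n + 1) + of_real (a (n - 1)) * jost_fun \<zeta> (n - 1) + of_real (b n) * jost_fun \<zeta> n
    = energy a0 b0 \<zeta> * jost_fun \<zeta> n"
proof -
  define w where "w = \<zeta> powi (n - 1)"
  have p: "\<zeta> powi n = w * \<zeta>" "\<zeta> powi (n + 1) = w * \<zeta> ^ 2"
    using assms power_int_add[of \<zeta> "n - 1" 1] power_int_add[of \<zeta> "n - 1" 2]
    by (simp_all add: w_def add.commute)
  have e: "energy a0 b0 \<zeta> * \<zeta> = of_real a0 * (1 + \<zeta> ^ 2) + of_real b0 * \<zeta>"
    using assms by (simp add: energy_def power2_eq_square field_simps)
  have "A * (w * \<zeta> ^ 2 * x) + B * (w * y) + C * (w * \<zeta> * v) = h * (w * \<zeta> * v)"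
    if "B * y = (P + (Q - C) * \<zeta>) * v - A * \<zeta> ^ 2 * x" "h * \<zeta> = P + Q * \<zeta>" for A B C x y v h P Q
    using that by algebra
  from this[OF _ e, of "of_real (a (n - 1))" "E (n - 1) \<zeta>" "of_real (b n)" "E n \<zeta>" "of_real (a n)" "E (n + 1) \<zeta>"]
  show ?thesis
    unfolding jost_fun_def p w_def[symmetric] using jost_rec[of n \<zeta>] by simp
qed

definition jost_wronskian :: "complex \<Rightarrow> int \<Rightarrow> int \<Rightarrow> complex"
  where "jost_wronskian \<zeta> m n = of_real (a m) *
    (green a b (energy a0 b0 \<zeta>) m n * jost_fun \<zeta> (m + 1) - green a b (energy a0 b0 \<zeta>) (m + 1) n * jost_fun \<zeta> m)"

lemma jost_wronskian_step:
  assumes "(12 * M + 8) / a0 + 2 \<le> norm \<zeta>"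
  shows "jost_wronskian \<zeta> m n = jost_wronskian \<zeta> (m - 1) n - (if m = n then jost_fun \<zeta> n else 0)"
proof -
  interpret e: jacobi_energy a b M a0 b0 \<zeta> using assms by (rule energy_locale)
  have "A * (g * fp - gp * f) = B * (gm * f - g * fm) - d * f"
    if "A * gp + B * gm + C * g = h * g + d" "A * fp + B * fm + C * f = h * f" for A B C g gp gm f fp fm h d :: complex
    using that by algebra
  from this[OF e.green_eq[of m n] jost_fun_eq[OF e.\<zeta>_nz, of m]] show ?thesis
    by (auto simp: jost_wronskian_def)
qed

lemma jost_wronskian_left:
  assumes \<zeta>: "(12 * M + 8) / a0 + 2 \<le> norm \<zeta>" and "m < n"
  shows "jost_wronskian \<zeta> m n = jost_wronskian \<zeta> (n - 1) n"
proof -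
  have "jost_wronskian \<zeta> (n - 1 - int i) n = jost_wronskian \<zeta> (n - 1) n" for i
  proof (induction i)
    case (Suc i)
    then show ?case
      using jost_wronskian_step[OF \<zeta>, of "n - 1 - int i" n] by (simp add: algebra_simps)
  qed simp
  from this[of "nat (n - 1 - m)"] show ?thesis using assms(2) by simp
qed

lemma jost_wronskian_right:
  assumes \<zeta>: "(12 * M + 8) / a0 + 2 \<le> norm \<zeta>"
  shows "jost_wronskian \<zeta> (n + int i) n = jost_wronskian \<zeta> n n"
proof (induction i)
  case (Suc i)
  then show ?case
    using jost_wronskian_step[OF \<zeta>, of "n + int (Suc i)" n] by (simp add: algebra_simps)
qed simp

lemma green_dev_small:
  assumes refl: "refl_coef a b a0 b0 \<zeta> = 0" and \<zeta>: "(12 * M + 8) / a0 + 2 \<le> norm \<zeta>" and p: "0 < p" "p < 1"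
  obtains C where "C \<ge> 0" "\<And>N. norm (green_dev a b a0 b0 \<zeta> (int N)) \<le> C * p ^ N"
proof -
  interpret e: jacobi_energy a b M a0 b0 \<zeta> using \<zeta> by (rule energy_locale)
  have "\<exists>C. \<forall>\<zeta>' N. (12 * M + 8) / a0 + 2 \<le> norm \<zeta>' \<longrightarrow> norm \<zeta>' \<le> norm \<zeta> \<longrightarrow>
      norm (refl_coef a b a0 b0 \<zeta>' - refl_seq a b a0 b0 \<zeta>' N) \<le> C * p ^ N"
    by (rule refl_uniform_limit[OF a_bound b_bound a0_pos a0_bound b0_bound decay p])
  then obtain C where C: "\<And>N. norm (refl_coef a b a0 b0 \<zeta> - refl_seq a b a0 b0 \<zeta> N) \<le> C * p ^ N"
    using \<zeta> by blast
  have le: "norm (green_dev a b a0 b0 \<zeta> (int N)) \<le> C * p ^ N" for N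
  proof -
    have "1 * norm (green_dev a b a0 b0 \<zeta> (int N)) \<le> norm \<zeta> ^ (2 * N) * norm (green_dev a b a0 b0 \<zeta> (int N))"
      using e.norm_\<zeta> by (intro mult_right_mono one_le_power) auto
    also have "\<dots> \<le> C * p ^ N"
      using C[of N] unfolding refl by (simp add: refl_seq_def norm_mult norm_power)
    finally show ?thesis by simp
  qed
  have "0 \<le> C" using order_trans[OF norm_ge_zero le[of 0]] by simp
  then show thesis using that le by blast
qed

text \<open>This is where the vanishing of the reflection coefficient enters: the left Weyl solution is then
  a multiple of the Jost solution \<open>jost_fun \<zeta>\<close>.\<close>

lemma jost_wronskian_zero:
  assumes refl: "refl_coef a b a0 b0 \<zeta> = 0" and \<zeta>: "(12 * M + 8) / a0 + 2 \<le> norm \<zeta>"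
  shows "jost_wronskian \<zeta> (n - 1) n = 0"
proof -
  interpret e: jacobi_energy a b M a0 b0 \<zeta> using \<zeta> by (rule energy_locale)
  define G where "G = green a b (energy a0 b0 \<zeta>)"
  define \<gamma> where "\<gamma> = green_dev a b a0 b0 \<zeta>"
  \<comment> \<open>Since \<open>G\<close> is symmetric, the Wronskian to the left of the source
    solves the eigenvalue equation as a function of the source position \<open>n\<close>. A solution
    that decays faster than every exponential vanishes by \<open>backward_zero\<close>.\<close>
  define u where "u n = jost_wronskian \<zeta> (n - 1) n" for n
  have "u n = 0" for n
  proof (rule backward_zero[where u = u and z = "energy a0 b0 \<zeta>"])
    fix n
    \<comment> \<open>To the left of the source the Wronskian does not depend on its first argument,
      so the single site \<open>n - 2\<close> serves the three neighbouring values of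
      \<open>u\<close>.\<close>
    let ?W = "jost_wronskian \<zeta> (n - 2)"
    have W: "u (n + 1) = ?W (n + 1)" "u (n - 1) = ?W (n - 1)" "u n = ?W n"
      unfolding u_def by (rule jost_wronskian_left[OF \<zeta>, symmetric], simp)+
    have g: "of_real (a n) * G m (n + 1) + of_real (a (n - 1)) * G m (n - 1) + of_real (b n) * G m n = energy a0 b0 \<zeta> * G m n"
      if "m \<noteq> n" for m
      using e.green_eq[of n m] that by (simp add: G_def e.green_sym[of m])
    have "A * (x * (gp * f - hp * f')) + B * (x * (gm * f - hm * f')) + C * (x * (g * f - h * f')) = z * (x * (g * f - h * f'))"
      if "A * gp + B * gm + C * g = z * g" "A * hp + B * hm + C * h = z * h" for A B C g gp gm h hp hm f f' x z :: complex
      using that by algebra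
    from this[OF g[of "n - 2"] g[of "n - 2 + 1"]]
    show "of_real (a n) * u (n + 1) + of_real (a (n - 1)) * u (n - 1) + of_real (b n) * u n = energy a0 b0 \<zeta> * u n"
      unfolding W jost_wronskian_def G_def[symmetric] by simp
  next
    fix p :: real assume p: "0 < p" "p < 1"
    define x where "x = norm \<zeta>"
    have x: "x \<ge> 2" unfolding x_def by (rule e.norm_\<zeta>)
    \<comment> \<open>The Jost solution contributes a factor \<open>\<zeta> ^ N\<close>; division by
      \<open>x = norm \<zeta>\<close> compensates for it.\<close>
    define p' where "p' = p / x"
    have p': "0 < p'" "p' < 1" using p x by (auto simp: p'_def divide_less_eq)
    obtain Cg where Cg: "Cg \<ge> 0" "\<And>N. norm (\<gamma> (int N)) \<le> Cg * p' ^ N"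
      unfolding \<gamma>_def using green_dev_small[OF refl \<zeta> p'] by blast
    obtain Ce where Ce: "\<And>N. norm (E (int N) \<zeta> - 1) \<le> Ce * p' ^ N" using jost_near_1[OF p'] by blast
    obtain K where K: "\<And>n. tail (int n) (K * p' ^ n)"
      using decay p' unfolding rapid_decay_def by blast
    have K0: "K \<ge> 0" using tail_bound_nonneg[OF K[of 0]] by simp
    have Ce0: "Ce \<ge> 0" using order_trans[OF norm_ge_zero Ce[of 0]] by simp
    define g0 where "g0 = 1 / (of_real a0 * (1 / \<zeta> - \<zeta>))"
    define C1 where "C1 = norm g0 * (2 * Ce) + Cg * (1 + Ce) + x * (8 / a0 * K) * (1 + Ce) + Cg * (1 + Ce)"
    have C1: "C1 \<ge> 0" unfolding C1_def using Ce0 Cg K0 x a0_pos by (intro add_nonneg_nonneg mult_nonneg_nonneg) auto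
    have E1: "norm (E (int N) \<zeta>) \<le> 1 + Ce" for N
    proof -
      have "Ce * p' ^ N \<le> Ce * 1" using Ce0 p' by (intro mult_left_mono power_le_one) auto
      then show ?thesis using Ce[of N] norm_triangle_sub[of "E (int N) \<zeta>" 1] by simp
    qed
    have main: "norm (u (int (Suc N))) \<le> M * C1 * p ^ N" for N
    proof -
      define G1 where "G1 = G (int N + 1) (int N) - 1 / \<zeta> * G (int N) (int N)"
      define E0 where "E0 = E (int N) \<zeta>"
      define E2 where "E2 = E (int (Suc N)) \<zeta>"
      have pm: "p' ^ Suc N \<le> p' ^ N" using p' by (intro power_decreasing) auto
      have G1: "norm G1 \<le> 8 / a0 * (K * p' ^ N)"
        unfolding G1_def G_def by (rule e.green_step'[OF K]) simp
      have gg: "G (int N) (int N) = g0 + \<gamma> (int N)" "G (int N + 1) (int N + 1) = g0 + \<gamma> (int N + 1)"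
        by (simp_all add: G_def \<gamma>_def g0_def green_dev_def)
      have gs: "G (int N) (int N + 1) = 1 / \<zeta> * (g0 + \<gamma> (int N)) + G1"
        using e.green_sym[of "int N" "int N + 1"] by (simp add: G1_def gg[symmetric] G_def)
      have "u (int (Suc N)) = of_real (a (int N)) * (G (int N) (int N + 1) * jost_fun \<zeta> (int N + 1) - G (int N + 1) (int N + 1) * jost_fun \<zeta> (int N))"
        by (simp add: u_def jost_wronskian_def G_def add.commute)
      also have "\<dots> = of_real (a (int N)) * ((1 / \<zeta> * (g0 + \<gamma> (int N)) + G1) * (\<zeta> ^ Suc N * E2) - (g0 + \<gamma> (int N + 1)) * (\<zeta> ^ N * E0))"
        unfolding gs gg jost_fun_def E0_def E2_def using power_int_of_nat[of \<zeta> "Suc N"] by (simp add: add.commute)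
      \<comment> \<open>The leading terms \<open>g0 * \<zeta> ^ N\<close> of the two products cancel
        up to \<open>E2 - E0\<close>. The remaining summands are small because the diagonal
        deviation is small without reflection and because \<open>G1\<close> is the error of one free
        step.\<close>
      also have "\<dots> = of_real (a (int N)) * (\<zeta> ^ N * (g0 * (E2 - E0) + \<gamma> (int N) * E2 + \<zeta> * G1 * E2 - \<gamma> (int N + 1) * E0))"
        using e.\<zeta>_nz by (simp add: field_simps)
      finally have eq: "u (int (Suc N)) = \<dots>" .
      have "norm (g0 * (E2 - E0) + \<gamma> (int N) * E2 + \<zeta> * G1 * E2 - \<gamma> (int N + 1) * E0)
        \<le> norm g0 * (2 * Ce * p' ^ N) + Cg * p' ^ N * (1 + Ce) + x * (8 / a0 * (K * p' ^ N)) * (1 + Ce) + Cg * p' ^ N * (1 + Ce)"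
      proof (intro norm_triangle_le_diff norm_triangle_le add_mono)
        have "norm (E2 - E0) \<le> norm (E2 - 1) + norm (E0 - 1)"
          using norm_triangle_ineq4[of "E2 - 1" "E0 - 1"] by simp
        also have "\<dots> \<le> Ce * p' ^ N + Ce * p' ^ N"
          using Ce[of "Suc N"] Ce[of N] mult_left_mono[OF pm Ce0] unfolding E2_def E0_def by linarith
        finally have "norm (E2 - E0) \<le> 2 * Ce * p' ^ N" by simp
        then show "norm (g0 * (E2 - E0)) \<le> norm g0 * (2 * Ce * p' ^ N)"
          unfolding norm_mult by (intro mult_left_mono) auto
        show "norm (\<gamma> (int N) * E2) \<le> Cg * p' ^ N * (1 + Ce)"
          unfolding norm_mult E2_def using Cg p' by (intro mult_mono E1) auto
        show "norm (\<zeta> * G1 * E2) \<le> x * (8 / a0 * (K * p' ^ N)) * (1 + Ce)"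
          unfolding norm_mult E2_def x_def[symmetric] using G1 x K0 a0_pos p' by (intro mult_mono E1) auto
        have "norm (\<gamma> (int N + 1)) \<le> Cg * p' ^ N"
          using Cg(2)[of "Suc N"] mult_left_mono[OF pm Cg(1)] by (simp add: add.commute)
        then show "norm (\<gamma> (int N + 1) * E0) \<le> Cg * p' ^ N * (1 + Ce)"
          unfolding norm_mult E0_def using Cg(1) p' by (intro mult_mono E1) auto
      qed
      also have "\<dots> = C1 * p' ^ N" by (simp add: C1_def algebra_simps)
      finally have le: "norm (g0 * (E2 - E0) + \<gamma> (int N) * E2 + \<zeta> * G1 * E2 - \<gamma> (int N + 1) * E0) \<le> C1 * p' ^ N" .
      have "norm (u (int (Suc N))) \<le> M * (x ^ N * (C1 * p' ^ N))"
        unfolding eq norm_mult[of "of_real (a (int N))"] norm_mult[of "\<zeta> ^ N"] norm_power norm_of_real x_def[symmetric]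
        using le a_bound M_pos x C1 p' by (intro mult_mono mult_nonneg_nonneg) auto
      also have "\<dots> = M * C1 * (x * p') ^ N" by (simp add: power_mult_distrib mult_ac)
      also have "x * p' = p" using x by (simp add: p'_def)
      finally show ?thesis .
    qed
    define C where "C = norm (u 0) + M * C1 / p"
    have "norm (u (int N)) \<le> C * p ^ N" for N
    proof (cases N)
      case 0
      then show ?thesis using M_pos C1 p by (simp add: C_def)
    next
      case (Suc N')
      have "norm (u (int N)) \<le> M * C1 / p * p ^ N" using main[of N'] Suc p by simp
      also have "\<dots> \<le> C * p ^ N" using p unfolding C_def by (intro mult_right_mono) auto
      finally show ?thesis .
    qed
    then show "\<exists>C. \<forall>N. norm (u (int N)) \<le> C * p ^ N" by blast
  qed
  then show ?thesis by (simp add: u_def)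
qed

text \<open>\<open>green_bound\<close> alone yields only decay like
  \<open>(\<Lambda> / norm \<zeta>) ^ i\<close>, too weak by \<open>\<Lambda> ^ i\<close>. Inserted
  into \<open>green_step\<close> it suffices as an error bound, since the tail there decays faster
  than \<open>\<Lambda> ^ i\<close> grows; the free steps then provide the exact rate
  \<open>norm \<zeta> ^ (- i)\<close>, uniformly in \<zeta> and \<open>i\<close>.\<close>

lemma green_column_bound:
  obtains B where "B \<ge> 0" "\<And>\<zeta> i. (12 * M + 8) / a0 + 2 \<le> norm \<zeta> \<Longrightarrow>
    norm \<zeta> ^ i * norm (green a b (energy a0 b0 \<zeta>) (n + int i) n) \<le> B / norm \<zeta>"
proof -
  define \<Lambda> where "\<Lambda> = 6 * M / a0"
  have \<Lambda>: "\<Lambda> \<ge> 6" using a0_pos a0_bound by (simp add: \<Lambda>_def pos_le_divide_eq)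
  \<comment> \<open>The error of step \<open>i\<close> carries the factor
    \<open>(\<Lambda> * p) ^ i\<close>, which becomes \<open>(1 / 2) ^ i\<close>. The value of
    \<open>\<Lambda>\<close> comes from
    \<open>3 * M / norm z \<le> \<Lambda> / norm \<zeta>\<close>.\<close>
  define p where "p = 1 / (2 * \<Lambda>)"
  have p: "0 < p" "p < 1" using \<Lambda> by (auto simp: p_def divide_less_eq)
  obtain K where K: "K \<ge> 0" "\<And>i. tail (n + int i) (K * p ^ i)" using tail_shift[OF p] by blast
  define C where "C = K / a0 * (8 * \<Lambda> * (4 / a0))"
  define B where "B = 4 / a0 + 2 * C"
  have C0: "C \<ge> 0" using K \<Lambda> a0_pos by (simp add: C_def)
  have "norm \<zeta> ^ i * norm (green a b (energy a0 b0 \<zeta>) (n + int i) n) \<le> B / norm \<zeta>"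
    if \<zeta>: "(12 * M + 8) / a0 + 2 \<le> norm \<zeta>" for \<zeta> i
  proof -
    interpret e: jacobi_energy a b M a0 b0 \<zeta> using \<zeta> by (rule energy_locale)
    define x where "x = norm \<zeta>"
    have x: "x \<ge> 2" unfolding x_def by (rule e.norm_\<zeta>)
    define G where "G = green a b (energy a0 b0 \<zeta>)"
    have zl: "norm (energy a0 b0 \<zeta>) \<ge> a0 / 2 * x" unfolding x_def by (rule e.z_lower(1))
    have xp: "a0 / 2 * x > 0" using a0_pos x by simp
    have gb: "norm (G j n) \<le> 4 / a0 / x * (\<Lambda> / x) ^ i" if "n + int i \<le> j" for j i
    proof -
      have i: "i \<le> nat \<bar>j - n\<bar>" using that by linarith
      have "norm (G j n) \<le> 2 / norm (energy a0 b0 \<zeta>) * (3 * M / norm (energy a0 b0 \<zeta>)) ^ nat \<bar>j - n\<bar>"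
        unfolding G_def by (rule e.green_bound)
      also have "\<dots> \<le> 2 / norm (energy a0 b0 \<zeta>) * (3 * M / norm (energy a0 b0 \<zeta>)) ^ i"
        using e.ratio i by (intro mult_left_mono power_decreasing) auto
      also have "\<dots> \<le> 2 / (a0 / 2 * x) * (3 * M / (a0 / 2 * x)) ^ i"
        using zl xp M_pos a0_pos x e.z_nz by (intro mult_mono divide_left_mono power_mono mult_pos_pos zero_le_power) auto
      also have "\<dots> = 4 / a0 / x * (\<Lambda> / x) ^ i" by (simp add: \<Lambda>_def field_simps)
      finally show ?thesis .
    qed
    define Y where "Y i = x ^ i * norm (G (n + int i) n)" for i
    have Y0: "Y 0 \<le> 4 / a0 / x" using gb[of 0 n] by (simp add: Y_def)
    have step: "Y (Suc i) \<le> Y i + C / x * (1 / 2) ^ i" for i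
    proof -
      let ?g = "4 / a0 / x * (\<Lambda> / x) ^ Suc i"
      have "norm (G (n + int i + 1) n - 1 / \<zeta> * G (n + int i) n) \<le> K * p ^ i / a0 * (7 * ?g + norm (1 / \<zeta>) * norm (G (n + int i) n))"
        unfolding G_def by (rule e.green_step[OF K(2)]) (use gb[of "Suc i"] in \<open>auto simp: G_def\<close>)
      also have "\<dots> \<le> K * p ^ i / a0 * (7 * ?g + ?g)"
      proof (intro mult_left_mono add_left_mono)
        have "norm (1 / \<zeta>) * norm (G (n + int i) n) \<le> 1 / x * (4 / a0 / x * (\<Lambda> / x) ^ i)"
          unfolding norm_divide norm_one x_def[symmetric] using gb[of i "n + int i"] x by (intro mult_left_mono) auto
        also have "\<dots> \<le> \<Lambda> / x * (4 / a0 / x * (\<Lambda> / x) ^ i)"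
          using \<Lambda> x a0_pos by (intro mult_right_mono divide_right_mono) auto
        also have "\<dots> = ?g" by (simp only: power_Suc mult.left_commute)
        finally show "norm (1 / \<zeta>) * norm (G (n + int i) n) \<le> ?g" .
        show "0 \<le> K * p ^ i / a0" using K p a0_pos by simp
      qed
      finally have "x ^ Suc i * norm (G (n + int i + 1) n - 1 / \<zeta> * G (n + int i) n) \<le> x ^ Suc i * (K * p ^ i / a0 * (8 * ?g))"
        using x by (intro mult_left_mono) auto
      also have "\<dots> = C / x * (\<Lambda> * p) ^ i"
        using x by (simp add: C_def power_mult_distrib power_divide field_simps)
      also have "\<Lambda> * p = 1 / 2" using \<Lambda> by (simp add: p_def)
      finally have s: "x ^ Suc i * norm (G (n + int i + 1) n - 1 / \<zeta> * G (n + int i) n) \<le> C / x * (1 / 2) ^ i" .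
      have "norm (G (n + int i + 1) n) \<le> norm (G (n + int i + 1) n - 1 / \<zeta> * G (n + int i) n) + norm (1 / \<zeta> * G (n + int i) n)"
        using norm_triangle_sub[of "G (n + int i + 1) n" "1 / \<zeta> * G (n + int i) n"] by simp
      then have "x ^ Suc i * norm (G (n + int i + 1) n) \<le> x ^ Suc i * (norm (G (n + int i + 1) n - 1 / \<zeta> * G (n + int i) n) + norm (1 / \<zeta> * G (n + int i) n))"
        using x by (intro mult_left_mono) auto
      also have "\<dots> = x ^ Suc i * norm (G (n + int i + 1) n - 1 / \<zeta> * G (n + int i) n) + Y i"
        using x by (simp add: Y_def norm_divide norm_mult x_def[symmetric] distrib_left)
      finally show ?thesis using s by (simp add: Y_def add_ac)
    qed
    have "Y i \<le> 4 / a0 / x + C / x * (2 - 2 * (1 / 2) ^ i)" for i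
    proof (induction i)
      case 0
      then show ?case using Y0 by simp
    next
      case (Suc i)
      have "C / x * (2 - 2 * (1 / 2) ^ Suc i) = C / x * (2 - 2 * (1 / 2) ^ i) + C / x * (1 / 2) ^ i"
        by (simp add: algebra_simps)
      then show ?case using Suc step[of i] by linarith
    qed
    moreover have "C / x * (2 - 2 * (1 / 2) ^ i) \<le> C / x * 2" using C0 x by (intro mult_left_mono) auto
    ultimately have "Y i \<le> 4 / a0 / x + C / x * 2" by (meson add_left_mono order_trans)
    also have "\<dots> = B / x" by (simp add: B_def add_divide_distrib)
    finally show ?thesis by (simp add: Y_def x_def G_def)
  qed
  moreover have "B \<ge> 0" using C0 a0_pos by (simp add: B_def)
  ultimately show thesis using that by blast
qed

lemma reflectionless_trivial:
  assumes refl: "\<And>\<zeta>. R \<le> norm \<zeta> \<Longrightarrow> refl_coef a b a0 b0 \<zeta> = 0"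
  shows "\<bar>a n\<bar> = a0 \<and> b n = b0"
proof (rule trivial_if_jost_constant)
  fix n and \<zeta>1 :: complex
  define R' where "R' = max R ((12 * M + 8) / a0 + 2)"
  obtain B where B: "B \<ge> 0" "\<And>\<zeta> i. (12 * M + 8) / a0 + 2 \<le> norm \<zeta> \<Longrightarrow>
    norm \<zeta> ^ i * norm (green a b (energy a0 b0 \<zeta>) (n + int i) n) \<le> B / norm \<zeta>"
    using green_column_bound by blast
  have bdd: "norm (E n \<zeta>) \<le> M * (2 * B)" if z: "R' \<le> norm \<zeta>" for \<zeta>
  proof -
    have \<zeta>: "(12 * M + 8) / a0 + 2 \<le> norm \<zeta>" "R \<le> norm \<zeta>" using z by (auto simp: R'_def)
    interpret e: jacobi_energy a b M a0 b0 \<zeta> using \<zeta>(1) by (rule energy_locale)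
    define x where "x = norm \<zeta>"
    have x: "x \<ge> 2" unfolding x_def by (rule e.norm_\<zeta>)
    define G where "G = green a b (energy a0 b0 \<zeta>)"
    have "jost_wronskian \<zeta> n n = - jost_fun \<zeta> n"
      using jost_wronskian_step[OF \<zeta>(1), of n n] jost_wronskian_zero[OF refl[OF \<zeta>(2)] \<zeta>(1), of n] by simp
    \<comment> \<open>The left side does not depend on \<open>i\<close>. Letting
      \<open>n + i\<close> run to infinity, where \<open>E\<close> tends to 1 while
      \<open>green_column_bound\<close> holds uniformly, bounds \<open>E n \<zeta>\<close> by a
      constant that is independent of \<zeta>.\<close>
    then have W: "- jost_fun \<zeta> n = jost_wronskian \<zeta> (n + int i) n" for i
      using jost_wronskian_right[OF \<zeta>(1), of n i] by simp
    have pw: "\<zeta> powi (n + int i) = \<zeta> powi n * \<zeta> ^ i" for i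
      using e.\<zeta>_nz by (simp add: power_int_add)
    have le: "norm (E n \<zeta>) \<le> M * (B * norm (E (n + int (Suc i)) \<zeta>) + B * norm (E (n + int i) \<zeta>))" for i
    proof -
      have "- (\<zeta> powi n * E n \<zeta>) = \<zeta> powi n * (of_real (a (n + int i)) *
          (\<zeta> ^ Suc i * G (n + int i) n * E (n + int (Suc i)) \<zeta> - \<zeta> ^ i * G (n + int (Suc i)) n * E (n + int i) \<zeta>))"
        using W[of i] pw[of "Suc i"] pw[of i]
        by (simp add: jost_wronskian_def jost_fun_def G_def[symmetric] algebra_simps)
      then have "- E n \<zeta> = of_real (a (n + int i)) *
          (\<zeta> ^ Suc i * G (n + int i) n * E (n + int (Suc i)) \<zeta> - \<zeta> ^ i * G (n + int (Suc i)) n * E (n + int i) \<zeta>)"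
        using e.\<zeta>_nz by (simp only: mult_minus_right[symmetric] mult_cancel_left power_int_eq_0_iff) blast
      then have "norm (E n \<zeta>) = norm (of_real (a (n + int i)) *
          (\<zeta> ^ Suc i * G (n + int i) n * E (n + int (Suc i)) \<zeta> - \<zeta> ^ i * G (n + int (Suc i)) n * E (n + int i) \<zeta>))"
        by (metis norm_minus_cancel)
      also have "\<dots> \<le> M * (B * norm (E (n + int (Suc i)) \<zeta>) + B * norm (E (n + int i) \<zeta>))"
        unfolding norm_mult[of "of_real (a (n + int i))"] norm_of_real
      proof (intro mult_mono norm_triangle_le_diff add_mono)
        have "x ^ Suc i * norm (G (n + int i) n) = x * (x ^ i * norm (G (n + int i) n))" by simp
        also have "\<dots> \<le> x * (B / x)" using B(2)[OF \<zeta>(1), of i] x unfolding x_def G_def by (intro mult_left_mono) auto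
        finally have 1: "x ^ Suc i * norm (G (n + int i) n) \<le> B" using x by simp
        have "x ^ i * norm (G (n + int (Suc i)) n) \<le> x ^ Suc i * norm (G (n + int (Suc i)) n)"
          using x by (intro mult_right_mono power_increasing) auto
        also have "\<dots> \<le> B / x" using B(2)[OF \<zeta>(1), of "Suc i"] unfolding x_def G_def .
        also have "\<dots> \<le> B" using x B(1) by (simp add: divide_le_eq mult_le_cancel_left1)
        finally have 2: "x ^ i * norm (G (n + int (Suc i)) n) \<le> B" .
        show "norm (\<zeta> ^ Suc i * G (n + int i) n * E (n + int (Suc i)) \<zeta>) \<le> B * norm (E (n + int (Suc i)) \<zeta>)"
          unfolding norm_mult norm_power x_def[symmetric] using 1 by (intro mult_right_mono) auto
        show "norm (\<zeta> ^ i * G (n + int (Suc i)) n * E (n + int i) \<zeta>) \<le> B * norm (E (n + int i) \<zeta>)"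
          unfolding norm_mult norm_power x_def[symmetric] using 2 by (intro mult_right_mono) auto
      qed (use a_bound M_pos in auto)
      finally show ?thesis .
    qed
    have limE: "(\<lambda>N. E (int N) \<zeta>) \<longlonglongrightarrow> 1"
    proof -
      obtain C where C: "\<And>N. norm (E (int N) \<zeta> - 1) \<le> C * (1 / 2) ^ N" using jost_near_1[of "1 / 2" \<zeta>] by auto
      have "(\<lambda>N. C * (1 / 2) ^ N) \<longlonglongrightarrow> C * 0" by (intro tendsto_intros LIMSEQ_power_zero) auto
      then have "(\<lambda>N. C * (1 / 2) ^ N) \<longlonglongrightarrow> 0" by simp
      then have "(\<lambda>N. E (int N) \<zeta> - 1) \<longlonglongrightarrow> 0" by (rule Lim_null_comparison[rotated]) (use C in simp)
      then show ?thesis by (rule LIM_zero_cancel)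
    qed
    have "(\<lambda>N. M * (B * norm (E (int (Suc N)) \<zeta>) + B * norm (E (int N) \<zeta>))) \<longlonglongrightarrow> M * (B * norm (1::complex) + B * norm (1::complex))"
      by (intro tendsto_intros limE LIMSEQ_Suc[OF limE, unfolded o_def])
    moreover have "\<forall>\<^sub>F N in sequentially. norm (E n \<zeta>) \<le> M * (B * norm (E (int (Suc N)) \<zeta>) + B * norm (E (int N) \<zeta>))"
      using eventually_ge_at_top[of "nat n"]
    proof eventually_elim
      case (elim N)
      then have e: "n + int (nat (int N - n)) = int N" "n + int (Suc (nat (int N - n))) = int (Suc N)" by auto
      show ?case using le[of "nat (int N - n)"] unfolding e .
    qed
    ultimately have "norm (E n \<zeta>) \<le> M * (B * norm (1::complex) + B * norm (1::complex))"
      by (intro tendsto_lowerbound) auto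
    then show ?thesis by simp
  qed
  have "bounded (E n ` cball 0 R')"
    by (intro compact_imp_bounded compact_continuous_image holomorphic_on_imp_continuous_on
        holomorphic_on_subset[OF jost_holomorphic]) auto
  moreover have "bounded (E n ` {\<zeta>. R' \<le> norm \<zeta>})"
    unfolding bounded_iff using bdd by blast
  moreover have "cball 0 R' \<union> {\<zeta> :: complex. R' \<le> norm \<zeta>} = UNIV"
    by auto
  ultimately have "bounded (range (E n))" by (metis bounded_Un image_Un)
  then have "E n constant_on UNIV" by (rule Liouville_theorem[OF jost_holomorphic])
  then show "E n \<zeta>1 = E n 0" by (auto simp: constant_on_def)
qed

end

section \<open>Unique continuation\<close>

lemma dispersion_polar:
  "Re (dispersion c s a0 b0 (of_real r * cis \<theta>))
    = 2 * (\<Sum>i=1..s. free_symbol c s a0 b0 i * ((1 / r) ^ i - r ^ i) * cos (real i * \<theta>))"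
proof -
  have inv: "1 / (of_real r * cis \<theta>) = of_real (1 / r) * cis (- \<theta>)"
    unfolding divide_inverse inverse_mult_distrib cis_inverse by simp
  have "Re (of_real p * ((1 / (of_real r * cis \<theta>)) ^ i - (of_real r * cis \<theta>) ^ i))
      = p * ((1 / r) ^ i - r ^ i) * cos (real i * \<theta>)" for p and i :: nat
    unfolding inv power_mult_distrib of_real_power[symmetric] Complex.DeMoivre
    by (simp add: left_diff_distrib right_diff_distrib)
  moreover have "Re (2 * w) = 2 * Re w" for w by simp
  ultimately show ?thesis
    unfolding dispersion_def by (simp only: Re_sum)
qed

text \<open>The top coefficient is \<open>a0 ^ s\<close> by \<open>free_symbol_top\<close>. On rays
  where the cosine of \<open>s * \<theta>\<close> stays away from 0 the top term is of order
  \<open>r ^ s\<close> and dominates the others, which are of order \<open>r ^ n\<close> with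
  \<open>n = s - 1\<close>. The weaker linear bound already beats every
  \<open>exp (\<epsilon> * r)\<close> with small \<epsilon>.\<close>

lemma dispersion_lower:
  assumes c: "c 0 = 1" and a0: "a0 > 0" and s: "s = Suc n"
  obtains R \<kappa> where "\<kappa> > 0" "\<And>r \<theta>. R \<le> r \<Longrightarrow> sqrt 2 / 2 \<le> \<bar>cos (real s * \<theta>)\<bar> \<Longrightarrow>
    \<kappa> * r \<le> \<bar>Re (dispersion c s a0 b0 (of_real r * cis \<theta>))\<bar>"
proof -
  define p where "p = free_symbol c s a0 b0"
  define P where "P = a0 ^ s"
  define B where "B = 2 * (\<Sum>i=1..n. \<bar>p i\<bar>)"
  have P: "P > 0" using a0 by (simp add: P_def)
  have ps: "p s = P" unfolding p_def P_def using c s by (intro free_symbol_top) auto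
  have B0: "B \<ge> 0" by (simp add: B_def sum_nonneg)
  have "P / 2 * r \<le> \<bar>Re (dispersion c s a0 b0 (of_real r * cis \<theta>))\<bar>"
    if r: "2 * (B + P) / P + 1 \<le> r" and good: "sqrt 2 / 2 \<le> \<bar>cos (real s * \<theta>)\<bar>" for r \<theta>
  proof -
    have "2 * (B + P) / P \<ge> 0" using B0 P by simp
    then have r1: "r \<ge> 1" using r by linarith
    have "2 * (B + P) / P \<le> r" using r by linarith
    then have rP: "2 * (B + P) \<le> P * r" using P by (simp add: pos_divide_le_eq mult.commute)
    define d where "d i = p i * ((1 / r) ^ i - r ^ i) * cos (real i * \<theta>)" for i
    have le: "(1 / r) ^ i \<le> 1" "1 \<le> r ^ i" for i using r1 by (auto intro: power_le_one)
    have pos: "(1 / r) ^ i \<ge> 0" for i using r1 by simp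
    have low: "\<bar>\<Sum>i=1..n. d i\<bar> \<le> (\<Sum>i=1..n. \<bar>p i\<bar>) * r ^ n"
      unfolding sum_distrib_right
    proof (rule order_trans[OF sum_abs], rule sum_mono)
      fix i assume i: "i \<in> {1..n}"
      have "\<bar>(1 / r) ^ i - r ^ i\<bar> \<le> r ^ i" using le[of i] pos[of i] by linarith
      also have "\<dots> \<le> r ^ n" using i r1 by (intro power_increasing) auto
      finally have "\<bar>p i\<bar> * \<bar>(1 / r) ^ i - r ^ i\<bar> * \<bar>cos (real i * \<theta>)\<bar> \<le> \<bar>p i\<bar> * r ^ n * 1"
        using r1 by (intro mult_mono) auto
      then show "\<bar>d i\<bar> \<le> \<bar>p i\<bar> * r ^ n" by (simp add: d_def abs_mult)
    qed
    have "sqrt 2 \<ge> 1" by simp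
    then have good': "1 / 2 \<le> \<bar>cos (real s * \<theta>)\<bar>" using good by linarith
    have "P * (r ^ s - 1) * (1 / 2) \<le> P * \<bar>(1 / r) ^ s - r ^ s\<bar> * \<bar>cos (real s * \<theta>)\<bar>"
      using good' P le[of s] pos[of s] by (intro mult_mono) auto
    then have high: "P * (r ^ s - 1) / 2 \<le> \<bar>d s\<bar>"
      using P by (simp add: d_def ps abs_mult)
    have "Re (dispersion c s a0 b0 (of_real r * cis \<theta>)) = 2 * (\<Sum>i=1..s. d i)"
      unfolding dispersion_polar d_def p_def ..
    also have "(\<Sum>i=1..s. d i) = (\<Sum>i=1..n. d i) + d s" using s by simp
    finally have eq: "Re (dispersion c s a0 b0 (of_real r * cis \<theta>)) = 2 * ((\<Sum>i=1..n. d i) + d s)" .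
    have rn: "1 \<le> r ^ n" by (rule le)
    have "(P * r - B) * 1 \<le> (P * r - B) * r ^ n" using rP P B0 rn by (intro mult_left_mono) auto
    also have "\<dots> = P * r ^ s - B * r ^ n" by (simp add: s algebra_simps)
    finally have 1: "P * r - B \<le> P * r ^ s - B * r ^ n" by simp
    have 2: "\<bar>\<Sum>i=1..n. d i\<bar> \<le> B * r ^ n / 2" using low by (simp add: B_def)
    have 3: "P * r ^ s / 2 - P / 2 \<le> \<bar>d s\<bar>" using high by (simp add: algebra_simps diff_divide_distrib)
    have "2 * \<bar>y\<bar> - 2 * \<bar>x\<bar> \<le> \<bar>2 * (x + y)\<bar>" for x y :: real
      using abs_triangle_ineq4[of "x + y" x] unfolding abs_mult[of 2] by simp
    then have "2 * \<bar>d s\<bar> - 2 * \<bar>\<Sum>i=1..n. d i\<bar> \<le> \<bar>Re (dispersion c s a0 b0 (of_real r * cis \<theta>))\<bar>"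
      unfolding eq by blast
    moreover have "P / 2 * r \<le> w" if "2 * y - 2 * x \<le> w" "x \<le> h / 2" "e / 2 - P / 2 \<le> y" "P * r - B \<le> e - h" for w x y e h
      using that rP by (simp add: field_simps)
    ultimately show ?thesis using 1 2 3 by blast
  qed
  then show thesis using that[of "P / 2"] P by (metis half_gt_zero)
qed

text \<open>The left side is the power \<open>2 * n\<close> of
  \<open>1 / (n * n powr \<delta>)\<close>, and \<open>fact (2 * n) \<le> (2 * n) ^ (2 * n)\<close>.
  The quotient to be bounded is therefore at most the power \<open>2 * n\<close> of
  \<open>2 / (\<epsilon> * n powr \<delta>)\<close>, whose base eventually drops below 1 because
  \<open>\<delta> > 0\<close>. The constant pays for the indices before that happens.\<close>

lemma super_factorial_decay:
  fixes \<delta> \<epsilon> :: real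
  assumes \<delta>: "\<delta> > 0" and \<epsilon>: "\<epsilon> > 0"
  obtains K where "K \<ge> 0"
    "\<And>n::nat. n \<ge> 1 \<Longrightarrow> 1 / real n powr ((1 + \<delta>) * 2 * real n) \<le> K * (\<epsilon> ^ (2 * n) / fact (2 * n))"
proof -
  define A where "A = max 1 (2 / \<epsilon>)"
  have A: "A \<ge> 1" "2 / \<epsilon> \<le> A" by (auto simp: A_def)
  define N where "N = nat \<lceil>A powr (1 / \<delta>)\<rceil>"
  have N: "A \<le> real n powr \<delta>" if "n \<ge> N" for n
  proof -
    have "A powr (1 / \<delta>) \<le> real N" unfolding N_def by (rule real_nat_ceiling_ge)
    then have "A powr (1 / \<delta>) \<le> real n" using that by linarith
    then have "(A powr (1 / \<delta>)) powr \<delta> \<le> real n powr \<delta>" using \<delta> by (intro powr_mono2) auto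
    then show ?thesis using A \<delta> by (simp add: powr_powr)
  qed
  have "1 / real n powr ((1 + \<delta>) * 2 * real n) \<le> A ^ (2 * N) * (\<epsilon> ^ (2 * n) / fact (2 * n))" if n: "n \<ge> 1" for n :: nat
  proof -
    define x where "x = real n powr \<delta>"
    have x: "x \<ge> 1" unfolding x_def using n \<delta> by (simp add: ge_one_powr_ge_zero)
    have pw: "real n powr ((1 + \<delta>) * 2 * real n) = (real n * x) ^ (2 * n)"
    proof -
      have "real n * x = real n powr (1 + \<delta>)" using n by (simp add: x_def powr_add)
      moreover have "(real n powr (1 + \<delta>)) powr real (2 * n) = (real n powr (1 + \<delta>)) ^ (2 * n)"
        using n by (intro powr_realpow) simp
      ultimately show ?thesis by (simp add: powr_powr mult_ac)
    qed
    have "(A / x) ^ (2 * n) \<le> A ^ (2 * N)"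
    proof (cases "n \<ge> N")
      case True
      then have "A \<le> x" using N[of n] by (simp add: x_def)
      moreover have "x > 0" using x by simp
      ultimately have "A / x \<le> 1" by (simp add: pos_divide_le_eq)
      then have "(A / x) ^ (2 * n) \<le> 1" using A x by (intro power_le_one) auto
      then show ?thesis using one_le_power[OF A(1), of "2 * N"] by linarith
    next
      case False
      have "A / x \<le> A / 1" using A x by (intro divide_left_mono) auto
      then have "A / x \<le> A" by simp
      then have "(A / x) ^ (2 * n) \<le> A ^ (2 * n)" using A x by (intro power_mono) auto
      also have "\<dots> \<le> A ^ (2 * N)" using A False by (intro power_increasing) auto
      finally show ?thesis .
    qed
    moreover have "(2 / \<epsilon> / x) ^ (2 * n) \<le> (A / x) ^ (2 * n)"
      using A x \<epsilon> by (intro power_mono divide_right_mono) auto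
    ultimately have le: "(2 / \<epsilon> / x) ^ (2 * n) \<le> A ^ (2 * N)" by linarith
    have "fact (2 * n) \<le> (real (2 * n)) ^ (2 * n)"
      using fact_le_power[of "2 * n", where ?'a = real] by simp
    then have "fact (2 * n) / (real n * x * \<epsilon>) ^ (2 * n) \<le> (real (2 * n)) ^ (2 * n) / (real n * x * \<epsilon>) ^ (2 * n)"
      using x \<epsilon> by (intro divide_right_mono) auto
    also have "\<dots> = (2 / \<epsilon> / x) ^ (2 * n)"
      using n x \<epsilon> by (subst power_divide[symmetric]) (simp add: field_simps)
    also have "\<dots> \<le> A ^ (2 * N)" by (rule le)
    finally have "fact (2 * n) / (real n * x * \<epsilon>) ^ (2 * n) \<le> A ^ (2 * N)" .
    then have "fact (2 * n) / (real n * x * \<epsilon>) ^ (2 * n) * (\<epsilon> ^ (2 * n) / fact (2 * n)) \<le> A ^ (2 * N) * (\<epsilon> ^ (2 * n) / fact (2 * n))"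
      using \<epsilon> by (intro mult_right_mono) auto
    moreover have "fact (2 * n) / (real n * x * \<epsilon>) ^ (2 * n) * (\<epsilon> ^ (2 * n) / fact (2 * n)) = 1 / (real n * x) ^ (2 * n)"
      using \<epsilon> by (simp add: power_mult_distrib)
    ultimately show ?thesis unfolding pw by simp
  qed
  then show thesis using that[of "A ^ (2 * N)"] A by simp
qed

lemma tail_bound_of_decay:
  fixes a b :: "int \<Rightarrow> real"
  assumes bnd: "\<And>n. \<bar>a n\<bar> \<le> M" "\<And>n. \<bar>b n\<bar> \<le> M" "0 < a0" "a0 \<le> M" "\<bar>b0\<bar> \<le> M"
    and \<delta>: "\<delta> > 0" and \<epsilon>: "\<epsilon> > 0"
    and decay: "\<And>m::int. m > 0 \<Longrightarrow> (\<lambda>n. \<bar>a n - a0\<bar> + \<bar>b n - b0\<bar>) summable_on {m..} \<and>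
      (\<Sum>\<^sub>\<infinity>n\<in>{m..}. \<bar>a n - a0\<bar> + \<bar>b n - b0\<bar>) \<le> C * (1 / real_of_int m powr ((1 + \<delta>) * 2 * real_of_int m))"
  shows "\<exists>K. \<forall>n. tail_bound a b a0 b0 (int n) (K * (\<epsilon> ^ (2 * n) / fact (2 * n)))"
proof -
  obtain K where K: "K \<ge> 0" "\<And>n::nat. n \<ge> 1 \<Longrightarrow> 1 / real n powr ((1 + \<delta>) * 2 * real n) \<le> K * (\<epsilon> ^ (2 * n) / fact (2 * n))"
    using super_factorial_decay[OF \<delta> \<epsilon>] by blast
  have M: "M > 0" using bnd by linarith
  have "tail_bound a b a0 b0 (int n) ((2 * M + \<bar>C\<bar> * K) * (\<epsilon> ^ (2 * n) / fact (2 * n)))" for n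
  \<comment> \<open>The decay hypothesis starts at site 1, whereas \<open>tail_bound\<close> is also
    wanted at site 0; there the trivial bound \<open>2 * M\<close> is used.\<close>
  proof (cases "n = 0")
    case True
    have d: "\<bar>a j - a0\<bar> \<le> 2 * M" "\<bar>b j - b0\<bar> \<le> 2 * M" for j
      using bnd(1)[of j] bnd(2)[of j] bnd(3-5) by linarith+
    have e: "2 * M \<le> 2 * M + \<bar>C\<bar> * K" using K by simp
    show ?thesis using True order_trans[OF d(1) e] order_trans[OF d(2) e] by (simp add: tail_bound_def)
  next
    case False
    let ?e = "\<epsilon> ^ (2 * n) / fact (2 * n)"
    have n: "n \<ge> 1" "int n > 0" using False by auto
    have e: "?e \<ge> 0" using \<epsilon> by simp
    have "\<bar>a j - a0\<bar> + \<bar>b j - b0\<bar> \<le> (2 * M + \<bar>C\<bar> * K) * ?e" if j: "int n \<le> j" for j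
    proof -
      have "(\<Sum>n\<in>{j}. \<bar>a n - a0\<bar> + \<bar>b n - b0\<bar>) \<le> (\<Sum>\<^sub>\<infinity>n\<in>{int n..}. \<bar>a n - a0\<bar> + \<bar>b n - b0\<bar>)"
        by (rule finite_sum_le_infsum) (use decay[OF n(2)] j in auto)
      also have "\<dots> \<le> C * (1 / real n powr ((1 + \<delta>) * 2 * real n))"
        using decay[OF n(2)] by simp
      also have "\<dots> \<le> \<bar>C\<bar> * (1 / real n powr ((1 + \<delta>) * 2 * real n))"
        by (intro mult_right_mono) auto
      also have "\<dots> \<le> \<bar>C\<bar> * (K * ?e)" by (intro mult_left_mono K n) auto
      also have "\<dots> \<le> (2 * M + \<bar>C\<bar> * K) * ?e"
      proof -
        have "0 \<le> 2 * M * ?e" using M e by (intro mult_nonneg_nonneg) auto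
        then show ?thesis unfolding distrib_right mult.assoc by linarith
      qed
      finally show ?thesis by simp
    qed
    then show ?thesis unfolding tail_bound_def by (smt (verit, ccfv_SIG) abs_ge_zero)
  qed
  then show ?thesis by blast
qed

lemma rapid_decay_of_factorial:
  assumes "\<And>\<epsilon>. \<epsilon> > 0 \<Longrightarrow> \<exists>K. \<forall>n. tail_bound a b a0 b0 (int n) (K * (\<epsilon> ^ (2 * n) / fact (2 * n)))"
  shows "rapid_decay a b a0 b0"
  unfolding rapid_decay_def
proof (intro allI impI)
  fix q :: real assume q: "0 < q" "q < 1"
  obtain K where K: "\<And>n. tail_bound a b a0 b0 (int n) (K * (sqrt q ^ (2 * n) / fact (2 * n)))"
    using assms[of "sqrt q"] q by auto
  have K0: "K \<ge> 0" using tail_bound_nonneg[OF K[of 0]] by simp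
  have le: "K * (sqrt q ^ (2 * n) / fact (2 * n)) \<le> K * q ^ n" for n
  proof -
    have "sqrt q ^ (2 * n) / fact (2 * n) \<le> sqrt q ^ (2 * n) / 1"
      using q by (intro divide_left_mono) auto
    also have "\<dots> = q ^ n" using q by (simp add: power_mult)
    finally show ?thesis using K0 by (rule mult_left_mono)
  qed
  have "tail_bound a b a0 b0 (int n) (K * q ^ n)" for n
    using K[of n] le[of n] unfolding tail_bound_def by (meson order_trans)
  then show "\<exists>K. \<forall>n. tail_bound a b a0 b0 (int n) (K * q ^ n)" by blast
qed

theorem theorem2p1:
  fixes r :: nat and c :: "nat \<Rightarrow> real" and a b :: "int \<Rightarrow> real \<Rightarrow> real"
    and a0 b0 t0 t1 \<delta> C :: real
  assumes "a0 > 0"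
    and "c 0 = 1" and "c (r + 1) = 0"
    and "\<forall>n t. (a n t)\<^sup>2 \<noteq> 0"
    and "\<forall>t. bounded (range (\<lambda>n. a n t)) \<and> bounded (range (\<lambda>n. b n t))"
    and "toda_hierarchy r c a b"
    and "\<exists>t. (\<lambda>n. \<bar>real_of_int n\<bar> * (\<bar>a n t - a0\<bar> + \<bar>b n t - b0\<bar>)) summable_on UNIV"
    and "t0 < t1" and "\<delta> > 0"
    and "\<forall>t\<in>{t0, t1}. \<forall>M::int. M > 0 \<longrightarrow>
      (\<lambda>n. \<bar>a n t - a0\<bar> + \<bar>b n t - b0\<bar>) summable_on {M..} \<and>
      (\<Sum>\<^sub>\<infinity>n\<in>{M..}. \<bar>a n t - a0\<bar> + \<bar>b n t - b0\<bar>)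
        \<le> C * (1 / real_of_int M powr ((1 + \<delta>) * 2 * real_of_int M))"
  shows "(\<forall>n t. \<bar>a n t\<bar> = a0 \<and> b n t = b0) \<and>
    ((\<forall>n t. a n t > 0) \<longrightarrow> (\<forall>n t. a n t = a0 \<and> b n t = b0))"
proof -
  note toda = \<open>toda_hierarchy r c a b\<close>
  obtain M0 where M0: "\<And>n t. \<bar>a n t\<bar> \<le> M0" "\<And>n t. \<bar>b n t\<bar> \<le> M0"
    using toda_uniformly_bounded[OF toda assms(5)] by blast
  define M where "M = max M0 (max a0 \<bar>b0\<bar>)"
  have bnd: "\<And>n t. \<bar>a n t\<bar> \<le> M" "\<And>n t. \<bar>b n t\<bar> \<le> M" "a0 > 0" "a0 \<le> M" "\<bar>b0\<bar> \<le> M"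
    using M0 assms(1) by (auto simp: M_def le_max_iff_disj)
  have a0M: "\<bar>a0\<bar> \<le> M" using bnd by simp
  define s where "s = r + 1"
  have sS: "s = Suc r" by (simp add: s_def)
  define R0 where "R0 = (12 * M + 8) / a0 + 2"
  define \<rho> where "\<rho> t = refl_coef (\<lambda>n. a n t) (\<lambda>n. b n t) a0 b0" for t
  have fac: "\<exists>K. \<forall>n. tail_bound (\<lambda>n. a n t) (\<lambda>n. b n t) a0 b0 (int n) (K * (\<epsilon> ^ (2 * n) / fact (2 * n)))"
    if "t \<in> {t0, t1}" "\<epsilon> > 0" for t \<epsilon>
    by (rule tail_bound_of_decay[where M = M and \<delta> = \<delta> and C = C]) (use bnd that assms(9,10) in auto)
  have rapid: "rapid_decay (\<lambda>n. a n t) (\<lambda>n. b n t) a0 b0" if "t \<in> {t0, t1}" for t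
    by (rule rapid_decay_of_factorial) (use fac that in blast)
  have hol: "\<rho> t holomorphic_on {\<zeta>. R0 < norm \<zeta>}" if "t \<in> {t0, t1}" for t
    unfolding \<rho>_def R0_def by (rule refl_coef_holomorphic) (use bnd rapid that in auto)
  have growth: "\<exists>C. \<forall>\<zeta>. R0 \<le> norm \<zeta> \<longrightarrow> norm (\<rho> t \<zeta>) \<le> C * exp (\<epsilon> * norm \<zeta>)" if "t \<in> {t0, t1}" "\<epsilon> > 0" for t \<epsilon>
    unfolding \<rho>_def R0_def by (rule refl_coef_growth) (use bnd fac that in auto)
  have evol: "\<rho> t \<zeta> = exp (dispersion c s a0 b0 \<zeta> * of_real (t - t0)) * \<rho> t0 \<zeta>" if "R0 \<le> norm \<zeta>" for t \<zeta>
    unfolding \<rho>_def s_def using that rapid[of t0]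
    by (intro refl_coef_evolution[OF toda bnd]) (auto simp: R0_def)
  obtain R1 \<kappa> where R1: "\<kappa> > 0" "\<And>r \<theta>. R1 \<le> r \<Longrightarrow> sqrt 2 / 2 \<le> \<bar>cos (real s * \<theta>)\<bar> \<Longrightarrow>
    \<kappa> * r \<le> \<bar>Re (dispersion c s a0 b0 (of_real r * cis \<theta>))\<bar>"
    by (rule dispersion_lower[of c a0 s r b0, OF assms(2,1) sS]) blast
  define \<Delta> where "\<Delta> = t1 - t0"
  have \<Delta>: "\<Delta> > 0" using assms(8) by (simp add: \<Delta>_def)
  \<comment> \<open>Two factors of growth \<open>exp (\<epsilon> * r)\<close> cost
    \<open>\<kappa> * \<Delta> / 2\<close> of the gain \<open>\<kappa> * \<Delta>\<close> in the
    exponent; the other half remains as the decay rate of \<open>Q\<close>.\<close>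
  define \<epsilon> where "\<epsilon> = \<kappa> * \<Delta> / 4"
  have \<epsilon>: "\<epsilon> > 0" using R1 \<Delta> by (simp add: \<epsilon>_def)
  obtain C0 C1 where C01: "\<And>\<zeta>. R0 \<le> norm \<zeta> \<Longrightarrow> norm (\<rho> t0 \<zeta>) \<le> C0 * exp (\<epsilon> * norm \<zeta>)"
    "\<And>\<zeta>. R0 \<le> norm \<zeta> \<Longrightarrow> norm (\<rho> t1 \<zeta>) \<le> C1 * exp (\<epsilon> * norm \<zeta>)"
    using growth[of t0 \<epsilon>] growth[of t1 \<epsilon>] \<epsilon> by auto
  define K where "K = max C0 C1"
  have \<rho>K: "norm (\<rho> t \<zeta>) \<le> K * exp (\<epsilon> * norm \<zeta>)" if "t \<in> {t0, t1}" "R0 \<le> norm \<zeta>" for t \<zeta>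
  proof -
    have "C0 * exp (\<epsilon> * norm \<zeta>) \<le> K * exp (\<epsilon> * norm \<zeta>)" "C1 * exp (\<epsilon> * norm \<zeta>) \<le> K * exp (\<epsilon> * norm \<zeta>)"
      by (auto simp: K_def)
    from order_trans[OF C01(1)[OF that(2)] this(1)] order_trans[OF C01(2)[OF that(2)] this(2)]
    show ?thesis using that(1) by blast
  qed
  \<comment> \<open>On a good ray the smaller factor equals the larger one times
    \<open>exp (- (\<bar>\<alpha>\<bar> * \<Delta>))\<close>, whichever of the two times it belongs
    to. The product is thus small for either sign of \<alpha>, and it is still holomorphic.\<close>
  define Q where "Q \<zeta> = \<rho> t0 \<zeta> * \<rho> t1 \<zeta>" for \<zeta>
  define R where "R = max (max R0 R1) 0"
  have R: "R0 \<le> R" "R1 \<le> R" "0 \<le> R" by (auto simp: R_def)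
  have sq: "norm x * norm y \<le> K\<^sup>2 * exp (2 * \<epsilon> * u)"
    if "norm x \<le> K * exp (\<epsilon> * u)" "norm y \<le> K * exp (\<epsilon> * u)" for x y :: complex and u
  proof -
    have "norm x * norm y \<le> (K * exp (\<epsilon> * u)) * (K * exp (\<epsilon> * u))"
      using that by (intro mult_mono) (auto intro: order_trans[OF norm_ge_zero])
    also have "\<dots> = K\<^sup>2 * exp (2 * \<epsilon> * u)"
      by (simp add: power2_eq_square exp_add[symmetric])
    finally show ?thesis .
  qed
  have zero: "\<rho> t0 \<zeta> = 0" if \<zeta>: "R < norm \<zeta>" for \<zeta>
  proof -
    have "Q \<zeta> = 0"
    proof (rule flat_at_infinity[where Q = Q and R = R and \<zeta> = \<zeta> and C = "K\<^sup>2" and B = "2 * \<epsilon>" and c = "\<kappa> * \<Delta> / 2" and s = s])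
      have "Q holomorphic_on {\<zeta>. R0 < norm \<zeta>}"
        unfolding Q_def[abs_def] by (intro holomorphic_on_mult hol) auto
      then show "Q holomorphic_on {\<zeta>. R < norm \<zeta>}"
        by (rule holomorphic_on_subset) (use R in auto)
      show "norm (Q w) \<le> K\<^sup>2 * exp (2 * \<epsilon> * norm w)" if "R < norm w" for w
        unfolding Q_def norm_mult using that R by (intro sq \<rho>K) auto
      fix x \<theta> assume x: "R < x" and good: "sqrt 2 / 2 \<le> \<bar>cos (real s * \<theta>)\<bar>"
      define w where "w = of_real x * cis \<theta>"
      define \<alpha> where "\<alpha> = Re (dispersion c s a0 b0 w)"
      have nw: "norm w = x" using x R by (simp add: w_def norm_mult)
      have w0: "R0 \<le> norm w" using nw x R by simp
      have \<alpha>: "\<kappa> * x \<le> \<bar>\<alpha>\<bar>" unfolding \<alpha>_def w_def using x R good by (intro R1) auto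
      have ev: "norm (\<rho> t1 w) = exp (\<alpha> * \<Delta>) * norm (\<rho> t0 w)"
        unfolding evol[OF w0, of t1] norm_mult norm_exp_eq_Re by (simp add: \<alpha>_def \<Delta>_def)
      have "norm (Q w) \<le> K\<^sup>2 * exp (2 * \<epsilon> * x) * exp (- (\<bar>\<alpha>\<bar> * \<Delta>))"
      proof (cases "\<alpha> \<ge> 0")
        case True
        have "norm (\<rho> t0 w) = norm (\<rho> t1 w) * exp (- (\<bar>\<alpha>\<bar> * \<Delta>))"
          unfolding ev using True by (simp add: exp_minus)
        then have "norm (Q w) = norm (\<rho> t1 w) * norm (\<rho> t1 w) * exp (- (\<bar>\<alpha>\<bar> * \<Delta>))"
          by (simp add: Q_def norm_mult)
        also have "\<dots> \<le> K\<^sup>2 * exp (2 * \<epsilon> * x) * exp (- (\<bar>\<alpha>\<bar> * \<Delta>))"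
          unfolding nw[symmetric] using w0 by (intro mult_right_mono sq \<rho>K) auto
        finally show ?thesis .
      next
        case False
        have "norm (\<rho> t1 w) = norm (\<rho> t0 w) * exp (- (\<bar>\<alpha>\<bar> * \<Delta>))"
          unfolding ev using False by simp
        then have "norm (Q w) = norm (\<rho> t0 w) * norm (\<rho> t0 w) * exp (- (\<bar>\<alpha>\<bar> * \<Delta>))"
          by (simp add: Q_def norm_mult)
        also have "\<dots> \<le> K\<^sup>2 * exp (2 * \<epsilon> * x) * exp (- (\<bar>\<alpha>\<bar> * \<Delta>))"
          unfolding nw[symmetric] using w0 by (intro mult_right_mono sq \<rho>K) auto
        finally show ?thesis .
      qed
      also have "\<dots> = K\<^sup>2 * exp (2 * \<epsilon> * x - \<bar>\<alpha>\<bar> * \<Delta>)"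
        by (simp add: exp_diff exp_minus divide_inverse)
      also have "\<dots> \<le> K\<^sup>2 * exp (- (\<kappa> * \<Delta> / 2) * x)"
      proof (intro mult_left_mono)
        have "\<kappa> * x * \<Delta> \<le> \<bar>\<alpha>\<bar> * \<Delta>" using \<alpha> \<Delta> by (intro mult_right_mono) auto
        then show "exp (2 * \<epsilon> * x - \<bar>\<alpha>\<bar> * \<Delta>) \<le> exp (- (\<kappa> * \<Delta> / 2) * x)"
          by (simp add: \<epsilon>_def field_simps)
      qed auto
      finally show "norm (Q (of_real x * cis \<theta>)) \<le> K\<^sup>2 * exp (- (\<kappa> * \<Delta> / 2) * x)" by (simp add: w_def)
    qed (use R \<epsilon> R1 \<Delta> \<zeta> in \<open>auto simp: s_def\<close>)
    \<comment> \<open>By the evolution law \<open>Q\<close> is a nonvanishing factor times the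
      square of \<open>\<rho> t0\<close>, so its vanishing already kills the reflection coefficient
      at \<open>t0\<close> and then at all times.\<close>
    moreover have "Q \<zeta> = exp (dispersion c s a0 b0 \<zeta> * of_real (t1 - t0)) * (\<rho> t0 \<zeta> * \<rho> t0 \<zeta>)"
      unfolding Q_def evol[of \<zeta> t1, OF order_trans[OF R(1) less_imp_le[OF \<zeta>]]] by (rule mult.left_commute)
    ultimately show ?thesis by simp
  qed
  have triv: "\<bar>a n t\<bar> = a0 \<and> b n t = b0" for n t
  proof -
    interpret jacobi_tail "\<lambda>n. a n t" "\<lambda>n. b n t" M a0 b0
    proof
      show "rapid_decay (\<lambda>n. a n t) (\<lambda>n. b n t) a0 b0"
        by (rule toda_rapid_decay[OF toda bnd(1,2) a0M bnd(5) rapid[of t0]]) simp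
      show "a n t \<noteq> 0" for n using assms(4) by auto
    qed (use bnd in auto)
    show ?thesis
    proof (rule reflectionless_trivial[of "R + 1"])
      fix \<zeta> :: complex assume z: "R + 1 \<le> norm \<zeta>"
      then have "\<rho> t \<zeta> = exp (dispersion c s a0 b0 \<zeta> * of_real (t - t0)) * \<rho> t0 \<zeta>"
        using R by (intro evol) linarith
      moreover have "\<rho> t0 \<zeta> = 0" using z by (intro zero) linarith
      ultimately show "refl_coef (\<lambda>n. a n t) (\<lambda>n. b n t) a0 b0 \<zeta> = 0" by (simp add: \<rho>_def)
    qed
  qed
  \<comment> \<open>Positivity serves to pass from the modulus of \<open>a n t\<close> to
    \<open>a n t\<close> itself.\<close>
  moreover have "a n t = a0" if "a n t > 0" for n t
    using triv[of n t] that by simp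
  ultimately show ?thesis by blast
qed

end
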